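(* Let $\lambda\in\mathcal I$ be $k$-singular. Then the eigenvalue polynomial $f_\lambda$ of the Capelli operator $D_\lambda$ is $$f_\lambda=\frac{4(\lambda_1-\lambda_2-k-1)}{H'_{\lambda^\dagger}(k)}\,P_{\lambda^\dagger}^k,$$ where $H'_{\lambda^\dagger}(k)$ denotes the derivative of $H_{\lambda^\dagger}(\kappa)$ with respect to $\kappa$ at $\kappa=k$.
   Context: Setting. Let $V=V_{\bar 0}\oplus V_{\bar 1}$ be a complex vector superspace with $\dim V_{\bar 0}=2m$, $\dim V_{\bar 1}=2n$, where $m,n$ are positive integers and $k:=n-m\ge 0$, equipped with a non-degenerate even supersymmetric bilinear form $\omega$. Let $\mathfrak g:=\mathfrak{gosp}(V,\omega):=\mathfrak{osp}(V,\omega)\oplus\mathbb C z$, with $z$ central and acting on $V$ by $-\mathrm{id}_V$. Let $\mathcal P(V)=\bigoplus_{d\ge0}\mathcal P^d(V)\cong \mathcal S(V^* )$ be the superalgebra of superpolynomials on $V$ graded by degree, $\mathcal D(V)=\bigoplus_{d\ge 0}\mathcal D^d(V)\cong\mathcal S(V)$ the superalgebra of constant-coefficient superdifferential operators graded by order, and $\mathcal{PD}(V)\cong\mathcal P(V)\otimes\mathcal D(V)$ the superalgebra of superdifferential operators with superpolynomial coefficients, with $\mathfrak g$ acting by supercommutator; $\mathcal{PD}(V)^{\mathfrak g}$ is the algebra of $\mathfrak g$-invariants. Partitions. $\mathcal I:=\{(\lambda_1,\lambda_2)\in\mathbb Z^2:\lambda_1\ge\lambda_2\ge0\}$, $|\lambda|:=\lambda_1+\lambda_2$.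 An element $\lambda\in\mathcal I$ is $k$-regular if $\lambda_1\le k$ or $\lambda_1-\lambda_2=k+1$ or $\lambda_1-\lambda_2\ge 2k+3$; it is $k$-quasiregular if $\lambda_1\ge k+1$ and $\lambda_1-\lambda_2\le k$; it is $k$-singular if $k+2\le\lambda_1-\lambda_2\le 2k+2$. $\mathcal I'_k$ is the set of all $k$-regular and $k$-quasiregular elements. The involution $\lambda^\dagger:=(\lambda_2+k+1,\lambda_1-k-1)$ interchanges $k$-quasiregular and $k$-singular elements. Modules $V_\lambda$. Let $C$ be the Casimir operator of $\mathfrak g$ acting on $\mathcal P(V)$, normalized so that it acts on the irreducible $\mathfrak{osp}(V,\omega)$-module of highest weight $a\varepsilon_1$ by $a(a-2k-2)$ (here the Borel subalgebra has simple roots $\varepsilon_1-\varepsilon_2,\dots,\varepsilon_{m-1}-\varepsilon_m,\varepsilon_m-\delta_1,\dots,\delta_{n-1}-\delta_n,2\delta_n$). For $\lambda\in\mathcal I'_k$ put $c_\lambda:=(\lambda_1-\lambda_2)(\lambda_1-\lambda_2-2k-2)$ and let $V_\lambda$ be the generalized $c_\lambda$-eigenspace of $C$ on $\mathcal P^{|\lambda|}(V)$. Each $V_\lambda$ is an indecomposable $\mathfrak g$-module, $\mathcal P^d(V)=\bigoplus_{\lambda\in\mathcal I'_k,|\lambda|=d}V_\lambda$, and distinct $V_\lambda$ share no composition factors. The pairing $\mathcal D^d(V)\otimes\mathcal P^d(V)\to\mathbb C$, $(D,p)\mapsto Dp$, identifies $\mathcal D^d(V)\cong\mathcal P^d(V)^*$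 and hence $\mathcal{PD}(V)^{\mathfrak g}\cong\bigoplus_{\lambda\in\mathcal I'_k}\mathrm{Hom}_{\mathfrak g}(V_\lambda,V_\lambda)$. For $k$-quasiregular $\lambda$, $\mathrm{Hom}_{\mathfrak g}(V_\lambda,V_\lambda)=\mathbb C\,\mathrm{id}_{V_\lambda}\oplus\mathbb C N_\lambda$, where $N_\lambda$ is the nilpotent part of the Jordan decomposition of $C|_{V_\lambda}$ (and $N_\lambda^2=0$). Capelli operators. For $k$-singular $\lambda$, $D_\lambda\in\mathcal{PD}(V)^{\mathfrak g}$ is the element corresponding to $N_{\lambda^\dagger}\in\mathrm{Hom}_{\mathfrak g}(V_{\lambda^\dagger},V_{\lambda^\dagger})$ under this isomorphism. Every $D\in\mathcal{PD}(V)^{\mathfrak g}$ preserves each $V_\mu$ and has a single eigenvalue there; the eigenvalue polynomial of $D$ is the unique symmetric polynomial $f_D\in\mathbb C[x,y]$ such that the eigenvalue of $D$ on $V_\mu$ is $f_D(\mu_1-k-1,\mu_2)$ for all $\mu\in\mathcal I'_k$. Write $f_\lambda:=f_{D_\lambda}$. Knop–Sahi polynomials. With $a^{\underline r}:=a(a-1)\cdots(a-r+1)$, for $\lambda\in\mathcal I$ let $P_\lambda^\kappa\in\mathbb Q(\kappa)[x,y]$ be $$P_\lambda^\kappa(x,y):=\sum_{i+j\le\lambda_1-\lambda_2}\frac{(\lambda_1-\lambda_2)!\,(\kappa+1)^{\underline{\lambda_1-\lambda_2-i}}(\kappa+1)^{\underline{\lambda_1-\lambda_2-j}}}{i!\,j!\,(\lambda_1-\lambda_2-i-j)!\,(\kappa+1)^{\underline{\lambda_1-\lambda_2}}}\,x^{\underline{\lambda_2+i}}y^{\underline{\lambda_2+j}}$$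 (sum over $i,j\ge0$), and $H_\lambda(\kappa):=(\lambda_1-\lambda_2)!\,\lambda_2!\,(\lambda_1-1-\kappa)^{\underline{\lambda_2}}$. The coefficients of $P^\kappa_\lambda$ have no pole at $\kappa=k$ when $\lambda$ is not $k$-singular; $P_\lambda^k$ denotes the specialization at $\kappa=k$. *)

theory Defs
  imports
    "HOL-Analysis.Analysis"
    "HOL-Library.Poly_Mapping"
    "HOL-Computational_Algebra.Polynomial"
    "HOL-Computational_Algebra.Fraction_Field"
begin

section \<open>The superspace and the Lie superalgebra\<close>

text \<open>
  The superspace \<open>V\<close> is \<open>complex ^ ('a + 'b)\<close>: the indices \<open>Inl i\<close> label a basis of the even
  part and the indices \<open>Inr j\<close> a basis of the odd part.  Endomorphisms of \<open>V\<close> are matrices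
  acting by \<open>*v\<close>.  Parities are represented by the numbers 0 and 1.
\<close>

type_synonym ('a, 'b) svec = "complex ^ ('a + 'b)"
type_synonym ('a, 'b) smat = "complex ^ ('a + 'b) ^ ('a + 'b)"
type_synonym ('a, 'b) sform = "('a, 'b) svec \<Rightarrow> ('a, 'b) svec \<Rightarrow> complex"

definition par :: "'a + 'b \<Rightarrow> nat" where
  "par i = (case i of Inl _ \<Rightarrow> 0 | Inr _ \<Rightarrow> 1)"

definition hom_vec :: "nat \<Rightarrow> ('a::finite, 'b::finite) svec \<Rightarrow> bool" where
  "hom_vec s v \<longleftrightarrow> (\<forall>i. v $ i \<noteq> 0 \<longrightarrow> par i = s)"

definition hom_mat :: "nat \<Rightarrow> ('a::finite, 'b::finite) smat \<Rightarrow> bool" where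
  "hom_mat s X \<longleftrightarrow> (\<forall>i j. X $ i $ j \<noteq> 0 \<longrightarrow> (par i + par j) mod 2 = s)"

definition nondeg_even_supersym :: "('a::finite, 'b::finite) sform \<Rightarrow> bool" where
  "nondeg_even_supersym \<omega> \<longleftrightarrow>
     (\<forall>v. Vector_Spaces.linear (*s) (*) (\<omega> v)) \<and>
     (\<forall>w. Vector_Spaces.linear (*s) (*) (\<lambda>v. \<omega> v w)) \<and>
     (\<forall>v w. hom_vec 0 v \<and> hom_vec 1 w \<longrightarrow> \<omega> v w = 0 \<and> \<omega> w v = 0) \<and>
     (\<forall>s\<in>{0, 1}. \<forall>t\<in>{0, 1}. \<forall>v w. hom_vec s v \<and> hom_vec t w \<longrightarrow>
        \<omega> v w = (-1) ^ (s * t) * \<omega> w v) \<and>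
     (\<forall>v. (\<forall>w. \<omega> v w = 0) \<longrightarrow> v = 0)"

definition osp_hom :: "('a::finite, 'b::finite) sform \<Rightarrow> nat \<Rightarrow> ('a, 'b) smat set" where
  "osp_hom \<omega> s = {X. hom_mat s X \<and>
     (\<forall>t\<in>{0, 1}. \<forall>v w. hom_vec t v \<longrightarrow>
        \<omega> (X *v v) w + (-1) ^ (s * t) * \<omega> v (X *v w) = 0)}"

definition osp :: "('a::finite, 'b::finite) sform \<Rightarrow> ('a, 'b) smat set" where
  "osp \<omega> = {A + B | A B. A \<in> osp_hom \<omega> 0 \<and> B \<in> osp_hom \<omega> 1}"

text \<open>
  The central element \<open>z\<close> acts on \<open>V\<close> by \<open>-1\<close>.  Since \<open>osp\<close> contains no nonzero scalar matrix,
  \<open>gosp\<close> acts faithfully on \<open>V\<close>, and we identify it with its image.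
\<close>

definition gosp_hom :: "('a::finite, 'b::finite) sform \<Rightarrow> nat \<Rightarrow> ('a, 'b) smat set" where
  "gosp_hom \<omega> s =
     (if s = 0 then {A + mat (- c) | A c. A \<in> osp_hom \<omega> 0} else osp_hom \<omega> s)"

definition supertrace :: "('a::finite, 'b::finite) smat \<Rightarrow> complex" where
  "supertrace X = (\<Sum>i\<in>UNIV. (-1) ^ par i * X $ i $ i)"


section \<open>Superpolynomials and superdifferential operators\<close>

text \<open>
  Superpolynomials are written in the basis of monomials \<open>x^\<alpha> \<xi>_S\<close>, where \<open>x_i\<close> and \<open>\<xi>_j\<close> are the
  even and odd coordinate functions of \<open>V\<close> and \<open>\<xi>_S\<close> is the product of the \<open>\<xi>_s\<close> over \<open>s \<in> S\<close> in
  increasing order; \<open>(\<alpha>, S)\<close> encodes \<open>x^\<alpha> \<xi>_S\<close>.  The order on \<open>'b\<close> only serves to fix signs.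
\<close>

type_synonym ('a, 'b) smon = "('a \<Rightarrow> nat) \<times> 'b set"
type_synonym ('a, 'b) spoly = "('a, 'b) smon \<Rightarrow>\<^sub>0 complex"
type_synonym ('a, 'b) sop = "('a, 'b) spoly \<Rightarrow> ('a, 'b) spoly"

definition sp_scale :: "complex \<Rightarrow> ('a, 'b) spoly \<Rightarrow> ('a, 'b) spoly" where
  "sp_scale c p = Poly_Mapping.map (\<lambda>x. c * x) p"

lemma lookup_sp_scale [simp]:
  "Poly_Mapping.lookup (sp_scale c p) u = c * Poly_Mapping.lookup p u"
  by (simp add: sp_scale_def map.rep_eq when_def)

global_interpretation spoly: vector_space "sp_scale :: complex \<Rightarrow> ('a, 'b) spoly \<Rightarrow> ('a, 'b) spoly"
  by unfold_locales (auto simp: lookup_add algebra_simps intro!: poly_mapping_eqI)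

definition lin_ext :: "(('a, 'b) smon \<Rightarrow> ('a, 'b) spoly) \<Rightarrow> ('a, 'b) sop" where
  "lin_ext g p = (\<Sum>u\<in>Poly_Mapping.keys p. sp_scale (Poly_Mapping.lookup p u) (g u))"

definition hom_spolys :: "nat \<Rightarrow> ('a::finite, 'b::finite) spoly set" where
  "hom_spolys d =
     {p. \<forall>(\<alpha>, S)\<in>Poly_Mapping.keys p. (\<Sum>i\<in>UNIV. \<alpha> i) + card S = d}"

text \<open>Left multiplication by the coordinate functions, and the left partial derivatives.\<close>

definition coord_mult :: "'a + 'b \<Rightarrow> ('a::finite, 'b::{finite, linorder}) sop" where
  "coord_mult i = lin_ext (\<lambda>(\<alpha>, S).
     (case i of
        Inl a \<Rightarrow> Poly_Mapping.single (\<alpha>(a := \<alpha> a + 1), S) 1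
      | Inr b \<Rightarrow> if b \<in> S then 0
                 else Poly_Mapping.single (\<alpha>, insert b S) ((-1) ^ card {s \<in> S. s < b})))"

definition coord_deriv :: "'a + 'b \<Rightarrow> ('a::finite, 'b::{finite, linorder}) sop" where
  "coord_deriv i = lin_ext (\<lambda>(\<alpha>, S).
     (case i of
        Inl a \<Rightarrow> Poly_Mapping.single (\<alpha>(a := \<alpha> a - 1), S) (of_nat (\<alpha> a))
      | Inr b \<Rightarrow> if b \<in> S
                 then Poly_Mapping.single (\<alpha>, S - {b}) ((-1) ^ card {s \<in> S. s < b})
                 else 0))"

text \<open>
  Superdifferential operators are realised by their (faithful) action on superpolynomials.
  \<open>pd_part d e\<close> is the image of \<open>P^d \<otimes> D^e\<close>: the span of the operators \<open>p D\<close>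
  with \<open>p\<close> a monomial of degree \<open>d\<close> and \<open>D\<close> a product of \<open>e\<close> partial derivatives; \<open>pd\<close> is the sum
  of all of these.
\<close>

definition pd_part :: "nat \<Rightarrow> nat \<Rightarrow> ('a::finite, 'b::{finite, linorder}) sop set" where
  "pd_part d e = {D. \<exists>c. D = (\<lambda>p.
     \<Sum>u | length u = d. \<Sum>w | length w = e.
       sp_scale (c u w) (foldr coord_mult u (foldr coord_deriv w p)))}"

definition pd :: "('a::finite, 'b::{finite, linorder}) sop set" where
  "pd = {D. \<exists>N F. (\<forall>d\<le>N. \<forall>e\<le>N. F d e \<in> pd_part d e) \<and>
     D = (\<lambda>p. \<Sum>d\<le>N. \<Sum>e\<le>N. F d e p)}"

text \<open>
  The action of an endomorphism \<open>X\<close> of \<open>V\<close>: the superderivation of the superpolynomials extending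
  the contragredient action on the dual of \<open>V\<close>.  For homogeneous \<open>X\<close> and the coordinate function
  \<open>x_i\<close> one has \<open>(X \<cdot> x_i)(v) = - (-1)^(|X||i|) x_i (X v)\<close>, that is
  \<open>X \<cdot> x_i = - (-1)^(|X||i|) (\<Sum>j. X_ij x_j)\<close>, and \<open>|X| = |i| + |j|\<close> whenever \<open>X_ij\<close> is nonzero.
\<close>

definition gl_action :: "('a::finite, 'b::{finite, linorder}) smat \<Rightarrow> ('a, 'b) sop" where
  "gl_action X p = (\<Sum>i\<in>UNIV. \<Sum>j\<in>UNIV.
     sp_scale (- ((-1) ^ ((par i + par j) * par i)) * X $ i $ j) (coord_mult j (coord_deriv i p)))"

text \<open>
  For a homogeneous operator \<open>D\<close>, conjugation by the parity automorphism is multiplication by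
  \<open>(-1)^|D|\<close>; hence \<open>supercomm s A D\<close> is the supercommutator of \<open>A\<close>, homogeneous of parity \<open>s\<close>,
  with an arbitrary \<open>D\<close>.
\<close>

definition parity_aut :: "('a::finite, 'b::finite) sop" where
  "parity_aut = lin_ext (\<lambda>(\<alpha>, S). Poly_Mapping.single (\<alpha>, S) ((-1) ^ card S))"

definition supercomm ::
    "nat \<Rightarrow> ('a::finite, 'b::finite) sop \<Rightarrow> ('a, 'b) sop \<Rightarrow> ('a, 'b) sop" where
  "supercomm s A D =
     (\<lambda>p. A (D p) - (parity_aut ^^ s) (D ((parity_aut ^^ s) (A p))))"

definition pd_invariants ::
    "('a::finite, 'b::{finite, linorder}) sform \<Rightarrow> ('a, 'b) sop set" where
  "pd_invariants \<omega> =
     {D \<in> pd. \<forall>s\<in>{0, 1}. \<forall>X\<in>gosp_hom \<omega> s. supercomm s (gl_action X) D = (\<lambda>p. 0)}"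


section \<open>The Casimir operator and the modules\<close>

text \<open>
  The Casimir operator is formed with dual bases of \<open>osp\<close> for the invariant form
  \<open>(X, Y) = supertrace (X ** Y) / 2\<close>.  The factor 1/2 is the normalisation for which the operator
  acts on the irreducible module of highest weight \<open>a \<epsilon>_1\<close> by \<open>a (a - 2 k - 2)\<close>: the form
  induced on weights then has \<open>(\<epsilon>_i, \<epsilon>_j) = \<delta>_ij\<close> and \<open>(\<delta>_i, \<delta>_j) = - \<delta>_ij\<close>, and, in dimension
  \<open>2 m | 2 n\<close>, \<open>(\<epsilon>_1, 2 \<rho>) = 2 m - 2 n - 2 = - 2 k - 2\<close>, so the eigenvalue is
  \<open>(a \<epsilon>_1, a \<epsilon>_1 + 2 \<rho>)\<close>.
  No signs appear because the dual element is the first argument of the form.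
\<close>

definition casimir :: "('a::finite, 'b::{finite, linorder}) sform \<Rightarrow> ('a, 'b) sop" where
  "casimir \<omega> = (THE C. \<exists>(r::nat) E F.
     (\<forall>i<r. E i \<in> osp \<omega> \<and> F i \<in> osp \<omega>) \<and>
     (\<forall>X\<in>osp \<omega>. \<exists>c. X = (\<chi> a b. \<Sum>i<r. c i * E i $ a $ b)) \<and>
     (\<forall>i<r. \<forall>j<r. supertrace (F i ** E j) / 2 = (if i = j then 1 else 0)) \<and>
     C = (\<lambda>p. \<Sum>i<r. gl_action (E i) (gl_action (F i) p)))"

definition two_partitions :: "(nat \<times> nat) set" where
  "two_partitions = {(a, b). b \<le> a}"

definition wt :: "nat \<times> nat \<Rightarrow> nat" where
  "wt l = fst l + snd l"

definition k_regular :: "nat \<Rightarrow> nat \<times> nat \<Rightarrow> bool" where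
  "k_regular k l \<longleftrightarrow> l \<in> two_partitions \<and>
     (fst l \<le> k \<or> fst l - snd l = k + 1 \<or> fst l - snd l \<ge> 2 * k + 3)"

definition k_quasiregular :: "nat \<Rightarrow> nat \<times> nat \<Rightarrow> bool" where
  "k_quasiregular k l \<longleftrightarrow> l \<in> two_partitions \<and> fst l \<ge> k + 1 \<and> fst l - snd l \<le> k"

definition k_singular :: "nat \<Rightarrow> nat \<times> nat \<Rightarrow> bool" where
  "k_singular k l \<longleftrightarrow> l \<in> two_partitions \<and>
     k + 2 \<le> fst l - snd l \<and> fst l - snd l \<le> 2 * k + 2"

definition index_set :: "nat \<Rightarrow> (nat \<times> nat) set" where
  "index_set k = {l. k_regular k l \<or> k_quasiregular k l}"

text \<open>The subtraction does not truncate on quasiregular and singular elements.\<close>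

definition dagger :: "nat \<Rightarrow> nat \<times> nat \<Rightarrow> nat \<times> nat" where
  "dagger k l = (snd l + k + 1, fst l - (k + 1))"

definition gen_eigenspace :: "('a, 'b) spoly set \<Rightarrow> ('a, 'b) sop \<Rightarrow> complex \<Rightarrow> ('a, 'b) spoly set" where
  "gen_eigenspace W T c = {p \<in> W. \<exists>N::nat. ((\<lambda>q. T q - sp_scale c q) ^^ N) p = 0}"

definition cas_eig :: "nat \<Rightarrow> nat \<times> nat \<Rightarrow> complex" where
  "cas_eig k l = of_int ((int (fst l) - int (snd l)) * (int (fst l) - int (snd l) - 2 * int k - 2))"

definition V_mod ::
    "('a::finite, 'b::{finite, linorder}) sform \<Rightarrow> nat \<Rightarrow> nat \<times> nat \<Rightarrow> ('a, 'b) spoly set" where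
  "V_mod \<omega> k l = gen_eigenspace (hom_spolys (wt l)) (casimir \<omega>) (cas_eig k l)"


section \<open>Capelli operators and eigenvalue polynomials\<close>

definition jordan_decomposition ::
    "('a, 'b) spoly set \<Rightarrow> ('a, 'b) sop \<Rightarrow> ('a, 'b) sop \<Rightarrow> ('a, 'b) sop \<Rightarrow> bool" where
  "jordan_decomposition W T S N \<longleftrightarrow>
     Vector_Spaces.linear sp_scale sp_scale S \<and> Vector_Spaces.linear sp_scale sp_scale N \<and>
     (\<forall>p\<in>W. S p \<in> W \<and> N p \<in> W \<and> T p = S p + N p \<and> S (N p) = N (S p)) \<and>
     W \<subseteq> spoly.span {p \<in> W. \<exists>c. S p = sp_scale c p} \<and>
     (\<exists>r::nat. \<forall>p\<in>W. (N ^^ r) p = 0)"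

text \<open>Only the values on \<open>W\<close> are meaningful; there the nilpotent part is unique.\<close>

definition nilpotent_part :: "('a, 'b) spoly set \<Rightarrow> ('a, 'b) sop \<Rightarrow> ('a, 'b) sop" where
  "nilpotent_part W T = (SOME N. \<exists>S. jordan_decomposition W T S N)"

text \<open>
  The invariant operator corresponding to an element \<open>T\<close> of \<open>Hom(V_l, V_l)\<close>.  With \<open>D^d\<close> identified
  with the dual of \<open>P^d\<close>, the operator \<open>p D\<close> in \<open>P^d D^d\<close> corresponds to the map \<open>q \<mapsto> p (D q)\<close>
  of \<open>P^d\<close>, which is just the restriction of \<open>p D\<close> to \<open>P^d\<close>.
\<close>

definition op_of_hom ::
    "('a::finite, 'b::{finite, linorder}) sform \<Rightarrow> nat \<Rightarrow> nat \<times> nat \<Rightarrow> ('a, 'b) sop \<Rightarrow> ('a, 'b) sop" where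
  "op_of_hom \<omega> k l T = (THE D. D \<in> pd_invariants \<omega> \<and> D \<in> pd_part (wt l) (wt l) \<and>
     (\<forall>p\<in>V_mod \<omega> k l. D p = T p) \<and>
     (\<forall>\<mu>\<in>index_set k. wt \<mu> = wt l \<and> \<mu> \<noteq> l \<longrightarrow> (\<forall>p\<in>V_mod \<omega> k \<mu>. D p = 0)))"

definition capelli_op ::
    "('a::finite, 'b::{finite, linorder}) sform \<Rightarrow> nat \<Rightarrow> nat \<times> nat \<Rightarrow> ('a, 'b) sop" where
  "capelli_op \<omega> k l = op_of_hom \<omega> k (dagger k l)
     (nilpotent_part (V_mod \<omega> k (dagger k l)) (casimir \<omega>))"

definition has_single_eigenvalue :: "('a, 'b) sop \<Rightarrow> ('a, 'b) spoly set \<Rightarrow> complex \<Rightarrow> bool" where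
  "has_single_eigenvalue D W c \<longleftrightarrow>
     D ` W \<subseteq> W \<and> {e. \<exists>p\<in>W. p \<noteq> 0 \<and> D p = sp_scale e p} = {c}"

text \<open>
  Polynomials in \<open>x\<close> and \<open>y\<close> are represented as polynomials in \<open>y\<close> whose coefficients are
  polynomials in \<open>x\<close>.
\<close>

definition poly2 :: "'c::comm_ring_1 poly poly \<Rightarrow> 'c \<Rightarrow> 'c \<Rightarrow> 'c" where
  "poly2 f x y = poly (poly f [:y:]) x"

definition symmetric2 :: "'c::comm_ring_1 poly poly \<Rightarrow> bool" where
  "symmetric2 f \<longleftrightarrow> (\<forall>i j. coeff (coeff f i) j = coeff (coeff f j) i)"

definition eigenvalue_poly ::
    "('a::finite, 'b::{finite, linorder}) sform \<Rightarrow> nat \<Rightarrow> ('a, 'b) sop \<Rightarrow> complex poly poly" where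
  "eigenvalue_poly \<omega> k D = (THE f. symmetric2 f \<and>
     (\<forall>\<mu>\<in>index_set k. has_single_eigenvalue D (V_mod \<omega> k \<mu>)
        (poly2 f (of_nat (fst \<mu>) - of_nat k - 1) (of_nat (snd \<mu>)))))"


section \<open>Knop--Sahi polynomials\<close>

definition ffact :: "'c::comm_ring_1 \<Rightarrow> nat \<Rightarrow> 'c" where
  "ffact a r = (\<Prod>i<r. a - of_nat i)"

definition knop_sahi :: "'f::field \<Rightarrow> nat \<times> nat \<Rightarrow> 'f poly poly" where
  "knop_sahi \<kappa> l = (let r = fst l - snd l in
     \<Sum>(i, j)\<in>{(i, j). i + j \<le> r}.
       smult [: of_nat (fact r) * ffact (\<kappa> + 1) (r - i) * ffact (\<kappa> + 1) (r - j) /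
                (of_nat (fact i) * of_nat (fact j) * of_nat (fact (r - i - j)) * ffact (\<kappa> + 1) r) :]
         (ffact [:[:0, 1:]:] (snd l + i) * ffact [:0, 1:] (snd l + j)))"

text \<open>
  The rational functions in \<open>\<kappa>\<close> are \<open>rat poly fract\<close>; \<open>specialize k q\<close> is the value at \<open>\<kappa> = k\<close> of
  a rational function without a pole there.
\<close>

definition kappa :: "rat poly fract" where
  "kappa = Fract [:0, 1:] 1"

definition specialize :: "rat \<Rightarrow> rat poly fract \<Rightarrow> rat" where
  "specialize t q = (THE v. \<exists>a b. q = Fract a b \<and> poly b t \<noteq> 0 \<and> v = poly a t / poly b t)"

definition knop_sahi_at :: "nat \<Rightarrow> nat \<times> nat \<Rightarrow> complex poly poly" where
  "knop_sahi_at k l =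
     map_poly (map_poly (\<lambda>q. of_rat (specialize (of_nat k) q))) (knop_sahi kappa l)"

definition H_poly :: "nat \<times> nat \<Rightarrow> rat poly" where
  "H_poly l = of_nat (fact (fst l - snd l)) * of_nat (fact (snd l)) *
     ffact (of_nat (fst l) - 1 - [:0, 1:]) (snd l)"

end

theory Submission
  imports Defs
begin

text \<open>
  Let \<open>r\<close> be the invariant quadratic form, \<open>\<Delta>\<close> the invariant Laplacian and \<open>E\<close> the Euler operator.
  From \<open>[\<Delta>, r] = 4 E - 4 k\<close> one obtains that the Casimir operator is \<open>E (E - 2 k - 2) - r \<Delta>\<close>, and
  that in degree \<open>d\<close> the operator \<open>r\<^sup>b \<Delta>\<^sup>b\<close> is the product of the \<open>r \<Delta> - t\<^sub>i\<close> over \<open>i < b\<close>, where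
  \<open>t\<^sub>i = 4 i (d - 1 - k - i)\<close> is the eigenvalue of \<open>r \<Delta>\<close> on \<open>r\<^sup>i\<close> times a harmonic superpolynomial.
  Hence every linear combination \<open>\<Sum> c\<^sub>b r\<^sup>b :E\<^sup>d\<^sup>-\<^sup>2\<^sup>b: \<Delta>\<^sup>b\<close> with normally ordered powers of \<open>E\<close> is
  an invariant operator, acts in each degree as a polynomial in \<open>r \<Delta>\<close>, and has the eigenvalue polynomial
  \<open>\<Sum> c\<^sub>b 4\<^sup>b (d - 2 b)! binomial(x + y + k + 1 - 2 b, d - 2 b) (x)\<^sub>b (y)\<^sub>b\<close> with falling factorials
  \<open>(x)\<^sub>b\<close>, \<open>(y)\<^sub>b\<close>.  The Vandermonde identity expands the Knop--Sahi polynomial of \<open>\<lambda>\<^sup>\<dagger>\<close> in precisely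
  this shape.  With the resulting \<open>c\<^sub>b\<close>, Newton interpolation factors the operator in degree
  \<open>d = |\<lambda>|\<close> as a multiple of the product of all \<open>r \<Delta> - t\<^sub>i\<close> except the one for \<open>i = \<lambda>\<^sup>\<dagger>\<^sub>2\<close>.  The omitted
  \<open>t\<^sub>i\<close> coincides with the one for \<open>i = \<lambda>\<^sub>2\<close>, so the operator is zero on the \<open>V\<^sub>\<mu>\<close> of degree \<open>d\<close> with
  \<open>\<mu> \<noteq> \<lambda>\<^sup>\<dagger>\<close>, and for \<open>\<mu> = \<lambda>\<^sup>\<dagger>\<close> it is a multiple of the nilpotent part \<open>t\<^sub>i - r \<Delta>\<close> of the Casimir
  operator.  This multiple is 1 by the choice of the constant.
\<close>

text \<open>The definite descriptions shape the proof. They require that an operator of bidegree (d,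
  d) be determined in degree d, that the Casimir operator not depend on the dual bases, and that
  regular partitions far from the diagonal determine the eigenvalue polynomial. The modules enter
  only as generalized eigenspaces of \<open>r \<Delta>\<close>, each shown to contain an honest
  eigenvector r^j h, where h is a power of an isotropic linear form. The constant arises as follows.
  Write \<lambda> = (s + k + 1, j); its dagger is (j + k + 1, s), and t_j = t_s. So the product of
  all \<open>r \<Delta> - t_i\<close> has a double root at t_s, and dropping one copy leaves
  \<open>r \<Delta> - t_s\<close> times a product R over the i different from j and s. Where the
  square of \<open>r \<Delta> - t_s\<close> vanishes, R matters only through R(t_s). Its factors
  with i > s cancel the Newton denominators. Those with i < s are 4 (s - i) (j - i), and the product
  of these j - i is what survives of the falling factorial in H when it is differentiated at its
  simple zero \<kappa> = k.\<close>

section \<open>Falling factorials and sums of Vandermonde type\<close>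

lemma ffact_0 [simp]: "ffact a 0 = 1"
  by (simp add: ffact_def)

lemma ffact_Suc: "ffact a (Suc r) = ffact a r * (a - of_nat r)"
  by (simp add: ffact_def)

lemma ffact_add: "ffact a (p + q) = ffact a p * ffact (a - of_nat p) q"
  by (induction q) (simp_all add: ffact_Suc algebra_simps)

lemma ffact_eq_pochhammer: "ffact (z + of_nat n) n = pochhammer (z + 1) n"
proof (induction n arbitrary: z)
  case (Suc n)
  have "ffact (z + of_nat (Suc n)) (Suc n) = ffact ((z + 1) + of_nat n) (n + 1)"
    by (simp add: algebra_simps)
  also have "\<dots> = pochhammer (z + 1 + 1) n * (z + 1)"
    by (subst ffact_add, subst Suc.IH) (simp add: ffact_Suc)
  also have "\<dots> = pochhammer (z + 1) (Suc n)"
    by (simp add: pochhammer_rec algebra_simps)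
  finally show ?case .
qed simp

lemma ffact_eq_gbinomial: "ffact a n = fact n * (a gchoose n)" for a :: "'c::field_char_0"
  by (simp add: ffact_def gbinomial_prod_rev atLeast0LessThan)

lemma gbinomial_trinomial_Vandermonde:
  "((a + b + c) gchoose n) =
     (\<Sum>(i, j)\<in>{(i, j). i + j \<le> n}. (a gchoose i) * (b gchoose j) * (c gchoose (n - i - j)))"
  for a b c :: "'c::field_char_0"
proof -
  have "((a + b + c) gchoose n) = (\<Sum>i\<le>n. (a gchoose i) * ((b + c) gchoose (n - i)))"
    using gbinomial_Vandermonde[of a "b + c" n] by (simp add: add.assoc atLeast0AtMost)
  also have "\<dots> = (\<Sum>i\<le>n. \<Sum>j\<le>n - i. (a gchoose i) * (b gchoose j) * (c gchoose (n - i - j)))"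
    by (simp add: gbinomial_Vandermonde[symmetric] atLeast0AtMost sum_distrib_left mult.assoc)
  also have "\<dots> = (\<Sum>(i, j)\<in>(SIGMA i:{..n}. {..n - i}). (a gchoose i) * (b gchoose j) * (c gchoose (n - i - j)))"
    by (subst sum.Sigma) auto
  also have "(SIGMA i:{..n}. {..n - i}) = {(i, j). i + j \<le> n}"
    by auto
  finally show ?thesis .
qed

text \<open>The Chu-Vandermonde evaluation of 2F1(-i, -j; z + 1; 1). Rewriting 1 /
  \<open>?h a\<close> over the common denominator \<open>?h j\<close> turns the reciprocals into
  generalized binomials, to which the Vandermonde convolution applies.\<close>

lemma pochhammer_Vandermonde:
  fixes z :: "'c::field_char_0"
  assumes "\<And>n. n \<le> j \<Longrightarrow> pochhammer (z + 1) n \<noteq> 0"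
    and "pochhammer (z + 1) i \<noteq> 0"
  shows "(\<Sum>a\<le>min i j. fact i * fact j / (fact a * fact (i - a) * fact (j - a) * pochhammer (z + 1) a))
     = pochhammer (z + 1) (i + j) / (pochhammer (z + 1) i * pochhammer (z + 1) j)"
proof -
  let ?h = "pochhammer (z + 1)"
  have *: "?h a * ffact (z + of_nat j) (j - a) = ?h j" if "a \<le> j" for a
    using that pochhammer_product'[of "z + 1" a "j - a"]
      ffact_eq_pochhammer[of "z + of_nat a" "j - a"]
    by (simp add: of_nat_diff algebra_simps)
  have "(\<Sum>a\<le>min i j. fact i * fact j / (fact a * fact (i - a) * fact (j - a) * ?h a))
      = (\<Sum>a\<le>min i j. fact j / ?h j * (of_nat (i choose a) * ((z + of_nat j) gchoose (j - a))))"
  proof (rule sum.cong)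
    fix a assume "a \<in> {..min i j}"
    then have a: "a \<le> i" "a \<le> j" by auto
    have "?h a \<noteq> 0" "?h j \<noteq> 0" using assms a by auto
    then have h: "1 / ?h a = fact (j - a) * ((z + of_nat j) gchoose (j - a)) / ?h j"
      using *[OF a(2)] by (simp add: field_simps ffact_eq_gbinomial)
    have "fact i * fact j / (fact a * fact (i - a) * fact (j - a) * ?h a) =
       fact i * fact j / (fact a * fact (i - a) * fact (j - a)) * (1 / ?h a)"
      by simp
    also have "\<dots> = fact j / ?h j * (of_nat (i choose a) * ((z + of_nat j) gchoose (j - a)))"
      unfolding h using a by (simp add: binomial_fact field_simps)
    finally show "fact i * fact j / (fact a * fact (i - a) * fact (j - a) * ?h a) =
       fact j / ?h j * (of_nat (i choose a) * ((z + of_nat j) gchoose (j - a)))" .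
  qed simp
  also have "\<dots> = fact j / ?h j * (\<Sum>a\<le>min i j. (of_nat i gchoose a) * ((z + of_nat j) gchoose (j - a)))"
    by (simp add: sum_distrib_left binomial_gbinomial)
  also have "(\<Sum>a\<le>min i j. (of_nat i gchoose a) * ((z + of_nat j) gchoose (j - a)))
     = (\<Sum>a\<le>j. (of_nat i gchoose a) * ((z + of_nat j) gchoose (j - a)))"
    by (rule sum.mono_neutral_left) (auto simp flip: binomial_gbinomial)
  also have "\<dots> = ((z + of_nat i + of_nat j) gchoose j)"
    using gbinomial_Vandermonde[of "of_nat i" "z + of_nat j" j] by (simp add: atLeast0AtMost add_ac)
  also have "fact j / ?h j * ((z + of_nat i + of_nat j) gchoose j) = ffact (z + of_nat i + of_nat j) j / ?h j"
    by (simp add: ffact_eq_gbinomial)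
  also have "ffact (z + of_nat i + of_nat j) j = pochhammer (z + 1 + of_nat i) j"
    by (subst ffact_eq_pochhammer) (simp add: algebra_simps)
  also have "\<dots> = ?h (i + j) / ?h i"
    using assms(2) by (simp add: pochhammer_product')
  finally show ?thesis by (simp add: field_simps)
qed

text \<open>
  The right-hand side has the shape of the eigenvalues of invariant operators, see
  \<open>poly_capelli_poly\<close>.
\<close>

lemma knop_sahi_row_expansion:
  fixes x y z :: "'c::field_char_0" and r :: nat
  defines "K \<equiv> z + of_nat r"
  assumes nz: "\<And>n. n \<le> r \<Longrightarrow> pochhammer (z + 1) n \<noteq> 0"
  shows "(\<Sum>(i, j)\<in>{(i, j). i + j \<le> r}.
       fact r * ffact K (r - i) * ffact K (r - j) /
         (fact i * fact j * fact (r - i - j) * ffact K r) * (ffact x i * ffact y j))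
    = (\<Sum>a\<le>r div 2. fact r / (fact a * pochhammer (z + 1) a) *
        ((x + y + K - 2 * of_nat a) gchoose (r - 2 * a)) * (ffact x a * ffact y a))"
    (is "?L = ?R")
proof -
  let ?h = "pochhammer (z + 1)"
  have fin: "finite {(i, j). i + j \<le> (n::nat)}" for n
    by (rule finite_subset[of _ "{..n} \<times> {..n}"]) auto
  have K: "?h a * ffact K (r - a) = ?h r" if "a \<le> r" for a
    using that pochhammer_product'[of "z + 1" a "r - a"]
      ffact_eq_pochhammer[of "z + of_nat a" "r - a"]
    by (simp add: of_nat_diff algebra_simps K_def)
  \<comment> \<open>The upper argument splits as (x - a) + (y - a) + K; the factors
    \<open>ffact x a\<close> and \<open>ffact y a\<close> then absorb the shifted binomials into
    \<open>ffact x (a + p)\<close> and \<open>ffact y (a + q)\<close>.\<close>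
  have tri: "((x + y + K - 2 * of_nat a) gchoose (r - 2 * a)) * (ffact x a * ffact y a) =
      (\<Sum>(i, j)\<in>{(i, j). a \<le> i \<and> a \<le> j \<and> i + j \<le> r}.
         ffact x i * ffact y j / (fact (i - a) * fact (j - a)) * (K gchoose (r - i - j)))"
    if "2 * a \<le> r" for a
  proof -
    have shift: "ffact t a * ((t - of_nat a) gchoose p) = ffact t (a + p) / fact p" for t :: 'c and p
      by (simp add: ffact_add ffact_eq_gbinomial[of "t - of_nat a"])
    have "((x + y + K - 2 * of_nat a) gchoose (r - 2 * a)) =
        (((x - of_nat a) + (y - of_nat a) + K) gchoose (r - 2 * a))"
      by (simp add: algebra_simps)
    also have "\<dots> = (\<Sum>(p, q)\<in>{(p, q). p + q \<le> r - 2 * a}.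
        ((x - of_nat a) gchoose p) * ((y - of_nat a) gchoose q) * (K gchoose (r - 2 * a - p - q)))"
      by (rule gbinomial_trinomial_Vandermonde)
    finally have "((x + y + K - 2 * of_nat a) gchoose (r - 2 * a)) * (ffact x a * ffact y a) =
        (\<Sum>(p, q)\<in>{(p, q). p + q \<le> r - 2 * a}.
          (ffact x a * ((x - of_nat a) gchoose p)) * (ffact y a * ((y - of_nat a) gchoose q)) *
          (K gchoose (r - 2 * a - p - q)))"
      by (simp add: sum_distrib_left sum_distrib_right case_prod_unfold mult_ac)
    also have "\<dots> = (\<Sum>(p, q)\<in>{(p, q). p + q \<le> r - 2 * a}.
          ffact x (a + p) * ffact y (a + q) / (fact p * fact q) * (K gchoose (r - 2 * a - p - q)))"
      by (rule sum.cong) (auto simp: shift)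
    also have "\<dots> = (\<Sum>(i, j)\<in>{(i, j). a \<le> i \<and> a \<le> j \<and> i + j \<le> r}.
         ffact x i * ffact y j / (fact (i - a) * fact (j - a)) * (K gchoose (r - i - j)))"
      using that
      by (intro sum.reindex_bij_witness[where j = "\<lambda>(p, q). (a + p, a + q)"
            and i = "\<lambda>(i, j). (i - a, j - a)"]) (auto simp: algebra_simps mult_2_right)
    finally show ?thesis .
  qed
  have "?R = (\<Sum>a\<le>r div 2. \<Sum>(i, j)\<in>{(i, j). a \<le> i \<and> a \<le> j \<and> i + j \<le> r}.
         fact r / (fact a * ?h a) *
         (ffact x i * ffact y j / (fact (i - a) * fact (j - a)) * (K gchoose (r - i - j))))"
  proof (rule sum.cong, goal_cases)
    case (2 a)
    then have "2 * a \<le> r" by simp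
    then show ?case
      by (subst mult.assoc, subst tri) (simp_all add: sum_distrib_left case_prod_unfold)
  qed simp
  \<comment> \<open>With (i, j) outermost, the sum over a is the one evaluated by
    \<open>pochhammer_Vandermonde\<close>.\<close>
  also have "\<dots> = (\<Sum>(i, j)\<in>{(i, j). i + j \<le> r}. \<Sum>a\<le>min i j.
         fact r / (fact a * ?h a) *
         (ffact x i * ffact y j / (fact (i - a) * fact (j - a)) * (K gchoose (r - i - j))))"
    unfolding case_prod_unfold
    apply (subst sum.Sigma)
      apply simp
     apply (intro ballI finite_subset[OF _ fin[of r]])
     apply auto[1]
    apply (subst sum.Sigma)
      apply (rule fin[of r, unfolded case_prod_unfold])
     apply simp
    apply (rule sum.reindex_bij_witness[where j = "\<lambda>(a, ij). (ij, a)" and i = "\<lambda>(ij, a). (a, ij)"])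
        apply auto
    done
  also have "\<dots> = ?L"
  proof (rule sum.cong, goal_cases)
    case (2 ij)
    obtain i j where ij: "ij = (i, j)" "i + j \<le> r" using 2 by auto
    have V: "(\<Sum>a\<le>min i j. fact i * fact j / (fact a * fact (i - a) * fact (j - a) * ?h a))
      = ?h (i + j) / (?h i * ?h j)"
      by (rule pochhammer_Vandermonde) (use nz ij in auto)
    have "(\<Sum>a\<le>min i j. fact r / (fact a * ?h a) *
         (ffact x i * ffact y j / (fact (i - a) * fact (j - a)) * (K gchoose (r - i - j))))
       = fact r / (fact i * fact j) * (ffact x i * ffact y j) * (K gchoose (r - i - j)) *
        (\<Sum>a\<le>min i j. fact i * fact j / (fact a * fact (i - a) * fact (j - a) * ?h a))"
      unfolding sum_distrib_left by (rule sum.cong) (auto simp: field_simps)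
    also have "\<dots> = fact r / (fact i * fact j) * (ffact x i * ffact y j) *
        (ffact K (r - (i + j)) / fact (r - i - j)) * (?h (i + j) / (?h i * ?h j))"
      unfolding V by (simp add: ffact_eq_gbinomial)
    also have "ffact K (r - (i + j)) = ?h r / ?h (i + j)"
      using K[of "i + j"] nz[of "i + j"] ij by (simp add: field_simps)
    also have "fact r / (fact i * fact j) * (ffact x i * ffact y j) *
        (?h r / ?h (i + j) / fact (r - i - j)) * (?h (i + j) / (?h i * ?h j)) =
       fact r * (?h r / ?h i) * (?h r / ?h j) /
         (fact i * fact j * fact (r - i - j) * ?h r) * (ffact x i * ffact y j)"
      using nz[of "i + j"] nz[of r] ij by (simp add: field_simps)
    finally have *: "(\<Sum>a\<le>min i j. fact r / (fact a * ?h a) *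
         (ffact x i * ffact y j / (fact (i - a) * fact (j - a)) * (K gchoose (r - i - j)))) =
       fact r * (?h r / ?h i) * (?h r / ?h j) /
         (fact i * fact j * fact (r - i - j) * ?h r) * (ffact x i * ffact y j)" .
    have "?h r / ?h i = ffact K (r - i)" "?h r / ?h j = ffact K (r - j)" "?h r = ffact K r"
      using K[of i] K[of j] K[of 0] nz[of i] nz[of j] ij by (simp_all add: field_simps)
    with * show ?case by (simp only: ij prod.case)
  qed simp
  finally show ?thesis by simp
qed


section \<open>Polynomials in two variables and the coefficients of the Knop-Sahi
  polynomials\<close>

lemma poly2_mult [simp]: "poly2 (f * g) x y = poly2 f x y * poly2 g x y"
  by (simp add: poly2_def)

lemma poly2_diff [simp]: "poly2 (f - g) x y = poly2 f x y - poly2 g x y"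
  by (simp add: poly2_def)

lemma poly2_smult [simp]: "poly2 (smult c f) x y = poly c x * poly2 f x y"
  by (simp add: poly2_def)

lemma poly2_sum [simp]: "poly2 (\<Sum>i\<in>A. f i) x y = (\<Sum>i\<in>A. poly2 (f i) x y)"
  by (simp add: poly2_def poly_sum)

lemma poly2_of_nat [simp]: "poly2 (of_nat n) x y = of_nat n"
  by (simp add: poly2_def)

lemma poly2_ffact: "poly2 (ffact f n) x y = ffact (poly2 f x y) n"
  by (induction n) (simp_all add: ffact_Suc, simp add: poly2_def)

text \<open>Serves the uniqueness of the eigenvalue polynomial: points with a far above b come from
  regular partitions. Each row b has infinitely many of them, so h vanishes at the constant b; hence
  h has infinitely many roots in the domain of polynomials in x.\<close>

lemma poly2_eq_0I:
  fixes h :: "'c::field_char_0 poly poly"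
  assumes "\<And>a b :: nat. a \<ge> b + N \<Longrightarrow> poly2 h (of_nat a + c) (of_nat b) = 0"
  shows "h = 0"
proof (rule ccontr)
  assume "h \<noteq> 0"
  then have fin: "finite {y. poly h y = 0}"
    by (rule poly_roots_finite)
  have "poly h [:of_nat b:] = 0" for b :: nat
  proof (rule ccontr)
    assume "poly h [:of_nat b:] \<noteq> 0"
    then have "finite {x. poly (poly h [:of_nat b:]) x = 0}"
      by (rule poly_roots_finite)
    moreover have "(\<lambda>a. of_nat a + c) ` {b + N..} \<subseteq> {x. poly (poly h [:of_nat b:]) x = 0}"
      using assms by (auto simp: poly2_def)
    ultimately have "finite ((\<lambda>a. of_nat a + c) ` {b + N..})"
      using finite_subset by blast
    then have "finite {b + N..}"
      by (rule finite_imageD) (auto simp: inj_on_def)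
    then show False by (simp add: infinite_Ici)
  qed
  then have "range (\<lambda>b::nat. [:of_nat b:]) \<subseteq> {y. poly h y = 0}" by auto
  with fin have "finite (range (\<lambda>b::nat. [:of_nat b:] :: 'c poly))"
    using finite_subset by blast
  then have "finite (UNIV :: nat set)"
    by (rule finite_imageD) (auto simp: inj_on_def)
  then show False by simp
qed

abbreviation (input) knop_sahi_coeff :: "'f::field \<Rightarrow> nat \<Rightarrow> nat \<Rightarrow> nat \<Rightarrow> 'f" where
  "knop_sahi_coeff \<kappa> r i j \<equiv>
     of_nat (fact r) * ffact (\<kappa> + 1) (r - i) * ffact (\<kappa> + 1) (r - j) /
       (of_nat (fact i) * of_nat (fact j) * of_nat (fact (r - i - j)) * ffact (\<kappa> + 1) r)"

lemma poly2_knop_sahi: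
  "poly2 (knop_sahi \<kappa> l) x y =
     (\<Sum>(i, j)\<in>{(i, j). i + j \<le> fst l - snd l}. knop_sahi_coeff \<kappa> (fst l - snd l) i j *
        (ffact x (snd l + i) * ffact y (snd l + j)))"
  unfolding knop_sahi_def Let_def poly2_sum
  by (rule sum.cong) (auto simp: poly2_ffact poly2_def[of "[:_:]"] poly2_def[of "[:0, 1:]"])

lemma ffact_const_poly: "ffact [:a:] n = [:ffact a n:]"
  by (induction n) (simp_all add: ffact_Suc of_nat_poly)

lemma coeff_ffact_Suc:
  "coeff (ffact [:0, 1:] (Suc n) :: 'c::comm_ring_1 poly) p =
     (case p of 0 \<Rightarrow> 0 | Suc p' \<Rightarrow> coeff (ffact [:0, 1:] n) p') - of_nat n * coeff (ffact [:0, 1:] n) p"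
proof -
  have "(ffact [:0, 1:] (Suc n) :: 'c poly) = pCons 0 (ffact [:0, 1:] n) - smult (of_nat n) (ffact [:0, 1:] n)"
    by (simp add: ffact_Suc algebra_simps of_nat_poly)
  then show ?thesis by (simp only: coeff_diff coeff_smult coeff_pCons)
qed

lemma coeff_ffact_poly_poly:
  "coeff (ffact [:0, 1:] n :: 'c::comm_ring_1 poly poly) p = [:coeff (ffact [:0, 1:] n) p:]"
  by (induction n arbitrary: p)
    (auto simp: coeff_ffact_Suc of_nat_poly coeff_1 split: nat.splits)

text \<open>The coefficients are signed Stirling numbers. Being integers, they are the same over the
  rational functions in \<kappa> and over the complex numbers, so that specialization concerns
  \<open>knop_sahi_coeff\<close> alone.\<close>

lemma coeff_ffact_int:
  "coeff (ffact [:0, 1:] n :: 'c::comm_ring_1 poly) p = of_int (coeff (ffact [:0, 1:] n) p)"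
  by (induction n arbitrary: p) (auto simp: coeff_ffact_Suc coeff_1 split: nat.splits)

lemma coeff_coeff_knop_sahi:
  "coeff (coeff (knop_sahi \<kappa> l) p) q =
     (\<Sum>(i, j)\<in>{(i, j). i + j \<le> fst l - snd l}. knop_sahi_coeff \<kappa> (fst l - snd l) i j *
        (of_int (coeff (ffact [:0, 1:] (snd l + i)) q) * of_int (coeff (ffact [:0, 1:] (snd l + j)) p)))"
  unfolding knop_sahi_def Let_def coeff_sum
  by (rule sum.cong)
    (auto simp: ffact_const_poly coeff_ffact_poly_poly
        coeff_ffact_int[where 'c = 'a, symmetric])

lemma symmetric2_knop_sahi: "symmetric2 (knop_sahi \<kappa> l)"
  unfolding symmetric2_def coeff_coeff_knop_sahi
  by (intro allI sum.reindex_bij_witness[where i = prod.swap and j = prod.swap])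
    (auto simp: add.commute[of "fst _ :: nat"] add.commute diff_commute[of _ "_::nat"] mult_ac simp del: diff_diff_left)

lemma symmetric2_smult: "symmetric2 f \<Longrightarrow> symmetric2 (smult [:c:] f)"
  by (simp add: symmetric2_def)

section \<open>Specialization of rational functions at \<kappa> = k, and the derivative of H\<close>

text \<open>A relational form of \<open>specialize\<close>, with the value already complex. It
  includes the absence of a pole, and so is closed under sums, products and inverses of nonzero
  values.\<close>

definition specializes_to :: "rat \<Rightarrow> rat poly fract \<Rightarrow> complex \<Rightarrow> bool" where
  "specializes_to t q z \<longleftrightarrow>
     (\<exists>a b. q = Fract a b \<and> poly b t \<noteq> 0 \<and> z = of_rat (poly a t / poly b t))"

lemma specializes_to_imp_specialize:
  assumes "specializes_to t q z"
  shows "of_rat (specialize t q) = z"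
proof -
  from assms obtain a b where ab: "q = Fract a b" "poly b t \<noteq> 0" "z = of_rat (poly a t / poly b t)"
    by (auto simp: specializes_to_def)
  have "specialize t q = poly a t / poly b t"
    unfolding specialize_def
  proof (rule the_equality)
    show "\<exists>a' b'. q = Fract a' b' \<and> poly b' t \<noteq> 0 \<and> poly a t / poly b t = poly a' t / poly b' t"
      using ab by blast
  next
    fix v assume "\<exists>a' b'. q = Fract a' b' \<and> poly b' t \<noteq> 0 \<and> v = poly a' t / poly b' t"
    then obtain a' b' where a'b': "q = Fract a' b'" "poly b' t \<noteq> 0" "v = poly a' t / poly b' t"
      by blast
    have "b \<noteq> 0" "b' \<noteq> 0" using ab a'b' by auto
    then have "a * b' = a' * b" using ab(1) a'b'(1) by (simp add: eq_fract)
    then have "poly a t * poly b' t = poly a' t * poly b t"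
      by (metis poly_mult)
    then show "v = poly a t / poly b t"
      using ab a'b' by (simp add: frac_eq_eq)
  qed
  then show ?thesis using ab by simp
qed

lemma specializes_to_add:
  assumes "specializes_to t q z" "specializes_to t q' z'"
  shows "specializes_to t (q + q') (z + z')"
proof -
  obtain a b a' b' where *: "q = Fract a b" "poly b t \<noteq> 0" "z = of_rat (poly a t / poly b t)"
    "q' = Fract a' b'" "poly b' t \<noteq> 0" "z' = of_rat (poly a' t / poly b' t)"
    using assms by (auto simp: specializes_to_def)
  then have "b \<noteq> 0" "b' \<noteq> 0" by auto
  then have "q + q' = Fract (a * b' + a' * b) (b * b')" using * by simp
  then show ?thesis unfolding specializes_to_def
    using * by (intro exI[of _ "a * b' + a' * b"] exI[of _ "b * b'"])
      (simp add: add_frac_eq of_rat_divide of_rat_mult of_rat_add)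
qed

lemma specializes_to_mult:
  assumes "specializes_to t q z" "specializes_to t q' z'"
  shows "specializes_to t (q * q') (z * z')"
proof -
  obtain a b a' b' where *: "q = Fract a b" "poly b t \<noteq> 0" "z = of_rat (poly a t / poly b t)"
    "q' = Fract a' b'" "poly b' t \<noteq> 0" "z' = of_rat (poly a' t / poly b' t)"
    using assms by (auto simp: specializes_to_def)
  then have "q * q' = Fract (a * a') (b * b')" by simp
  then show ?thesis unfolding specializes_to_def
    using * by (intro exI[of _ "a * a'"] exI[of _ "b * b'"])
      (simp add: of_rat_divide of_rat_mult)
qed

lemma specializes_to_inverse:
  assumes "specializes_to t q z" "z \<noteq> 0"
  shows "specializes_to t (inverse q) (inverse z)"
proof -
  obtain a b where *: "q = Fract a b" "poly b t \<noteq> 0" "z = of_rat (poly a t / poly b t)"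
    using assms by (auto simp: specializes_to_def)
  then have "poly a t \<noteq> 0" using assms(2) by auto
  then show ?thesis unfolding specializes_to_def
    using * by (intro exI[of _ b] exI[of _ a])
      (simp add: of_rat_divide)
qed

lemma specializes_to_of_int: "specializes_to t (of_int n) (of_int n)"
proof -
  have nat: "(of_nat m :: rat poly fract) = Fract (of_nat m) 1" for m
    by (induction m) (simp_all add: Zero_fract_def One_fract_def)
  have "(of_int n :: rat poly fract) = Fract (of_int n) 1"
    by (cases n rule: int_cases2) (simp_all add: nat)
  then show ?thesis unfolding specializes_to_def
    by (intro exI[of _ "of_int n"] exI[of _ 1]) simp
qed

lemma specializes_to_of_nat: "specializes_to t (of_nat n) (of_nat n)"
  using specializes_to_of_int[of t "int n"] by simp

lemma specializes_to_kappa: "specializes_to t kappa (of_rat t)"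
  unfolding specializes_to_def kappa_def
  by (intro exI[of _ "[:0, 1:]"] exI[of _ 1]) simp

lemma specializes_to_sum:
  "(\<And>i. i \<in> A \<Longrightarrow> specializes_to t (f i) (g i)) \<Longrightarrow> specializes_to t (\<Sum>i\<in>A. f i) (\<Sum>i\<in>A. g i)"
  by (induction A rule: infinite_finite_induct)
    (auto intro: specializes_to_add specializes_to_of_nat[of _ 0, simplified])

lemma specializes_to_ffact_kappa:
  "specializes_to (of_nat k) (ffact (kappa + 1) n) (ffact (of_nat k + 1) n)"
proof (induction n)
  case 0
  then show ?case using specializes_to_of_nat[of _ 1] by simp
next
  case (Suc n)
  have "specializes_to (of_nat k) ((kappa + 1) + of_int (- int n)) ((of_nat k + 1) + of_int (- int n))"
    using specializes_to_of_nat[of "of_nat k" 1] specializes_to_kappa[of "of_nat k"]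
    by (intro specializes_to_add specializes_to_of_int) simp_all
  from specializes_to_mult[OF Suc this] show ?case by (simp add: ffact_Suc)
qed

lemma ffact_of_nat_nonzero: "n \<le> N \<Longrightarrow> ffact (of_nat N :: 'c::{comm_ring_1, ring_char_0, idom}) n \<noteq> 0"
  by (auto simp: ffact_def of_nat_diff[symmetric] simp del: of_nat_diff)

text \<open>The only denominator involving \<kappa> is \<open>ffact (kappa + 1) r\<close> with r =
  \<open>fst l - snd l\<close>. At k its factors k + 1, ..., k + 2 - r are positive since r \<le> k
  + 1, so each coefficient can be specialized term by term.\<close>

lemma knop_sahi_at_eq:
  assumes "fst l - snd l \<le> k + 1"
  shows "knop_sahi_at k l = knop_sahi (of_nat k) l"
proof -
  let ?r = "fst l - snd l"
  have "ffact (of_nat (k + 1) :: complex) ?r \<noteq> 0"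
    using assms by (rule ffact_of_nat_nonzero)
  then have nz: "ffact (of_nat k + 1 :: complex) ?r \<noteq> 0" by (simp add: add.commute)
  have coeff: "specializes_to (of_nat k) (knop_sahi_coeff kappa ?r i j) (knop_sahi_coeff (of_nat k) ?r i j)" for i j
    unfolding divide_inverse
    using nz by (intro specializes_to_mult specializes_to_inverse specializes_to_of_nat
        specializes_to_ffact_kappa) auto
  have sp: "specializes_to (of_nat k) (coeff (coeff (knop_sahi kappa l) p) q)
      (coeff (coeff (knop_sahi (of_nat k) l) p) q)" for p q
    unfolding coeff_coeff_knop_sahi case_prod_unfold
    by (intro specializes_to_sum specializes_to_mult specializes_to_of_int coeff)
  have z: "of_rat (specialize (of_nat k) 0) = (0 :: complex)"
    using specializes_to_imp_specialize[OF specializes_to_of_nat[of "of_nat k" 0]] by simp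
  show ?thesis
    unfolding knop_sahi_at_def
    by (intro poly_eqI)
      (simp add: coeff_map_poly z specializes_to_imp_specialize[OF sp])
qed

text \<open>The product rule; each linear factor has derivative -1, whence the overall sign.\<close>

lemma poly_H_poly:
  "poly (pderiv (H_poly l)) t = - (of_nat (fact (fst l - snd l)) * of_nat (fact (snd l)) *
     (\<Sum>i<snd l. \<Prod>i'\<in>{..<snd l} - {i}. of_nat (fst l) - 1 - t - of_nat i'))"
proof -
  have lin: "pderiv (of_nat (fst l) - 1 - [:0, 1:] - of_nat i :: rat poly) = - 1" for i
    by (simp add: pderiv_diff pderiv_of_nat pderiv_pCons one_pCons)
  have "pderiv (ffact (of_nat (fst l) - 1 - [:0, 1:]) (snd l) :: rat poly) =
     - (\<Sum>i<snd l. \<Prod>i'\<in>{..<snd l} - {i}. of_nat (fst l) - 1 - [:0, 1:] - of_nat i')"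
    unfolding ffact_def pderiv_prod by (simp add: lin sum_negf)
  then show ?thesis
    by (simp add: H_poly_def pderiv_mult pderiv_of_nat poly_sum poly_prod del: of_nat_fact)
qed

section \<open>The ring of linear operators\<close>

lemma sp_linear_iff:
  "Vector_Spaces.linear sp_scale sp_scale f \<longleftrightarrow>
     (\<forall>p q. f (p + q) = f p + f q) \<and> (\<forall>c p. f (sp_scale c p) = sp_scale c (f p))"
  by (auto simp: Vector_Spaces.linear_iff spoly.vector_space_axioms)

text \<open>As a type of their own, linear operators form a ring under composition, and commutation
  relations become rewriting in a noncommutative ring.\<close>

typedef ('a, 'b) lop = "{f :: ('a, 'b) sop. Vector_Spaces.linear sp_scale sp_scale f}"
  morphisms app Lop
  by (rule exI[of _ "\<lambda>p. p"]) (simp add: sp_linear_iff)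

setup_lifting type_definition_lop

lemma app_linear: "Vector_Spaces.linear sp_scale sp_scale (app A)"
  using app[of A] by simp

lemma app_add: "app A (p + q) = app A p + app A q"
  and app_scale: "app A (sp_scale c p) = sp_scale c (app A p)"
  using app_linear[of A] by (auto simp: sp_linear_iff)

lemma app_zero [simp]: "app A 0 = 0"
  using app_add[of A 0 0] by simp

lemma app_uminus: "app A (- p) = - app A p"
  using app_add[of A p "- p"] by (simp add: eq_neg_iff_add_eq_0 add.commute)

lemma app_diff: "app A (p - q) = app A p - app A q"
  using app_add[of A p "- q"] by (simp add: app_uminus)

lemma app_sum: "app A (\<Sum>i\<in>I. f i) = (\<Sum>i\<in>I. app A (f i))"
  by (induction I rule: infinite_finite_induct) (simp_all add: app_add)

instantiation lop :: (type, type) ring_1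
begin

lift_definition zero_lop :: "('a, 'b) lop" is "\<lambda>p. 0" by (simp add: sp_linear_iff)
lift_definition one_lop :: "('a, 'b) lop" is "\<lambda>p. p" by (simp add: sp_linear_iff)
lift_definition plus_lop :: "('a, 'b) lop \<Rightarrow> ('a, 'b) lop \<Rightarrow> ('a, 'b) lop" is "\<lambda>f g p. f p + g p"
  by (simp add: sp_linear_iff spoly.scale_right_distrib algebra_simps)
lift_definition minus_lop :: "('a, 'b) lop \<Rightarrow> ('a, 'b) lop \<Rightarrow> ('a, 'b) lop" is "\<lambda>f g p. f p - g p"
  by (simp add: sp_linear_iff spoly.scale_right_diff_distrib algebra_simps)
lift_definition uminus_lop :: "('a, 'b) lop \<Rightarrow> ('a, 'b) lop" is "\<lambda>f p. - f p"
  by (simp add: sp_linear_iff)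
lift_definition times_lop :: "('a, 'b) lop \<Rightarrow> ('a, 'b) lop \<Rightarrow> ('a, 'b) lop" is "\<lambda>f g p. f (g p)"
  by (simp add: sp_linear_iff)

instance
proof
  show "(0 :: ('a, 'b) lop) \<noteq> 1"
  proof transfer
    have "Poly_Mapping.single undefined 1 \<noteq> (0 :: ('a, 'b) spoly)"
    proof
      assume "Poly_Mapping.single undefined 1 = (0 :: ('a, 'b) spoly)"
      then have "Poly_Mapping.lookup (Poly_Mapping.single undefined 1 :: ('a, 'b) spoly) undefined =
          Poly_Mapping.lookup (0 :: ('a, 'b) spoly) undefined"
        by (rule arg_cong[of _ _ "\<lambda>p. Poly_Mapping.lookup p undefined"])
      then show False by simp
    qed
    then have "(\<lambda>p. 0) (Poly_Mapping.single undefined 1) \<noteq> (Poly_Mapping.single undefined 1 :: ('a, 'b) spoly)"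
      by metis
    then show "(\<lambda>p. 0) \<noteq> (\<lambda>p. p :: ('a, 'b) spoly)"
      by (rule contrapos_nn) (rule fun_cong)
  qed
qed (transfer; force simp: sp_linear_iff fun_eq_iff algebra_simps)+

end

lift_definition smul :: "complex \<Rightarrow> ('a, 'b) lop \<Rightarrow> ('a, 'b) lop" is "\<lambda>c f p. sp_scale c (f p)"
  by (simp add: sp_linear_iff spoly.scale_right_distrib mult.commute)

lemma app_lop [simp]:
  "app 0 p = 0" "app 1 p = p" "app (A + B) p = app A p + app B p"
  "app (A - B) p = app A p - app B p" "app (- A) p = - app A p"
  "app (A * B) p = app A (app B p)" "app (smul c A) p = sp_scale c (app A p)"
  by (transfer; simp)+

lemma app_sum_lop: "app (\<Sum>i\<in>I. F i) p = (\<Sum>i\<in>I. app (F i) p)"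
  by (induction I rule: infinite_finite_induct) simp_all

lemma app_power: "app (A ^ n) p = (app A ^^ n) p"
  by (induction n arbitrary: p) (simp_all add: funpow_swap1)

lemma lop_eqI: "(\<And>p. app A p = app B p) \<Longrightarrow> A = B"
  by (metis app_inject ext)

global_interpretation lop: vector_space "smul :: complex \<Rightarrow> ('a, 'b) lop \<Rightarrow> ('a, 'b) lop"
  by unfold_locales
    (auto intro!: lop_eqI simp: spoly.scale_right_distrib spoly.scale_left_distrib)

lemma smul_mult_left [simp]: "smul c A * B = smul c (A * B)"
  and smul_mult_right [simp]: "A * smul c B = smul c (A * B)"
  by (auto intro!: lop_eqI simp: app_scale)

lemma of_nat_eq_smul: "of_nat n = smul (of_nat n) 1"
  by (induction n) (simp_all add: lop.scale_left_distrib)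

section \<open>The super Weyl algebra\<close>

lemma lin_ext_superset:
  assumes "finite U" "Poly_Mapping.keys p \<subseteq> U"
  shows "lin_ext g p = (\<Sum>u\<in>U. sp_scale (Poly_Mapping.lookup p u) (g u))"
  unfolding lin_ext_def using assms
  by (intro sum.mono_neutral_left) (auto simp: in_keys_iff)

lemma lin_ext_linear: "Vector_Spaces.linear sp_scale sp_scale (lin_ext g)"
  unfolding sp_linear_iff
proof safe
  fix p q :: "('a, 'b) spoly"
  have "Poly_Mapping.keys (p + q) \<subseteq> Poly_Mapping.keys p \<union> Poly_Mapping.keys q"
    by (rule Poly_Mapping.keys_add)
  then show "lin_ext g (p + q) = lin_ext g p + lin_ext g q"
    by (simp add: lin_ext_superset[of "Poly_Mapping.keys p \<union> Poly_Mapping.keys q"]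
        lookup_add spoly.scale_left_distrib sum.distrib)
next
  fix c and p :: "('a, 'b) spoly"
  have "Poly_Mapping.keys (sp_scale c p) \<subseteq> Poly_Mapping.keys p"
    by (auto simp: in_keys_iff)
  then show "lin_ext g (sp_scale c p) = sp_scale c (lin_ext g p)"
    by (simp add: lin_ext_superset[of "Poly_Mapping.keys p"] spoly.scale_sum_right)
qed

lemma sp_scale_single [simp]:
  "sp_scale c (Poly_Mapping.single u d) = Poly_Mapping.single u (c * d)"
  by (rule poly_mapping_eqI) (simp add: lookup_single when_def)

lemma lin_ext_single [simp]: "lin_ext g (Poly_Mapping.single u c) = sp_scale c (g u)"
  by (cases "c = 0") (simp_all add: lin_ext_def)

lemma spoly_as_sum: "p = (\<Sum>u\<in>Poly_Mapping.keys p. sp_scale (Poly_Mapping.lookup p u) (Poly_Mapping.single u 1))"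
  by (rule poly_mapping_eqI)
    (simp add: lookup_sum lookup_single when_def in_keys_iff if_distrib sum.delta' cong: if_cong)

lemma lop_eq_on_monomialsI:
  assumes "\<And>u. app A (Poly_Mapping.single u 1) = app B (Poly_Mapping.single u 1)"
  shows "A = B"
proof (rule lop_eqI)
  fix p
  show "app A p = app B p"
    by (subst (1 2) spoly_as_sum) (simp only: app_sum app_scale assms)
qed

lift_definition Xop :: "'a + 'b \<Rightarrow> ('a::finite, 'b::{finite, linorder}) lop" is coord_mult
  by (simp add: coord_mult_def lin_ext_linear)

lift_definition Dop :: "'a + 'b \<Rightarrow> ('a::finite, 'b::{finite, linorder}) lop" is coord_deriv
  by (simp add: coord_deriv_def lin_ext_linear)

lift_definition Pop :: "('a::finite, 'b::{finite, linorder}) lop" is parity_aut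
  by (simp add: parity_aut_def lin_ext_linear)

text \<open>The Koszul sign for exchanging two coordinates.\<close>

definition sgn2 :: "'a + 'b \<Rightarrow> 'a + 'b \<Rightarrow> complex" where
  "sgn2 i j = (-1) ^ (par i * par j)"

lemma par_simps [simp]: "par (Inl a) = 0" "par (Inr b) = 1"
  by (simp_all add: par_def)

abbreviation (input) nbelow :: "'b::linorder set \<Rightarrow> 'b \<Rightarrow> nat" where
  "nbelow S b \<equiv> card {s \<in> S. s < b}"

lemma app_Xop_single:
  "app (Xop (Inl a)) (Poly_Mapping.single (\<alpha>, S) c) = Poly_Mapping.single (\<alpha>(a := \<alpha> a + 1), S) c"
  "app (Xop (Inr b)) (Poly_Mapping.single (\<alpha>, S) c) =
     (if b \<in> S then 0 else Poly_Mapping.single (\<alpha>, insert b S) ((-1) ^ nbelow S b * c))"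
  by (simp_all add: Xop.rep_eq coord_mult_def mult.commute)

lemma app_Dop_single:
  "app (Dop (Inl a)) (Poly_Mapping.single (\<alpha>, S) c) =
     Poly_Mapping.single (\<alpha>(a := \<alpha> a - 1), S) (of_nat (\<alpha> a) * c)"
  "app (Dop (Inr b)) (Poly_Mapping.single (\<alpha>, S) c) =
     (if b \<in> S then Poly_Mapping.single (\<alpha>, S - {b}) ((-1) ^ nbelow S b * c) else 0)"
  by (simp_all add: Dop.rep_eq coord_deriv_def mult.commute)

lemma app_Pop_single:
  "app Pop (Poly_Mapping.single (\<alpha>, S) c) = Poly_Mapping.single (\<alpha>, S) ((-1) ^ card S * c)"
  by (simp add: Pop.rep_eq parity_aut_def mult.commute)

lemma nbelow_insert:
  fixes S :: "'b::{finite, linorder} set"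
  assumes "b \<notin> S"
  shows "nbelow (insert b S) c = nbelow S c + (if b < c then 1 else 0)"
proof (cases "b < c")
  case True
  then have "{s \<in> insert b S. s < c} = insert b {s \<in> S. s < c}" by auto
  then show ?thesis using assms True by simp
next
  case False
  then have "{s \<in> insert b S. s < c} = {s \<in> S. s < c}" by auto
  then show ?thesis using False by simp
qed

lemma nbelow_insert':
  fixes S :: "'b::{finite, linorder} set"
  assumes "b \<notin> S"
  shows "card {s. (s = b \<or> s \<in> S) \<and> s < c} = nbelow S c + (if b < c then 1 else 0)"
  using nbelow_insert[OF assms, of c] by simp

lemma nbelow_remove:
  fixes S :: "'b::{finite, linorder} set"
  assumes "b \<in> S"
  shows "nbelow S c = nbelow (S - {b}) c + (if b < c then 1 else 0)"
  using nbelow_insert[of b "S - {b}" c] assms by (simp add: insert_absorb)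

lemma minus_one_power_assoc: "(-1) ^ n * ((-1) ^ n * x) = (x :: complex)"
  by (simp flip: mult.assoc)

lemma single_eqI: "u = v \<Longrightarrow> c = d \<Longrightarrow> Poly_Mapping.single u c = Poly_Mapping.single v d"
  by simp

lemma Xop_comm: "Xop i * Xop j = smul (sgn2 i j) (Xop j * Xop i)"
proof (rule lop_eq_on_monomialsI, goal_cases)
  case (1 u)
  obtain \<alpha> S where u: "u = (\<alpha>, S)" by fastforce
  show ?case
    by (cases i; cases j)
      (auto simp: u app_Xop_single sgn2_def fun_upd_twist nbelow_insert' insert_commute
        power_add minus_one_power_assoc mult.commute simp flip: single_uminus intro!: single_eqI)
qed

lemma Dop_comm: "Dop i * Dop j = smul (sgn2 i j) (Dop j * Dop i)"
proof (rule lop_eq_on_monomialsI, goal_cases)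
  case (1 u)
  obtain \<alpha> S where u: "u = (\<alpha>, S)" by fastforce
  \<comment> \<open>Deleting b lowers the position of the larger index c by one, while deleting c
    leaves the position of b alone; the two orders therefore differ by one sign.\<close>
  have odd: "app (Dop (Inr b)) (app (Dop (Inr c)) (Poly_Mapping.single (\<alpha>, S) 1)) =
    - app (Dop (Inr c)) (app (Dop (Inr b)) (Poly_Mapping.single (\<alpha>, S) 1))"
    if "b \<in> S" "c \<in> S" "b < c" for b c
    using that nbelow_remove[of b S c] nbelow_remove[of c S b]
    by (auto simp: app_Dop_single power_add minus_one_power_assoc insert_commute Diff_insert[symmetric]
        single_uminus[symmetric] intro!: single_eqI)
  show ?case
  proof (cases i; cases j)
    fix b c assume ij: "i = Inr b" "j = Inr c"
    show ?thesis
      using odd[of b c] odd[of c b]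
      by (cases b c rule: linorder_cases; cases "b \<in> S"; cases "c \<in> S")
        (simp_all add: ij u sgn2_def app_Dop_single)
  qed (auto simp: u app_Dop_single sgn2_def fun_upd_twist intro!: single_eqI)
qed

lemma Dop_Xop: "Dop i * Xop j = smul (sgn2 i j) (Xop j * Dop i) + (if i = j then 1 else 0)"
proof (rule lop_eq_on_monomialsI, goal_cases)
  case (1 u)
  obtain \<alpha> S where u: "u = (\<alpha>, S)" by fastforce
  show ?case
  proof (cases i; cases j)
    fix b c assume ij: "i = Inr b" "j = Inr c"
    show ?thesis
    proof (cases "b = c")
      case True
      have "{s. (s = b \<or> s \<in> S) \<and> s < b} = {s \<in> S. s < b}"
        "{s \<in> S. s \<noteq> b \<and> s < b} = {s \<in> S. s < b}" by auto
      then show ?thesis using True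
        by (auto simp: ij u sgn2_def app_Dop_single app_Xop_single insert_absorb minus_one_power_assoc)
    next
      case False
      then show ?thesis
        using nbelow_remove[of b S c]
        by (cases "b \<in> S"; cases "c \<in> S"; cases b c rule: linorder_cases)
         (auto simp: ij u sgn2_def app_Dop_single app_Xop_single nbelow_insert' insert_Diff_if
            power_add minus_one_power_assoc single_uminus[symmetric] intro!: single_eqI)
    qed
  next
    fix a b assume ij: "i = Inl a" "j = Inl b"
    show ?thesis
      by (cases "a = b"; cases "\<alpha> b = 0")
        (auto simp: ij u sgn2_def app_Dop_single app_Xop_single fun_upd_twist algebra_simps
           single_add[symmetric] intro!: single_eqI)
  qed (auto simp: u app_Dop_single app_Xop_single sgn2_def intro!: single_eqI)
qed

lemma Pop_Pop [simp]: "Pop * Pop = 1"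
  by (rule lop_eq_on_monomialsI) (auto simp: app_Pop_single)

lemma Pop_Xop: "Pop * Xop i = smul ((-1) ^ par i) (Xop i * Pop)"
proof (rule lop_eq_on_monomialsI, goal_cases)
  case (1 u)
  obtain \<alpha> S where u: "u = (\<alpha>, S)" by fastforce
  show ?case
    by (cases i) (auto simp: u app_Pop_single app_Xop_single mult.commute simp flip: single_uminus intro!: single_eqI)
qed

lemma Pop_Dop: "Pop * Dop i = smul ((-1) ^ par i) (Dop i * Pop)"
proof (rule lop_eq_on_monomialsI, goal_cases)
  case (1 u)
  obtain \<alpha> S where u: "u = (\<alpha>, S)" by fastforce
  have *: "(-1) ^ (card S - Suc 0) * c = - ((-1) ^ card S * c)" if "b \<in> S" for b and c :: complex
  proof -
    have "card S > 0" using that by (auto simp: card_gt_0_iff)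
    then obtain n where "card S = Suc n" by (cases "card S") auto
    then show ?thesis by simp
  qed
  show ?case
    by (cases i) (auto simp: u app_Pop_single app_Dop_single * mult.commute simp flip: single_uminus intro!: single_eqI)
qed

lemma Euler_single:
  "app (\<Sum>i\<in>UNIV. Xop i * Dop i) (Poly_Mapping.single (\<alpha>, S) c) =
     sp_scale (of_nat ((\<Sum>i\<in>UNIV. \<alpha> i) + card S)) (Poly_Mapping.single (\<alpha>, S) c)"
proof -
  have ev: "app (Xop (Inl a)) (app (Dop (Inl a)) (Poly_Mapping.single (\<alpha>, S) c)) =
      sp_scale (of_nat (\<alpha> a)) (Poly_Mapping.single (\<alpha>, S) c)" for a
    by (cases "\<alpha> a = 0") (auto simp: app_Dop_single app_Xop_single)
  have od: "app (Xop (Inr b)) (app (Dop (Inr b)) (Poly_Mapping.single (\<alpha>, S) c)) =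
      sp_scale (if b \<in> S then 1 else 0) (Poly_Mapping.single (\<alpha>, S) c)" for b
  proof -
    have "{s \<in> S. s \<noteq> b \<and> s < b} = {s \<in> S. s < b}" by auto
    then show ?thesis
      by (auto simp: app_Dop_single app_Xop_single insert_absorb minus_one_power_assoc)
  qed
  have "app (\<Sum>i\<in>UNIV. Xop i * Dop i) (Poly_Mapping.single (\<alpha>, S) c) =
      sp_scale ((\<Sum>a\<in>UNIV. of_nat (\<alpha> a)) + (\<Sum>b\<in>UNIV. if b \<in> S then 1 else 0)) (Poly_Mapping.single (\<alpha>, S) c)"
    by (simp only: app_sum_lop app_lop UNIV_Plus_UNIV[symmetric] sum.Plus finite o_def
        ev od spoly.scale_sum_left spoly.scale_left_distrib)
  also have "(\<Sum>b\<in>UNIV. if b \<in> S then 1 else 0) = (of_nat (card S) :: complex)"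
    by (simp add: sum.If_cases)
  finally show ?thesis by simp
qed


definition Euler :: "('a::finite, 'b::{finite, linorder}) lop" where
  "Euler = (\<Sum>i\<in>UNIV. Xop i * Dop i)"

definition mdeg :: "('a::finite, 'b::finite) smon \<Rightarrow> nat" where
  "mdeg u = (\<Sum>i\<in>UNIV. fst u i) + card (snd u)"

lemma app_Euler_single:
  "app Euler (Poly_Mapping.single u c) = sp_scale (of_nat (mdeg u)) (Poly_Mapping.single u c)"
  using Euler_single[of "fst u" "snd u" c] by (simp add: Euler_def mdeg_def)

lemma lookup_Euler: "Poly_Mapping.lookup (app Euler p) u = of_nat (mdeg u) * Poly_Mapping.lookup p u"
proof -
  have "app Euler p = app Euler (\<Sum>v\<in>Poly_Mapping.keys p. sp_scale (Poly_Mapping.lookup p v) (Poly_Mapping.single v 1))"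
    by (rule arg_cong[OF spoly_as_sum])
  also have "\<dots> = (\<Sum>v\<in>Poly_Mapping.keys p. Poly_Mapping.single v (Poly_Mapping.lookup p v * of_nat (mdeg v)))"
    by (simp only: app_sum app_scale app_Euler_single) simp
  finally have "Poly_Mapping.lookup (app Euler p) u =
     (\<Sum>v\<in>Poly_Mapping.keys p. Poly_Mapping.lookup p v * of_nat (mdeg v) when v = u)"
    by (simp add: lookup_sum lookup_single)
  also have "\<dots> = (\<Sum>v\<in>Poly_Mapping.keys p. if v = u then of_nat (mdeg u) * Poly_Mapping.lookup p u else 0)"
    by (rule sum.cong) (auto simp: when_def)
  also have "\<dots> = of_nat (mdeg u) * Poly_Mapping.lookup p u"
    by (simp add: in_keys_iff)
  finally show ?thesis .
qed

lemma hom_spolys_iff: "p \<in> hom_spolys d \<longleftrightarrow> app Euler p = sp_scale (of_nat d) p"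
proof -
  have "p \<in> hom_spolys d \<longleftrightarrow> (\<forall>u. Poly_Mapping.lookup p u \<noteq> 0 \<longrightarrow> mdeg u = d)"
    by (auto simp: hom_spolys_def mdeg_def in_keys_iff)
  also have "\<dots> \<longleftrightarrow> (\<forall>u. of_nat (mdeg u) * Poly_Mapping.lookup p u = of_nat d * Poly_Mapping.lookup p u)"
    by auto
  also have "\<dots> \<longleftrightarrow> app Euler p = sp_scale (of_nat d) p"
    by (auto simp: lookup_Euler poly_mapping_eq_iff fun_eq_iff)
  finally show ?thesis .
qed

text \<open>Monomials diagonalize \<open>Euler\<close> with natural eigenvalues. This is how degree
  arguments are made: a vector whose eigenvalue would be negative is zero.\<close>

lemma Euler_eigenvalue_nat:
  assumes "app Euler p = sp_scale c p" "p \<noteq> 0"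
  obtains d where "c = of_nat d" "p \<in> hom_spolys d"
proof -
  obtain u where u: "Poly_Mapping.lookup p u \<noteq> 0"
    using assms(2) by (auto simp: poly_mapping_eq_iff fun_eq_iff)
  have "of_nat (mdeg u) * Poly_Mapping.lookup p u = c * Poly_Mapping.lookup p u"
    using arg_cong[OF assms(1), of "\<lambda>q. Poly_Mapping.lookup q u"] by (simp add: lookup_Euler)
  then have "c = of_nat (mdeg u)" using u by simp
  with assms(1) that show ?thesis by (auto simp: hom_spolys_iff)
qed

lemma sgn2_sym: "sgn2 i j = sgn2 j i"
  by (simp add: sgn2_def mult.commute)

lemma sgn2_sgn2 [simp]: "sgn2 i j * sgn2 i j = 1" "sgn2 i j * (sgn2 i j * c) = c"
  by (simp_all add: sgn2_def minus_one_power_assoc)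

lemma smul_if: "smul c (if b then A else B) = (if b then smul c A else smul c B)"
  "smul (if b then c else d) A = (if b then smul c A else smul d A)"
  by simp_all

lemma Euler_Xop: "Euler * Xop i = Xop i * Euler + Xop i"
proof -
  have "Euler * Xop i = (\<Sum>j\<in>UNIV. Xop i * (Xop j * Dop j) + (if i = j then Xop j else 0))"
    unfolding Euler_def sum_distrib_right
  proof (rule sum.cong)
    fix j
    have "Xop j * Dop j * Xop i = smul (sgn2 j i) (Xop j * Xop i * Dop j) + (if i = j then Xop j else 0)"
      by (simp add: mult.assoc Dop_Xop distrib_left)
    also have "smul (sgn2 j i) (Xop j * Xop i * Dop j) = Xop i * (Xop j * Dop j)"
      by (subst Xop_comm) (simp add: mult.assoc sgn2_sym[of i j])
    finally show "Xop j * Dop j * Xop i = Xop i * (Xop j * Dop j) + (if i = j then Xop j else 0)" .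
  qed simp
  then show ?thesis by (simp add: sum.distrib Euler_def sum_distrib_left)
qed

lemma Euler_Dop: "Euler * Dop i = Dop i * Euler - Dop i"
proof -
  have "Dop i * Euler = (\<Sum>j\<in>UNIV. Xop j * Dop j * Dop i + (if i = j then Dop j else 0))"
    unfolding Euler_def sum_distrib_left
  proof (rule sum.cong)
    fix j
    have "Dop i * (Xop j * Dop j) = smul (sgn2 i j) (Xop j * (Dop i * Dop j)) + (if i = j then Dop j else 0)"
      by (simp add: mult.assoc[symmetric] Dop_Xop distrib_right)
    also have "smul (sgn2 i j) (Xop j * (Dop i * Dop j)) = Xop j * Dop j * Dop i"
      by (subst Dop_comm) (simp add: mult.assoc sgn2_sym[of i j])
    finally show "Dop i * (Xop j * Dop j) = Xop j * Dop j * Dop i + (if i = j then Dop j else 0)" .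
  qed simp
  then show ?thesis by (simp add: sum.distrib Euler_def sum_distrib_right)
qed

lemma Pop_Euler: "Pop * Euler = Euler * Pop"
proof -
  have "Pop * (Xop i * Dop i) = Xop i * Dop i * Pop" for i :: "'a + 'b"
  proof -
    have "Pop * (Xop i * Dop i) = smul ((-1) ^ par i) (Xop i * (Pop * Dop i))"
      by (simp add: mult.assoc[symmetric] Pop_Xop)
    then show ?thesis by (simp add: Pop_Dop mult.assoc)
  qed
  then show ?thesis by (simp add: Euler_def sum_distrib_left sum_distrib_right)
qed

lemma Euler_power_eigen:
  assumes "app Euler p = sp_scale c p"
  shows "app Euler (app (Xop i) p) = sp_scale (c + 1) (app (Xop i) p)"
    and "app Euler (app (Dop i) p) = sp_scale (c - 1) (app (Dop i) p)"
    and "app Euler (app Pop p) = sp_scale c (app Pop p)"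
proof -
  show "app Euler (app (Xop i) p) = sp_scale (c + 1) (app (Xop i) p)"
    using arg_cong[OF Euler_Xop, of "\<lambda>A. app A p" i] assms
    by (simp add: app_scale spoly.scale_left_distrib)
  show "app Euler (app (Dop i) p) = sp_scale (c - 1) (app (Dop i) p)"
    using arg_cong[OF Euler_Dop, of "\<lambda>A. app A p" i] assms
    by (simp add: app_scale spoly.scale_left_diff_distrib)
  show "app Euler (app Pop p) = sp_scale c (app Pop p)"
    using arg_cong[OF Pop_Euler, of "\<lambda>A. app A p"] assms
    by (simp add: app_scale)
qed

section \<open>Normally ordered operators\<close>

abbreviation Xword :: "('a + 'b) list \<Rightarrow> ('a::finite, 'b::{finite, linorder}) lop" where
  "Xword u \<equiv> prod_list (map Xop u)"

abbreviation Dword :: "('a + 'b) list \<Rightarrow> ('a::finite, 'b::{finite, linorder}) lop" where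
  "Dword w \<equiv> prod_list (map Dop w)"

lemma foldr_coord_mult: "foldr coord_mult u p = app (Xword u) p"
  by (induction u) (simp_all add: Xop.rep_eq)

lemma foldr_coord_deriv: "foldr coord_deriv w p = app (Dword w) p"
  by (induction w) (simp_all add: Dop.rep_eq)

definition pd_lop :: "nat \<Rightarrow> nat \<Rightarrow> ('a::finite, 'b::{finite, linorder}) lop set" where
  "pd_lop d e = lop.span {Xword u * Dword w | u w. length u = d \<and> length w = e}"

lemma finite_words: "finite {u :: 'c::finite list. length u = d}"
  using finite_lists_length_eq[of "UNIV :: 'c set" d] by simp

text \<open>There are finitely many words of each length, so the coefficient functions in
  \<open>pd_part\<close> describe all linear combinations of words. The span form permits induction
  without carrying coefficients along.\<close>

lemma pd_part_eq: "pd_part d e = app ` (pd_lop d e :: ('a::finite, 'b::{finite, linorder}) lop set)"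
proof -
  let ?F = "\<lambda>c. (\<Sum>u | length u = d. \<Sum>w | length w = e. smul (c u w) (Xword u * Dword w)) :: ('a, 'b) lop"
  have "pd_lop d e = range ?F"
  proof (rule antisym)
    have "lop.subspace (range ?F)"
    proof (rule lop.subspaceI)
      show "0 \<in> range ?F" by (rule range_eqI[of _ _ "\<lambda>_ _. 0"]) simp
    next
      fix A B assume "A \<in> range ?F" "B \<in> range ?F"
      then obtain c c' where "A = ?F c" "B = ?F c'" by auto
      then show "A + B \<in> range ?F"
        by (intro range_eqI[of _ _ "\<lambda>u w. c u w + c' u w"]) (simp add: lop.scale_left_distrib sum.distrib)
    next
      fix A x assume "A \<in> range ?F"
      then obtain c where "A = ?F c" by auto
      then show "smul x A \<in> range ?F"
        by (intro range_eqI[of _ _ "\<lambda>u w. x * c u w"]) (simp add: lop.scale_sum_right)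
    qed
    moreover have "{Xword u * Dword w | u w. length u = d \<and> length w = e} \<subseteq> range ?F"
    proof (rule subsetI, elim CollectE exE conjE)
      fix A :: "('a, 'b) lop" and u w assume A: "A = Xword u * Dword w" and len: "length u = d" "length w = e"
      \<comment> \<open>The coefficient function is the indicator of the pair (u, w), nested so that
        the inner and the outer sum collapse in turn.\<close>
      have inner: "(\<Sum>w' | length w' = e. smul (if u' = u then if w' = w then 1 else 0 else 0) (Xword u' * Dword w')) =
          (if u' = u then Xword u * Dword w else 0)" for u' :: "('a + 'b) list"
      proof (cases "u' = u")
        case True
        have "(\<Sum>w' | length w' = e. smul (if u' = u then if w' = w then 1 else 0 else 0) (Xword u' * Dword w')) =
            (\<Sum>w' | length w' = e. if w' = w then Xword u * Dword w else 0)"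
          using True by (intro sum.cong refl) auto
        also have "\<dots> = Xword u * Dword w"
          using len by (subst sum.delta) (auto intro: finite_words)
        finally show ?thesis by (simp only: True if_True refl)
      qed simp
      have "?F (\<lambda>u' w'. if u' = u then if w' = w then 1 else 0 else 0) =
          (\<Sum>u' | length u' = d. if u' = u then Xword u * Dword w else 0)"
        by (simp only: inner)
      also have "\<dots> = Xword u * Dword w"
        using len by (subst sum.delta) (auto intro: finite_words)
      finally have "Xword u * Dword w = ?F (\<lambda>u' w'. if u' = u then if w' = w then 1 else 0 else 0)"
        by (rule sym)
      then show "A \<in> range ?F"
        unfolding A by (rule range_eqI[where x = "\<lambda>u' w'. if u' = u then if w' = w then 1 else 0 else 0"])
    qed
    ultimately show "pd_lop d e \<subseteq> range ?F"
      unfolding pd_lop_def by (intro lop.span_minimal)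
    show "range ?F \<subseteq> pd_lop d e"
    proof (rule image_subsetI)
      fix c
      have "Xword u * Dword w \<in> pd_lop d e" if "length u = d" "length w = e" for u w :: "('a + 'b) list"
        unfolding pd_lop_def using that by (intro lop.span_base) blast
      then show "?F c \<in> pd_lop d e"
        unfolding pd_lop_def by (intro lop.span_sum lop.span_scale) simp
    qed
  qed
  moreover have "(\<lambda>p. \<Sum>u | length u = d. \<Sum>w | length w = e.
       sp_scale (c u w) (foldr coord_mult u (foldr coord_deriv w p))) = app (?F c)" for c
    by (rule ext) (simp add: app_sum_lop foldr_coord_mult foldr_coord_deriv)
  then have "pd_part d e = app ` range ?F"
    unfolding pd_part_def by auto
  ultimately show ?thesis by simp
qed

lemma pd_lop_induct [consumes 1, case_names word zero add smul]:
  assumes "A \<in> pd_lop d e"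
    and "\<And>u w. length u = d \<Longrightarrow> length w = e \<Longrightarrow> P (Xword u * Dword w)"
    and "P 0" and "\<And>A B. P A \<Longrightarrow> P B \<Longrightarrow> P (A + B)" and "\<And>c A. P A \<Longrightarrow> P (smul c A)"
  shows "P A"
  using assms(1) unfolding pd_lop_def
  by (rule lop.span_induct) (use assms in \<open>auto intro!: lop.subspaceI\<close>)

lemma subspace_pd_lop: "lop.subspace (pd_lop d e)"
  by (simp add: pd_lop_def)

lemmas pd_lop_zero = lop.subspace_0[OF subspace_pd_lop]
  and pd_lop_add = lop.subspace_add[OF subspace_pd_lop]
  and pd_lop_smul = lop.subspace_scale[OF subspace_pd_lop]
  and pd_lop_sum = lop.subspace_sum[OF subspace_pd_lop]

lemma pd_lop_Xop: "A \<in> pd_lop d e \<Longrightarrow> Xop i * A \<in> pd_lop (Suc d) e"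
proof (induction rule: pd_lop_induct)
  case (word u w)
  then show ?case unfolding pd_lop_def
    by (intro lop.span_base CollectI exI[of _ "i # u"] exI[of _ w]) (simp add: mult.assoc)
qed (simp_all add: pd_lop_zero pd_lop_add pd_lop_smul distrib_left)

lemma pd_lop_Dop: "A \<in> pd_lop d e \<Longrightarrow> A * Dop i \<in> pd_lop d (Suc e)"
proof (induction rule: pd_lop_induct)
  case (word u w)
  then show ?case unfolding pd_lop_def
    by (intro lop.span_base CollectI exI[of _ u] exI[of _ "w @ [i]"]) (simp add: mult.assoc)
qed (simp_all add: pd_lop_zero pd_lop_add pd_lop_smul distrib_right)

lemma one_in_pd_lop: "1 \<in> pd_lop 0 0"
  unfolding pd_lop_def by (intro lop.span_base CollectI exI[of _ "[]"]) simp

lemma Dword_Euler: "Euler * Dword w = Dword w * (Euler - of_nat (length w))"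
proof (induction w)
  case (Cons i w)
  have "Euler * Dword (i # w) = Dop i * (Euler * Dword w) - Dop i * Dword w"
    by (simp add: mult.assoc[symmetric] Euler_Dop left_diff_distrib)
  then show ?case by (simp add: Cons algebra_simps)
qed simp

text \<open>Moving \<open>Pop ^ par i\<close> past the j-th generator produces
  \<open>sgn2 i j\<close>, which cancels the sign of the supercommutation. The twisted generator
  thus commutes with the untwisted ones in the ordinary sense.\<close>

lemma parity_conj_words:
  "Xop i * Pop ^ par i * Xword u = Xword u * (Xop i * Pop ^ par i)"
  "Pop ^ par i * Dop i * Dword w = Dword w * (Pop ^ par i * Dop i)"
proof -
  have X: "Xop i * Pop ^ par i * Xop j = Xop j * (Xop i * Pop ^ par i)" for j :: "'a + 'b"
  proof -
    have "Pop ^ par i * Xop j = smul (sgn2 i j) (Xop j * Pop ^ par i)"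
      by (cases i) (simp_all add: sgn2_def Pop_Xop)
    then have "Xop i * Pop ^ par i * Xop j = smul (sgn2 i j) (Xop i * Xop j * Pop ^ par i)"
      by (simp add: mult.assoc)
    also have "\<dots> = Xop j * (Xop i * Pop ^ par i)"
      by (subst Xop_comm) (simp add: mult.assoc)
    finally show ?thesis .
  qed
  have D: "Pop ^ par i * Dop i * Dop j = Dop j * (Pop ^ par i * Dop i)" for j :: "'a + 'b"
  proof -
    have "Pop ^ par i * Dop j = smul (sgn2 i j) (Dop j * Pop ^ par i)"
      by (cases i) (simp_all add: sgn2_def Pop_Dop)
    then have "Dop j * (Pop ^ par i * Dop i) = smul (sgn2 i j) (Pop ^ par i * (Dop j * Dop i))"
      by (simp add: mult.assoc[symmetric])
    also have "\<dots> = Pop ^ par i * Dop i * Dop j"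
      by (subst Dop_comm) (simp add: mult.assoc sgn2_sym[of j i])
    finally show ?thesis by simp
  qed
  show "Xop i * Pop ^ par i * Xword u = Xword u * (Xop i * Pop ^ par i)"
  proof (induction u)
    case (Cons j u)
    have "Xop i * Pop ^ par i * Xword (j # u) = Xop i * Pop ^ par i * Xop j * Xword u"
      by (simp add: mult.assoc)
    also have "\<dots> = Xop j * (Xop i * Pop ^ par i * Xword u)"
      unfolding X by (simp only: mult.assoc)
    finally show ?case by (simp only: Cons) (simp add: mult.assoc)
  qed simp
  show "Pop ^ par i * Dop i * Dword w = Dword w * (Pop ^ par i * Dop i)"
  proof (induction w)
    case (Cons j w)
    have "Pop ^ par i * Dop i * Dword (j # w) = Pop ^ par i * Dop i * Dop j * Dword w"
      by (simp add: mult.assoc)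
    also have "\<dots> = Dop j * (Pop ^ par i * Dop i * Dword w)"
      unfolding D by (simp only: mult.assoc)
    finally show ?case by (simp only: Cons) (simp add: mult.assoc)
  qed simp
qed

text \<open>
  The parity twists make the outer factors commute with the factors of \<open>A\<close>.  By induction on the
  degree, an operator of order \<open>e\<close> is therefore determined by its restriction to degree \<open>e\<close>.
\<close>

lemma pd_lop_Euler_sandwich:
  assumes "A \<in> pd_lop d e"
  shows "(\<Sum>i\<in>UNIV. Xop i * Pop ^ par i * A * (Pop ^ par i * Dop i)) = A * (Euler - of_nat e)"
  using assms
proof (induction rule: pd_lop_induct)
  case (word u w)
  have Pop2: "Pop ^ par i * (Pop ^ par i * B) = B" for i :: "'a + 'b" and B :: "('a, 'b) lop"
    by (cases i) (simp_all add: mult.assoc[symmetric])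
  have "Xop i * Pop ^ par i * (Xword u * Dword w) * (Pop ^ par i * Dop i) =
     Xword u * (Xop i * Dop i) * Dword w" for i :: "'a + 'b"
  proof -
    have "Xop i * Pop ^ par i * (Xword u * Dword w) * (Pop ^ par i * Dop i) =
        (Xop i * Pop ^ par i * Xword u) * (Dword w * (Pop ^ par i * Dop i))"
      by (simp add: mult.assoc)
    also have "\<dots> = Xword u * (Xop i * (Pop ^ par i * (Pop ^ par i * (Dop i * Dword w))))"
      unfolding parity_conj_words(1) parity_conj_words(2)[symmetric] by (simp add: mult.assoc)
    finally show ?thesis by (simp add: Pop2 mult.assoc)
  qed
  then have "(\<Sum>i\<in>UNIV. Xop i * Pop ^ par i * (Xword u * Dword w) * (Pop ^ par i * Dop i)) =
      Xword u * (Euler * Dword w)"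
    by (simp add: Euler_def sum_distrib_left sum_distrib_right mult.assoc)
  then show ?case using word by (simp add: Dword_Euler mult.assoc)
next
  case (smul c A)
  have "(\<Sum>i\<in>UNIV. Xop i * Pop ^ par i * smul c A * (Pop ^ par i * Dop i)) =
    smul c (\<Sum>i\<in>UNIV. Xop i * Pop ^ par i * A * (Pop ^ par i * Dop i))"
    by (simp add: lop.scale_sum_right)
  then show ?case by (simp add: smul)
next
  case (add A B)
  have "(\<Sum>i\<in>UNIV. Xop i * Pop ^ par i * (A + B) * (Pop ^ par i * Dop i)) =
    (\<Sum>i\<in>UNIV. Xop i * Pop ^ par i * A * (Pop ^ par i * Dop i)) +
    (\<Sum>i\<in>UNIV. Xop i * Pop ^ par i * B * (Pop ^ par i * Dop i))"
    by (simp add: distrib_left distrib_right sum.distrib)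
  then show ?case by (simp only: add distrib_right)
qed simp

lemma pd_lop_eq_0I:
  fixes A :: "('a::finite, 'b::{finite, linorder}) lop"
  assumes A: "A \<in> pd_lop d e" and zero: "\<And>p. p \<in> hom_spolys e \<Longrightarrow> app A p = 0"
  shows "A = 0"
proof -
  have "app A p = 0" if "p \<in> hom_spolys f" for f p
    using that
  proof (induction f arbitrary: p)
    case (0 p)
    show ?case
    proof (cases "e = 0")
      case False
      \<comment> \<open>A derivative of a degree 0 element would have degree -1. The sandwich
        identity then leaves -e times \<open>app A p\<close>, with e nonzero in this case.\<close>
      have "app (Dop i) p = 0" for i
      proof (rule ccontr)
        assume nz: "app (Dop i) p \<noteq> 0"
        have "app Euler (app (Dop i) p) = sp_scale (- 1) (app (Dop i) p)"
          using Euler_power_eigen(2)[of p 0 i] 0 by (simp add: hom_spolys_iff)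
        then obtain d where "(- 1 :: complex) = of_nat d"
          using nz by (rule Euler_eigenvalue_nat)
        then show False
          by (metis of_nat_Suc of_nat_eq_0_iff add.right_inverse nat.distinct(1))
      qed
      then have "app (A * (Euler - of_nat e)) p = 0"
        unfolding pd_lop_Euler_sandwich[OF A, symmetric] by (simp add: app_sum_lop)
      then show ?thesis using 0 False
        by (simp add: hom_spolys_iff of_nat_eq_smul app_diff app_scale)
    qed (use 0 zero in auto)
  next
    case (Suc f p)
    show ?case
    proof (cases "Suc f = e")
      case False
      \<comment> \<open>The derivatives have degree f, so the induction hypothesis kills the
        sandwich. What is left is \<open>app A p\<close> times f + 1 - e, which is nonzero
        here.\<close>
      have "app (Pop ^ par i * Dop i) p \<in> hom_spolys f" for i
        using Suc.prems Euler_power_eigen(2)[of p "of_nat (Suc f)" i]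
          Euler_power_eigen(3)[of "app (Dop i) p" "of_nat f"]
        by (cases i) (simp_all add: hom_spolys_iff)
      then have "app (A * (Euler - of_nat e)) p = 0"
        unfolding pd_lop_Euler_sandwich[OF A, symmetric]
        by (simp add: app_sum_lop Suc.IH del: app_lop(6)) (simp add: Suc.IH)
      then have "sp_scale (of_nat (Suc f) - of_nat e) (app A p) = 0" using Suc.prems
        by (simp add: hom_spolys_iff of_nat_eq_smul app_diff app_scale spoly.scale_left_diff_distrib
            del: of_nat_Suc)
      then show ?thesis using False
        by (simp del: of_nat_Suc)
    qed (use Suc.prems zero in auto)
  qed
  moreover have "Poly_Mapping.single u 1 \<in> hom_spolys (mdeg u)" for u :: "('a, 'b) smon"
    by (auto simp: hom_spolys_def mdeg_def)
  ultimately show ?thesis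
    by (intro lop_eq_on_monomialsI) auto
qed

section \<open>The orthosymplectic dual pair\<close>

text \<open>
  \<open>G\<close> is the Gram matrix of the form with the sign that makes it supersymmetric in the sense
  of the coordinate functions: \<open>G i j = (-1)^|i| \<omega>(e_i, e_j)\<close>.
\<close>

locale supersym_form =
  fixes G H :: "'a::finite + 'b::{finite, linorder} \<Rightarrow> 'a + 'b \<Rightarrow> complex"
  assumes G_sym: "G i j = sgn2 i j * G j i"
    and G_par: "par i \<noteq> par j \<Longrightarrow> G i j = 0"
    and GH: "(\<Sum>j\<in>UNIV. G i j * H j l) = (if i = l then 1 else 0)"
    and HG: "(\<Sum>j\<in>UNIV. H i j * G j l) = (if i = l then 1 else 0)"
begin

text \<open>Since \<open>H\<close> is also a left inverse, right inverses of \<open>G\<close> are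
  unique. Each symmetry of \<open>G\<close> produces another right inverse and so passes to
  \<open>H\<close>.\<close>

lemma H_unique:
  assumes "\<And>i l. (\<Sum>j\<in>UNIV. G i j * H' j l) = (if i = l then 1 else 0)"
  shows "H' i l = H i l"
proof -
  have "H i l = (\<Sum>j\<in>UNIV. H i j * (\<Sum>m\<in>UNIV. G j m * H' m l))"
    by (simp add: assms if_distrib sum.delta cong: if_cong)
  also have "\<dots> = (\<Sum>m\<in>UNIV. (\<Sum>j\<in>UNIV. H i j * G j m) * H' m l)"
    by (simp add: sum_distrib_left sum_distrib_right mult.assoc) (rule sum.swap)
  also have "\<dots> = H' i l"
    by (simp add: HG if_distrib[of "\<lambda>c. c * _"] sum.delta' cong: if_cong)
  finally show ?thesis by simp
qed

lemma H_par: "par i \<noteq> par j \<Longrightarrow> H i j = 0"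
proof -
  assume ne: "par i \<noteq> par j"
  have "(-1) ^ par i * H i j * (-1) ^ par j = H i j"
  proof (rule H_unique)
    fix i l
    have "(\<Sum>j\<in>UNIV. G i j * ((-1) ^ par j * H j l * (-1) ^ par l)) =
        (-1) ^ par i * (-1) ^ par l * (\<Sum>j\<in>UNIV. G i j * H j l)"
      unfolding sum_distrib_left
    proof (rule sum.cong)
      fix j show "G i j * ((-1) ^ par j * H j l * (-1) ^ par l) = (-1) ^ par i * (-1) ^ par l * (G i j * H j l)"
        by (cases "par i = par j") (simp_all add: G_par)
    qed simp
    then show "(\<Sum>j\<in>UNIV. G i j * ((-1) ^ par j * H j l * (-1) ^ par l)) = (if i = l then 1 else 0)"
      by (simp add: GH)
  qed
  with ne show ?thesis by (cases i; cases j) auto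
qed

lemma H_sym: "H i j = sgn2 i j * H j i"
proof -
  have "sgn2 i j * H j i = H i j"
  proof (rule H_unique)
    fix i l
    have "(\<Sum>j\<in>UNIV. G i j * (sgn2 j l * H l j)) = (\<Sum>j\<in>UNIV. H l j * G j i)"
    proof (rule sum.cong)
      fix j show "G i j * (sgn2 j l * H l j) = H l j * G j i"
      proof (cases "par i = par j \<and> par j = par l")
        case True
        then have "sgn2 j l = sgn2 i j" by (simp add: sgn2_def)
        then show ?thesis by (subst G_sym) (simp add: mult_ac)
      qed (auto simp: G_par[of i j] G_par[of j i] H_par)
    qed simp
    then show "(\<Sum>j\<in>UNIV. G i j * (sgn2 j l * H l j)) = (if i = l then 1 else 0)"
      by (auto simp: HG)
  qed
  then show ?thesis by simp
qed

text \<open>The form pairs only indices of equal parity, so a sign attached to one index may be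
  moved to the other.\<close>

lemma sgn2_G: "sgn2 i c * G i j = sgn2 j c * G i j" "sgn2 c i * G i j = sgn2 c j * G i j"
  by (cases "par i = par j"; simp add: G_par sgn2_def)+

lemma sgn2_H: "sgn2 i c * H i j = sgn2 j c * H i j" "sgn2 c i * H i j = sgn2 c j * H i j"
  by (cases "par i = par j"; simp add: H_par sgn2_def)+

text \<open>The derivative with its index raised by the inverse form; \<open>xs\<close> is the
  coordinate with its index lowered. \<open>rr\<close> and \<open>Lap\<close> contract these with
  the plain generators without a factor 1/2, hence the factor 4 in \<open>Lap_rr\<close>.\<close>

definition nab :: "'a + 'b \<Rightarrow> ('a, 'b) lop" where
  "nab c = (\<Sum>i\<in>UNIV. smul (H c i) (Dop i))"

definition xs :: "'a + 'b \<Rightarrow> ('a, 'b) lop" where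
  "xs b = (\<Sum>c\<in>UNIV. smul (G b c) (Xop c))"

definition rr :: "('a, 'b) lop" where
  "rr = (\<Sum>i\<in>UNIV. Xop i * xs i)"

definition Lap :: "('a, 'b) lop" where
  "Lap = (\<Sum>j\<in>UNIV. nab j * Dop j)"

definition sdim :: complex where
  "sdim = (\<Sum>i::'a + 'b\<in>UNIV. (-1) ^ par i)"

lemma sum_smul_delta: "(\<Sum>i\<in>UNIV. smul (if i = a then 1 else 0) (A i)) = A a"
  "(\<Sum>i\<in>UNIV. smul (if a = i then 1 else 0) (A i)) = A a" for A :: "'a + 'b \<Rightarrow> ('a, 'b) lop"
  by (simp_all add: smul_if(2) cong: if_cong)

lemma G_nab: "(\<Sum>j\<in>UNIV. smul (G i j) (nab j)) = Dop i"
proof -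
  have "(\<Sum>j\<in>UNIV. smul (G i j) (nab j)) = (\<Sum>l\<in>UNIV. \<Sum>j\<in>UNIV. smul (G i j * H j l) (Dop l))"
    unfolding nab_def by (simp add: lop.scale_sum_right) (rule sum.swap)
  then show ?thesis by (simp add: lop.scale_sum_left[symmetric] GH sum_smul_delta)
qed

lemma xs_nab: "(\<Sum>i\<in>UNIV. smul (sgn2 i i) (xs i * nab i)) = Euler"
proof -
  have *: "sgn2 i i * G i c = G c i" for i c
  proof (cases "par i = par c")
    case True
    then show ?thesis
      by (subst (2) G_sym) (simp add: sgn2_def)
  qed (simp add: G_par)
  have "smul (sgn2 i i) (xs i * nab i) = (\<Sum>c\<in>UNIV. smul (G c i) (Xop c * nab i))" for i
    unfolding xs_def sum_distrib_right lop.scale_sum_right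
    by (rule sum.cong) (simp_all add: * del: lop.scale_eq_0_iff lop.scale_cancel_left lop.scale_cancel_right)
  then have "(\<Sum>i\<in>UNIV. smul (sgn2 i i) (xs i * nab i)) =
      (\<Sum>i\<in>UNIV. \<Sum>c\<in>UNIV. smul (G c i) (Xop c * nab i))"
    by (simp only:)
  also have "\<dots> = (\<Sum>c\<in>UNIV. \<Sum>i\<in>UNIV. smul (G c i) (Xop c * nab i))"
    by (rule sum.swap)
  also have "\<dots> = (\<Sum>c\<in>UNIV. Xop c * (\<Sum>i\<in>UNIV. smul (G c i) (nab i)))"
    unfolding sum_distrib_left by (simp only: smul_mult_right)
  finally show ?thesis unfolding G_nab Euler_def .
qed

lemma nab_Dop: "nab c * Dop j = smul (sgn2 c j) (Dop j * nab c)"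
  unfolding nab_def sum_distrib_left sum_distrib_right lop.scale_sum_right
proof (rule sum.cong)
  fix i
  show "smul (H c i) (Dop i) * Dop j = smul (sgn2 c j) (Dop j * smul (H c i) (Dop i))"
    unfolding smul_mult_left smul_mult_right Dop_comm[of i j] lop.scale_scale sgn2_H(1)[of c j i]
    by (simp only: mult.commute)
qed simp

lemma nab_nab: "nab c * nab d = smul (sgn2 c d) (nab d * nab c)"
proof -
  have "nab c * nab d = (\<Sum>j\<in>UNIV. smul (H d j) (nab c * Dop j))"
    by (simp add: nab_def[of d] sum_distrib_left)
  also have "\<dots> = (\<Sum>j\<in>UNIV. smul (sgn2 c j * H d j) (Dop j * nab c))"
    by (simp add: nab_Dop mult.commute)
  also have "\<dots> = smul (sgn2 c d) (nab d * nab c)"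
    unfolding sgn2_H(2)[of c d, symmetric]
    by (simp add: nab_def[of d] sum_distrib_right lop.scale_sum_right)
  finally show ?thesis .
qed

lemma nab_Xop: "nab c * Xop j = smul (sgn2 c j) (Xop j * nab c) + smul (H c j) 1"
proof -
  have "nab c * Xop j = (\<Sum>i\<in>UNIV. smul (sgn2 i j * H c i) (Xop j * Dop i) + (if i = j then smul (H c i) 1 else 0))"
    unfolding nab_def sum_distrib_right
    by (rule sum.cong) (auto simp: Dop_Xop lop.scale_right_distrib mult.commute)
  also have "\<dots> = (\<Sum>i\<in>UNIV. smul (sgn2 c j * H c i) (Xop j * Dop i)) + smul (H c j) 1"
    unfolding sgn2_H(1)[of c j, symmetric] by (simp add: sum.distrib)
  finally show ?thesis by (simp add: nab_def sum_distrib_left lop.scale_sum_right)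
qed

lemma Xop_xs: "Xop i * xs j = smul (sgn2 i j) (xs j * Xop i)"
  unfolding xs_def sum_distrib_left sum_distrib_right lop.scale_sum_right
proof (rule sum.cong)
  fix c
  have "Xop i * smul (G j c) (Xop c) = smul (sgn2 i c * G j c) (Xop c * Xop i)"
    using Xop_comm[of i c] by (simp add: mult.commute)
  also have "sgn2 i c * G j c = sgn2 i j * G j c"
    by (rule sgn2_G(2)[symmetric])
  finally show "Xop i * smul (G j c) (Xop c) = smul (sgn2 i j) (smul (G j c) (Xop c) * Xop i)" by simp
qed simp

lemma sum_G_H: "(\<Sum>c\<in>UNIV. G a c * H b c) = (if a = b then (-1) ^ par a else 0)"
proof -
  have "(\<Sum>c\<in>UNIV. G a c * H b c) = (\<Sum>c\<in>UNIV. (-1) ^ par b * (G a c * H c b))"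
  proof (rule sum.cong)
    fix c
    show "G a c * H b c = (-1) ^ par b * (G a c * H c b)"
    proof (cases "par b = par c")
      case True
      then have "sgn2 b c = (-1) ^ par b" by (cases b; cases c) (auto simp: sgn2_def)
      then show ?thesis using H_sym[of b c] by simp
    qed (simp add: H_par)
  qed simp
  then show ?thesis by (simp add: sum_distrib_left[symmetric] GH)
qed

lemma nab_xs: "nab b * xs a = smul (sgn2 b a) (xs a * nab b) + smul (if a = b then (-1) ^ par a else 0) 1"
proof -
  have "nab b * xs a = (\<Sum>c\<in>UNIV. smul (sgn2 b c * G a c) (Xop c * nab b) + smul (G a c * H b c) 1)"
    unfolding xs_def sum_distrib_left
    by (rule sum.cong) (simp_all add: nab_Xop lop.scale_right_distrib mult.commute)
  also have "\<dots> = (\<Sum>c\<in>UNIV. smul (sgn2 b a * G a c) (Xop c * nab b)) +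
      smul (if a = b then (-1) ^ par a else 0) 1"
    unfolding sgn2_G(2)[of b a, symmetric]
    by (simp add: sum.distrib lop.scale_sum_left[symmetric] sum_G_H)
  finally show ?thesis by (simp add: xs_def sum_distrib_right lop.scale_sum_right)
qed

lemma sgn2_self: "sgn2 i i = (-1) ^ par i"
  by (cases i) (simp_all add: sgn2_def)

text \<open>The superdimension enters here, as the sum of the commutators of \<open>nab b\<close>
  with \<open>xs b\<close> up to Koszul signs.\<close>

lemma sum_nab_xs: "(\<Sum>b\<in>UNIV. nab b * xs b) = Euler + smul sdim 1"
  by (simp add: nab_xs sum.distrib xs_nab sdim_def lop.scale_sum_left)

lemma rr_Xop: "rr * Xop j = Xop j * rr"
proof -
  have "Xop i * xs i * Xop j = Xop j * (Xop i * xs i)" for i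
  proof -
    have "Xop j * (Xop i * xs i) = smul (sgn2 j i) (Xop i * (Xop j * xs i))"
      by (simp add: mult.assoc[symmetric] Xop_comm[of j i])
    also have "\<dots> = Xop i * xs i * Xop j" by (simp add: Xop_xs[of j i] mult.assoc)
    finally show ?thesis by simp
  qed
  then show ?thesis by (simp add: rr_def sum_distrib_left sum_distrib_right)
qed

lemma nab_rr: "nab c * rr = rr * nab c + smul 2 (Xop c)"
proof -
  have "(\<Sum>i\<in>UNIV. smul (H c i) (xs i)) = Xop c"
    unfolding xs_def lop.scale_sum_right
    by (subst sum.swap) (simp add: lop.scale_sum_left[symmetric] HG sum_smul_delta)
  moreover have "nab c * (Xop i * xs i) = Xop i * xs i * nab c +
      smul (if i = c then 1 else 0) (Xop i) + smul (H c i) (xs i)" for i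
  proof -
    have "nab c * (Xop i * xs i) = smul (sgn2 c i) (Xop i * (nab c * xs i)) + smul (H c i) (xs i)"
      by (simp add: mult.assoc[symmetric] nab_Xop distrib_right)
    also have "Xop i * (nab c * xs i) = smul (sgn2 c i) (Xop i * xs i * nab c) +
        smul (if i = c then (-1) ^ par i else 0) (Xop i)"
      by (simp add: nab_xs distrib_left mult.assoc)
    finally show ?thesis
      by (auto simp: lop.scale_right_distrib sgn2_self)
  qed
  ultimately show ?thesis
    by (simp add: rr_def sum_distrib_left sum_distrib_right sum.distrib sum_smul_delta)
       (simp add: lop.scale_left_distrib[of 1 1, simplified] add.assoc)
qed

lemma Lap_Xop: "Lap * Xop j = Xop j * Lap + smul 2 (nab j)"
proof -
  have "(\<Sum>i\<in>UNIV. smul (sgn2 i j * H i j) (Dop i)) = nab j"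
    unfolding nab_def H_sym[of j] sgn2_sym[of j] by (rule refl)
  moreover have "nab i * Dop i * Xop j = Xop j * (nab i * Dop i) + smul (sgn2 i j * H i j) (Dop i) +
      (if i = j then nab i else 0)" for i
  proof -
    have "nab i * Dop i * Xop j = smul (sgn2 i j) (nab i * Xop j * Dop i) + (if i = j then nab i else 0)"
      by (simp add: mult.assoc Dop_Xop distrib_left)
    also have "nab i * Xop j * Dop i = smul (sgn2 i j) (Xop j * (nab i * Dop i)) + smul (H i j) (Dop i)"
      by (simp add: nab_Xop distrib_right mult.assoc)
    finally show ?thesis by (simp add: lop.scale_right_distrib)
  qed
  ultimately show ?thesis
    by (simp add: Lap_def sum_distrib_left sum_distrib_right sum.distrib)
       (simp add: lop.scale_left_distrib[of 1 1, simplified] add.assoc)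
qed

lemma Lap_Dop: "Lap * Dop j = Dop j * Lap"
proof -
  have "nab i * Dop i * Dop j = Dop j * (nab i * Dop i)" for i
  proof -
    have "nab i * Dop i * Dop j = smul (sgn2 i j) (nab i * Dop j * Dop i)"
      by (simp add: mult.assoc Dop_comm[of i j])
    then show ?thesis by (simp add: nab_Dop mult.assoc)
  qed
  then show ?thesis by (simp add: Lap_def sum_distrib_left sum_distrib_right)
qed

lemma Lap_nab: "Lap * nab j = nab j * Lap"
  by (simp add: nab_def sum_distrib_left sum_distrib_right Lap_Dop)

lemma Lap_xs: "Lap * xs i = xs i * Lap + smul 2 (Dop i)"
proof -
  have "Lap * xs i = (\<Sum>c\<in>UNIV. smul (G i c) (Xop c * Lap) + smul 2 (smul (G i c) (nab c)))"
    by (simp add: xs_def sum_distrib_left Lap_Xop lop.scale_right_distrib mult.commute)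
  then show ?thesis
    by (simp only: sum.distrib lop.scale_sum_right[symmetric] G_nab) (simp add: xs_def sum_distrib_right)
qed

text \<open>Passing \<open>Lap\<close> through the two factors of \<open>rr\<close> gives 2
  \<open>Euler\<close> from \<open>xs\<close> and twice the sum of the \<open>nab i * xs i\<close>
  from \<open>Xop\<close>; reordering the latter gives 2 \<open>Euler\<close> again together with
  the constant.\<close>

lemma Lap_rr: "Lap * rr = rr * Lap + smul 4 Euler + smul (2 * sdim) 1"
proof -
  have "Lap * (Xop i * xs i) = Xop i * xs i * Lap + smul 2 (Xop i * Dop i) + smul 2 (nab i * xs i)" for i
    by (simp add: mult.assoc[symmetric] Lap_Xop distrib_right)
      (simp add: mult.assoc Lap_xs distrib_left)
  then have "Lap * rr = rr * Lap + smul 2 Euler + smul 2 (\<Sum>i\<in>UNIV. nab i * xs i)"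
    by (simp add: rr_def sum_distrib_left sum_distrib_right sum.distrib lop.scale_sum_right Euler_def)
  also have "\<dots> = rr * Lap + smul 4 Euler + smul (2 * sdim) 1"
    by (simp add: sum_nab_xs lop.scale_right_distrib)
      (simp add: lop.scale_left_distrib[of 2 2, simplified] add.assoc)
  finally show ?thesis .
qed

lemma Euler_nab: "Euler * nab c = nab c * Euler - nab c"
  by (simp add: nab_def sum_distrib_left sum_distrib_right Euler_Dop lop.scale_right_diff_distrib sum_subtractf)

lemma Euler_xs: "Euler * xs c = xs c * Euler + xs c"
  by (simp add: xs_def sum_distrib_left sum_distrib_right Euler_Xop lop.scale_right_distrib sum.distrib)

lemma Euler_rr: "Euler * rr = rr * Euler + smul 2 rr"
proof -
  have "Euler * (Xop i * xs i) = Xop i * xs i * Euler + Xop i * xs i + Xop i * xs i" for i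
    by (simp add: mult.assoc[symmetric] Euler_Xop distrib_right)
      (simp add: mult.assoc Euler_xs distrib_left)
  then show ?thesis
    by (simp add: rr_def sum_distrib_left sum_distrib_right sum.distrib lop.scale_sum_right
        lop.scale_left_distrib[of 1 1, simplified] add.assoc)
qed

lemma Euler_Lap: "Euler * Lap = Lap * Euler - smul 2 Lap"
proof -
  have "Euler * (nab i * Dop i) = nab i * Dop i * Euler - nab i * Dop i - nab i * Dop i" for i
    by (simp add: mult.assoc[symmetric] Euler_nab left_diff_distrib)
      (simp add: mult.assoc Euler_Dop right_diff_distrib)
  then have "Euler * Lap = Lap * Euler - Lap - Lap"
    by (simp add: Lap_def sum_distrib_left sum_distrib_right sum_subtractf)
  then show ?thesis
    by (simp add: lop.scale_left_distrib[of 1 1, simplified])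
qed

lemma Pop_nab: "Pop * nab i = smul ((-1) ^ par i) (nab i * Pop)"
  unfolding nab_def sum_distrib_left sum_distrib_right lop.scale_sum_right
proof (rule sum.cong)
  fix j show "Pop * smul (H i j) (Dop j) = smul ((-1) ^ par i) (smul (H i j) (Dop j) * Pop)"
    by (cases "par i = par j") (simp_all add: Pop_Dop H_par mult.commute)
qed simp

lemma Pop_xs: "Pop * xs i = smul ((-1) ^ par i) (xs i * Pop)"
  unfolding xs_def sum_distrib_left sum_distrib_right lop.scale_sum_right
proof (rule sum.cong)
  fix j show "Pop * smul (G i j) (Xop j) = smul ((-1) ^ par i) (smul (G i j) (Xop j) * Pop)"
    by (cases "par i = par j") (simp_all add: Pop_Xop G_par mult.commute)
qed simp

lemma Pop_rr: "Pop * rr = rr * Pop"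
proof -
  have "Pop * (Xop i * xs i) = Xop i * xs i * Pop" for i
    by (simp add: mult.assoc[symmetric] Pop_Xop) (simp add: mult.assoc Pop_xs)
  then show ?thesis by (simp add: rr_def sum_distrib_left sum_distrib_right)
qed

lemma Pop_Lap: "Pop * Lap = Lap * Pop"
proof -
  have "Pop * (nab i * Dop i) = nab i * Dop i * Pop" for i
    by (simp add: mult.assoc[symmetric] Pop_nab) (simp add: mult.assoc Pop_Dop)
  then show ?thesis by (simp add: Lap_def sum_distrib_left sum_distrib_right)
qed

text \<open>For superskew \<open>Z = lower X\<close> this is the action of X, see
  \<open>glop_superskew\<close>. With both indices lowered, the orthosymplectic condition is plain
  superskewness.\<close>

definition act :: "('a + 'b \<Rightarrow> 'a + 'b \<Rightarrow> complex) \<Rightarrow> ('a, 'b) lop" where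
  "act Z = (\<Sum>j\<in>UNIV. \<Sum>c\<in>UNIV. smul (Z j c) (Xop j * nab c))"

definition superskew :: "('a + 'b \<Rightarrow> 'a + 'b \<Rightarrow> complex) \<Rightarrow> bool" where
  "superskew Z \<longleftrightarrow> (\<forall>i j. Z j i = - sgn2 i j * Z i j)"

text \<open>Renaming the summation indices and supercommuting the factors shows that the sum is its
  own negative. This is why \<open>rr\<close> and \<open>Lap\<close> are invariant: their
  commutators with \<open>act Z\<close> are such contractions.\<close>

lemma superskew_contract:
  fixes A :: "'a + 'b \<Rightarrow> ('a, 'b) lop"
  assumes "superskew Z" and comm: "\<And>i j. A i * A j = smul (sgn2 i j) (A j * A i)"
  shows "(\<Sum>j\<in>UNIV. \<Sum>c\<in>UNIV. smul (Z j c) (A j * A c)) = 0" (is "?S = 0")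
proof -
  have "?S = (\<Sum>j\<in>UNIV. \<Sum>c\<in>UNIV. smul (Z c j) (A c * A j))"
    by (rule sum.swap)
  also have "\<dots> = (\<Sum>j\<in>UNIV. \<Sum>c\<in>UNIV. - smul (Z j c) (A j * A c))"
  proof (intro sum.cong refl)
    fix j c
    have "Z c j = - sgn2 j c * Z j c" using assms(1) unfolding superskew_def by blast
    then show "smul (Z c j) (A c * A j) = - smul (Z j c) (A j * A c)"
      by (subst comm) (simp add: sgn2_sym[of c j])
  qed
  also have "\<dots> = - ?S" by (simp add: sum_negf)
  finally have "?S + ?S = 0"
    by (rule eq_neg_iff_add_eq_0[THEN iffD1])
  moreover have "smul 2 ?S = ?S + ?S"
    using lop.scale_left_distrib[of 1 1 ?S] by (simp only: one_add_one lop.scale_one)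
  ultimately have "smul 2 ?S = 0" by (simp only:)
  then show ?thesis by (simp only: lop.scale_eq_0_iff) simp
qed

lemma act_rr: assumes "superskew Z" shows "act Z * rr = rr * act Z"
proof -
  have "Xop j * nab c * rr = rr * (Xop j * nab c) + smul 2 (Xop j * Xop c)" for j c
  proof -
    have "Xop j * nab c * rr = Xop j * rr * nab c + smul 2 (Xop j * Xop c)"
      by (simp add: mult.assoc nab_rr distrib_left)
    then show ?thesis by (simp only: rr_Xop[symmetric]) (simp only: mult.assoc)
  qed
  then have "act Z * rr = rr * act Z + smul 2 (\<Sum>j\<in>UNIV. \<Sum>c\<in>UNIV. smul (Z j c) (Xop j * Xop c))"
    by (simp add: act_def sum_distrib_left sum_distrib_right lop.scale_right_distrib sum.distrib
        lop.scale_sum_right mult.commute)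
  then show ?thesis by (simp add: superskew_contract[OF assms Xop_comm])
qed

lemma act_Lap: assumes "superskew Z" shows "act Z * Lap = Lap * act Z"
proof -
  have "Lap * (Xop j * nab c) = Xop j * nab c * Lap + smul 2 (nab j * nab c)" for j c
  proof -
    have "Lap * (Xop j * nab c) = Xop j * (Lap * nab c) + smul 2 (nab j * nab c)"
      by (simp add: mult.assoc[symmetric] Lap_Xop distrib_right)
    then show ?thesis by (simp add: Lap_nab mult.assoc)
  qed
  then have "Lap * act Z = act Z * Lap + smul 2 (\<Sum>j\<in>UNIV. \<Sum>c\<in>UNIV. smul (Z j c) (nab j * nab c))"
    by (simp add: act_def sum_distrib_left sum_distrib_right lop.scale_right_distrib sum.distrib
        lop.scale_sum_right mult.commute)
  then show ?thesis by (simp add: superskew_contract[OF assms nab_nab])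
qed

lemma act_Euler: "act Z * Euler = Euler * act Z"
proof -
  have "Euler * (Xop j * nab c) = Xop j * nab c * Euler" for j c
    by (simp add: mult.assoc[symmetric] Euler_Xop distrib_right)
      (simp add: mult.assoc Euler_nab right_diff_distrib)
  then show ?thesis by (simp add: act_def sum_distrib_left sum_distrib_right)
qed

text \<open>The Casimir element summed over all ordered pairs of indices in place of a basis; the
  two factors are \<open>act (LZ a b)\<close> and \<open>act (BZ a b)\<close>.
  \<open>dual_bases_casimir\<close> identifies it with the sum over any dual bases.\<close>

definition casimir_lop :: "('a, 'b) lop" where
  "casimir_lop = (\<Sum>a\<in>UNIV. \<Sum>b\<in>UNIV. (Xop a * nab b - smul (sgn2 a b) (Xop b * nab a)) *
     smul (1/2) (xs b * Dop a - smul (sgn2 a b) (xs a * Dop b)))"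

lemma casimir_lop_eq:
  "casimir_lop = Euler * Euler + smul (sdim - 2) Euler - rr * Lap"
proof -
  define L where "L a b = Xop a * nab b - smul (sgn2 a b) (Xop b * nab a)" for a b
  define B where "B a b = xs b * Dop a - smul (sgn2 a b) (xs a * Dop b)" for a b
  \<comment> \<open>By this symmetry the two halves of \<open>L\<close> contribute equally, which
    cancels the factor 1/2.\<close>
  have B_swap: "smul (sgn2 a b) (B b a) = - B a b" for a b
    by (simp add: B_def lop.scale_right_diff_distrib sgn2_sym[of b a])
  have "(\<Sum>a\<in>UNIV. \<Sum>b\<in>UNIV. smul (sgn2 a b) (Xop b * nab a) * B a b) =
      (\<Sum>b\<in>UNIV. \<Sum>a\<in>UNIV. Xop b * nab a * smul (sgn2 a b) (B a b))"
    by (subst sum.swap) simp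
  also have "\<dots> = (\<Sum>b\<in>UNIV. \<Sum>a\<in>UNIV. - (Xop b * nab a * B b a))"
  proof (intro sum.cong refl)
    fix b a
    have "Xop b * nab a * smul (sgn2 a b) (B a b) = Xop b * nab a * smul (sgn2 b a) (B a b)"
      by (simp only: sgn2_sym[of a b])
    also have "\<dots> = - (Xop b * nab a * B b a)"
      unfolding B_swap by simp
    finally show "Xop b * nab a * smul (sgn2 a b) (B a b) = - (Xop b * nab a * B b a)" .
  qed
  finally have "(\<Sum>a\<in>UNIV. \<Sum>b\<in>UNIV. L a b * B a b) = smul 2 (\<Sum>a\<in>UNIV. \<Sum>b\<in>UNIV. Xop a * nab b * B a b)"
    by (simp add: L_def left_diff_distrib sum_subtractf sum_negf lop.scale_left_distrib[of 1 1, simplified])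
  then have "casimir_lop = (\<Sum>a\<in>UNIV. \<Sum>b\<in>UNIV. Xop a * nab b * B a b)"
    unfolding casimir_lop_def L_def[symmetric] B_def[symmetric]
    by (simp add: lop.scale_sum_right[symmetric])
  also have "\<dots> = (\<Sum>a\<in>UNIV. \<Sum>b\<in>UNIV. Xop a * (nab b * xs b) * Dop a) -
      (\<Sum>a\<in>UNIV. \<Sum>b\<in>UNIV. smul (sgn2 a b) (Xop a * (nab b * xs a) * Dop b))"
    by (simp add: B_def right_diff_distrib sum_subtractf mult.assoc)
  also have "(\<Sum>a\<in>UNIV. \<Sum>b\<in>UNIV. Xop a * (nab b * xs b) * Dop a) =
      (\<Sum>a\<in>UNIV. Xop a * (Euler + smul sdim 1) * Dop a)"
    by (simp add: sum_distrib_left[symmetric] sum_distrib_right[symmetric] sum_nab_xs)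
  also have "\<dots> = Euler * Euler + smul (sdim - 1) Euler"
  proof -
    have *: "Xop a * (Euler + smul sdim 1) * Dop a = Xop a * Dop a * (Euler + smul (sdim - 1) 1)" for a :: "'a + 'b"
      by (simp add: distrib_left distrib_right mult.assoc Euler_Dop right_diff_distrib lop.scale_left_diff_distrib)
    have "Euler * R = (\<Sum>a\<in>UNIV. Xop a * Dop a * R)" for R :: "('a, 'b) lop"
      by (simp only: Euler_def sum_distrib_right)
    from this[of "Euler + smul (sdim - 1) 1"]
    have "(\<Sum>a::'a + 'b\<in>UNIV. Xop a * (Euler + smul sdim 1) * Dop a) = Euler * (Euler + smul (sdim - 1) 1)"
      by (simp only: *)
    then show ?thesis by (simp add: distrib_left)
  qed
  also have "(\<Sum>a\<in>UNIV. \<Sum>b\<in>UNIV. smul (sgn2 a b) (Xop a * (nab b * xs a) * Dop b)) =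
      (\<Sum>a\<in>UNIV. \<Sum>b\<in>UNIV. Xop a * xs a * (nab b * Dop b) + (if a = b then Xop a * Dop b else 0))"
  proof (intro sum.cong refl)
    fix a b
    have "smul (sgn2 a b) (Xop a * (nab b * xs a) * Dop b) =
       Xop a * xs a * (nab b * Dop b) + smul (sgn2 a b * (if a = b then (-1) ^ par a else 0)) (Xop a * Dop b)"
      by (simp add: nab_xs distrib_left distrib_right lop.scale_right_distrib mult.assoc sgn2_sym[of b a])
    then show "smul (sgn2 a b) (Xop a * (nab b * xs a) * Dop b) =
       Xop a * xs a * (nab b * Dop b) + (if a = b then Xop a * Dop b else 0)"
      by (simp add: sgn2_self)
  qed
  also have "\<dots> = rr * Lap + Euler"
    by (simp add: sum.distrib rr_def Lap_def sum_product Euler_def)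
  finally show ?thesis
    by (simp add: lop.scale_left_diff_distrib lop.scale_left_distrib[of 1 1, simplified])
qed

end

section \<open>Matrices of the orthosymplectic Lie superalgebra\<close>

definition glop :: "('a::finite, 'b::{finite, linorder}) smat \<Rightarrow> ('a, 'b) lop" where
  "glop X = (\<Sum>i\<in>UNIV. \<Sum>j\<in>UNIV. smul (- ((-1) ^ ((par i + par j) * par i)) * X $ i $ j) (Xop j * Dop i))"

lemma gl_action_eq: "gl_action X = app (glop X)"
  by (rule ext) (simp add: gl_action_def glop_def app_sum_lop Xop.rep_eq Dop.rep_eq)

lemma glop_add: "glop (X + Y) = glop X + glop Y"
  by (simp only: glop_def vector_add_component distrib_left lop.scale_left_distrib sum.distrib)

lemma glop_mat: "glop (mat c) = smul (- c) Euler"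
proof -
  have "glop (mat c) = (\<Sum>i\<in>UNIV. \<Sum>j\<in>UNIV. if j = i then smul (- c) (Xop j * Dop i) else 0)"
    unfolding glop_def by (intro sum.cong refl) (auto simp: mat_def power_add)
  then show ?thesis by (simp add: Euler_def lop.scale_sum_right del: lop.scale_minus_left)
qed

definition trpair :: "('a::finite, 'b::finite) smat \<Rightarrow> ('a, 'b) smat \<Rightarrow> complex" where
  "trpair X Y = (\<Sum>i\<in>UNIV. \<Sum>j\<in>UNIV. (-1) ^ par i * X $ i $ j * Y $ j $ i)"

lemma supertrace_mult: "supertrace (X ** Y) = trpair X Y"
  by (simp add: supertrace_def trpair_def matrix_matrix_mult_def sum_distrib_left mult.assoc)

definition mscale :: "complex \<Rightarrow> ('a::finite, 'b::finite) smat \<Rightarrow> ('a, 'b) smat" where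
  "mscale c X = (\<chi> i j. c * X $ i $ j)"

lemma mscale_nth [simp]: "mscale c X $ i $ j = c * X $ i $ j"
  by (simp add: mscale_def)

global_interpretation smat: vector_space "mscale :: complex \<Rightarrow> ('a::finite, 'b::finite) smat \<Rightarrow> ('a, 'b) smat"
  by unfold_locales (simp_all add: vec_eq_iff algebra_simps)

lemma trpair_sum_left: "trpair (\<Sum>i\<in>I. mscale (c i) (F i)) Y = (\<Sum>i\<in>I. c i * trpair (F i) Y)"
proof -
  have "trpair (\<Sum>i\<in>I. mscale (c i) (F i)) Y =
      (\<Sum>a\<in>UNIV. \<Sum>b\<in>UNIV. \<Sum>i\<in>I. c i * ((-1) ^ par a * F i $ a $ b * Y $ b $ a))"
    by (simp add: trpair_def sum_distrib_left sum_distrib_right mult_ac)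
  also have "\<dots> = (\<Sum>i\<in>I. \<Sum>a\<in>UNIV. \<Sum>b\<in>UNIV. c i * ((-1) ^ par a * F i $ a $ b * Y $ b $ a))"
    by (subst sum.swap, subst (2) sum.swap) (rule refl)
  finally show ?thesis by (simp add: trpair_def sum_distrib_left)
qed

lemma trpair_sum_right: "trpair X (\<Sum>i\<in>I. mscale (c i) (F i)) = (\<Sum>i\<in>I. c i * trpair X (F i))"
proof -
  have "trpair X (\<Sum>i\<in>I. mscale (c i) (F i)) =
      (\<Sum>a\<in>UNIV. \<Sum>b\<in>UNIV. \<Sum>i\<in>I. c i * ((-1) ^ par a * X $ a $ b * F i $ b $ a))"
    by (simp add: trpair_def sum_distrib_left sum_distrib_right mult_ac)
  also have "\<dots> = (\<Sum>i\<in>I. \<Sum>a\<in>UNIV. \<Sum>b\<in>UNIV. c i * ((-1) ^ par a * X $ a $ b * F i $ b $ a))"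
    by (subst sum.swap, subst (2) sum.swap) (rule refl)
  finally show ?thesis by (simp add: trpair_def sum_distrib_left)
qed

lemma glop_zero: "glop 0 = 0"
  by (simp add: glop_def)

lemma glop_mscale: "glop (mscale c X) = smul c (glop X)"
  by (simp add: glop_def lop.scale_sum_right mult_ac)

lemma glop_sum: "glop (\<Sum>i\<in>I. mscale (c i) (F i)) = (\<Sum>i\<in>I. smul (c i) (glop (F i)))"
  by (induction I rule: infinite_finite_induct) (simp_all add: glop_zero glop_add glop_mscale)

context supersym_form
begin

definition lower :: "('a, 'b) smat \<Rightarrow> 'a + 'b \<Rightarrow> 'a + 'b \<Rightarrow> complex" where
  "lower X j c = (\<Sum>i\<in>UNIV. G j i * X $ i $ c)"

definition raise :: "('a + 'b \<Rightarrow> 'a + 'b \<Rightarrow> complex) \<Rightarrow> ('a, 'b) smat" where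
  "raise Z = (\<chi> i j. \<Sum>c\<in>UNIV. H i c * Z c j)"

lemma sum_delta_mult: "(\<Sum>j\<in>UNIV. (if i = j then 1 else 0) * f j) = (f i :: complex)"
  "(\<Sum>j\<in>UNIV. (if j = i then 1 else 0) * f j) = (f i :: complex)" for f :: "'a + 'b \<Rightarrow> complex"
  by (simp_all add: if_distrib[of "\<lambda>c. c * _"] cong: if_cong)

lemma lower_raise [simp]: "lower (raise Z) = Z"
proof (intro ext)
  fix j c
  have "lower (raise Z) j c = (\<Sum>i\<in>UNIV. \<Sum>d\<in>UNIV. G j i * H i d * Z d c)"
    by (simp add: lower_def raise_def sum_distrib_left mult.assoc)
  also have "\<dots> = (\<Sum>d\<in>UNIV. (\<Sum>i\<in>UNIV. G j i * H i d) * Z d c)"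
    by (subst sum.swap) (simp add: sum_distrib_right)
  finally show "lower (raise Z) j c = Z j c" by (simp add: GH sum_delta_mult)
qed

lemma raise_lower [simp]: "raise (lower X) = X"
proof -
  have "raise (lower X) $ i $ j = X $ i $ j" for i j
  proof -
    have "raise (lower X) $ i $ j = (\<Sum>c\<in>UNIV. \<Sum>d\<in>UNIV. H i c * G c d * X $ d $ j)"
      by (simp add: lower_def raise_def sum_distrib_left mult.assoc)
    also have "\<dots> = (\<Sum>d\<in>UNIV. (\<Sum>c\<in>UNIV. H i c * G c d) * X $ d $ j)"
      by (subst sum.swap) (simp add: sum_distrib_right)
    finally show ?thesis by (simp add: HG sum_delta_mult)
  qed
  then show ?thesis by (simp add: vec_eq_iff)
qed

lemma raise_nth: "X $ i $ j = (\<Sum>c\<in>UNIV. H i c * lower X c j)"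
  using arg_cong[OF raise_lower[of X], of "\<lambda>Y. Y $ i $ j"] by (simp add: raise_def)

lemma lower_add: "lower (X + Y) j c = lower X j c + lower Y j c"
  by (simp add: lower_def distrib_left sum.distrib)

lemma lower_sum: "lower (\<Sum>i\<in>I. mscale (t i) (F i)) j c = (\<Sum>i\<in>I. t i * lower (F i) j c)"
  unfolding lower_def
  by (simp add: sum_distrib_left mult_ac) (rule sum.swap)

lemma superskewD: "superskew Z \<Longrightarrow> Z j i = - sgn2 i j * Z i j"
  unfolding superskew_def by blast

lemma superskewI: "(\<And>i j. Z j i = - sgn2 i j * Z i j) \<Longrightarrow> superskew Z"
  unfolding superskew_def by blast

lemma minus_one_par_sgn2: "sgn2 c i * H c i = (-1) ^ par i * H c i"
proof (cases "par c = par i")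
  case True
  then show ?thesis by (cases i) (simp_all add: sgn2_def)
qed (simp add: H_par)

lemma H_flip: "H c i = (-1) ^ par i * H i c" "H c i = (-1) ^ par c * H i c"
proof -
  show *: "H c i = (-1) ^ par i * H i c" for c i
    using H_sym[of i c] minus_one_par_sgn2[of c i] by (simp only: sgn2_sym[of i c] minus_one_power_assoc)
  show "H c i = (-1) ^ par c * H i c"
    by (subst *) (rule minus_one_power_assoc[symmetric])
qed

text \<open>Superskewness moves the index contracted with \<open>H\<close> to the front, where
  raising recovers X. The signs from this exchange and from flipping \<open>H\<close> combine to
  that of the contragredient action.\<close>

lemma glop_superskew:
  assumes "superskew (lower X)"
  shows "glop X = act (lower X)"
proof -
  let ?Z = "lower X"
  have coeff: "(\<Sum>c\<in>UNIV. ?Z j c * H c i) = - ((-1) ^ ((par i + par j) * par i)) * X $ i $ j" for i j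
  proof -
    have "?Z j c * H c i = - ((-1) ^ par i * sgn2 i j) * (H i c * ?Z c j)" for c
    proof -
      have "?Z j c * H c i = - (sgn2 c j * H c i) * ?Z c j"
        by (subst superskewD[OF assms, of j c]) simp
      also have "sgn2 c j * H c i = sgn2 i j * H c i"
        by (rule sgn2_H(1))
      also have "- (sgn2 i j * H c i) * ?Z c j = - ((-1) ^ par i * sgn2 i j) * (H i c * ?Z c j)"
        unfolding H_flip(1)[of c i] by simp
      finally show ?thesis .
    qed
    then have "(\<Sum>c\<in>UNIV. ?Z j c * H c i) = - ((-1) ^ par i * sgn2 i j) * (\<Sum>c\<in>UNIV. H i c * ?Z c j)"
      by (simp only: sum_distrib_left)
    also have "(-1) ^ par i * sgn2 i j = (-1) ^ ((par i + par j) * par i)"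
      by (cases i; cases j) (simp_all add: sgn2_def)
    finally show ?thesis by (simp only: raise_nth[symmetric])
  qed
  have "act ?Z = (\<Sum>j\<in>UNIV. \<Sum>c\<in>UNIV. \<Sum>i\<in>UNIV. smul (?Z j c * H c i) (Xop j * Dop i))"
    by (simp add: act_def nab_def sum_distrib_left lop.scale_sum_right)
  also have "\<dots> = (\<Sum>j\<in>UNIV. \<Sum>i\<in>UNIV. smul (\<Sum>c\<in>UNIV. ?Z j c * H c i) (Xop j * Dop i))"
    by (rule sum.cong[OF refl]) (subst sum.swap, simp only: lop.scale_sum_left)
  also have "\<dots> = glop X"
    unfolding coeff glop_def by (rule sum.swap)
  finally show ?thesis by simp
qed

text \<open>
  The matrices \<open>raise (LZ a b)\<close> span the Lie superalgebra, and \<open>raise (BZ a b)\<close> is a family dual to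
  them up to the redundancy \<open>LZ b a = - sgn2 a b * LZ a b\<close>.  Both expansions \<open>expand_LZ\<close> and
  \<open>expand_BZ\<close> hold for this overcomplete family, so that no basis has to be chosen.
\<close>

definition LZ :: "'a + 'b \<Rightarrow> 'a + 'b \<Rightarrow> 'a + 'b \<Rightarrow> 'a + 'b \<Rightarrow> complex" where
  "LZ a b j c = (if j = a then 1 else 0) * (if c = b then 1 else 0) -
     sgn2 a b * ((if j = b then 1 else 0) * (if c = a then 1 else 0))"

definition BZ :: "'a + 'b \<Rightarrow> 'a + 'b \<Rightarrow> 'a + 'b \<Rightarrow> 'a + 'b \<Rightarrow> complex" where
  "BZ a b c j = (-1) ^ par b / 2 * (G c b * G a j - sgn2 c j * (G j b * G a c))"

lemma superskew_LZ: "superskew (LZ a b)"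
  by (rule superskewI) (auto simp: LZ_def sgn2_sym right_diff_distrib)

lemma superskew_BZ: "superskew (BZ a b)"
  by (rule superskewI) (simp add: BZ_def sgn2_sym algebra_simps)

text \<open>The super analogues of the angular momentum operators, as generators.\<close>

lemma act_LZ: "act (LZ a b) = Xop a * nab b - smul (sgn2 a b) (Xop b * nab a)"
proof -
  have *: "(\<Sum>j\<in>UNIV. \<Sum>c\<in>UNIV. smul ((if j = a then 1 else 0) * (if c = b then 1 else 0)) (Xop j * nab c)) =
      Xop a * nab b" for a b
  proof -
    have "(\<Sum>c\<in>UNIV. smul ((if j = a then 1 else 0) * (if c = b then 1 else 0)) (Xop j * nab c)) =
        smul (if j = a then 1 else 0) (Xop j * nab b)" for j
      by (simp add: lop.scale_scale[symmetric] lop.scale_sum_right[symmetric] sum_smul_delta del: lop.scale_scale)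
    then show ?thesis by (simp add: sum_smul_delta)
  qed
  show ?thesis
    unfolding act_def LZ_def lop.scale_left_diff_distrib sum_subtractf *
      lop.scale_scale[symmetric] lop.scale_sum_right[symmetric]
    by (simp only: sum_smul_delta)
qed

lemma G_sgn_swap: "(-1) ^ par b * G c b = G b c"
proof (cases "par c = par b")
  case True
  then have "sgn2 b c = (-1) ^ par b" by (cases b; cases c) (auto simp: sgn2_def)
  then show ?thesis using G_sym[of b c] by simp
qed (simp add: G_par)

lemma BZ_alt: "BZ a b c j = (-1) ^ par b / 2 * (G c b * G a j - sgn2 a b * (G j b * G a c))"
proof -
  have "sgn2 c j * (G j b * G a c) = sgn2 a b * (G j b * G a c)"
    by (cases "par j = par b \<and> par a = par c") (auto simp: G_par sgn2_def)
  then show ?thesis by (simp only: BZ_def)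
qed

lemma act_BZ: "act (BZ a b) = smul (1/2) (xs b * Dop a - smul (sgn2 a b) (xs a * Dop b))"
proof -
  have BZ: "BZ a b c j = 1/2 * (G b c * G a j - sgn2 a b * (G b j * G a c))" for c j
  proof -
    have "BZ a b c j = 1/2 * (((-1) ^ par b * G c b) * G a j - sgn2 a b * (((-1) ^ par b * G j b) * G a c))"
      by (simp add: BZ_alt algebra_simps)
    then show ?thesis by (simp only: G_sgn_swap)
  qed
  have *: "(\<Sum>c\<in>UNIV. \<Sum>j\<in>UNIV. smul (G b c * G a j) (Xop c * nab j)) = xs b * Dop a" for a b
  proof -
    have "xs b * Dop a = xs b * (\<Sum>j\<in>UNIV. smul (G a j) (nab j))" by (simp only: G_nab)
    also have "\<dots> = (\<Sum>c\<in>UNIV. \<Sum>j\<in>UNIV. smul (G b c) (Xop c) * smul (G a j) (nab j))"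
      unfolding xs_def by (rule sum_product)
    finally show ?thesis by (simp add: mult.commute)
  qed
  have "smul (BZ a b c j) Y = smul (1/2) (smul (G b c * G a j) Y - smul (sgn2 a b) (smul (G a c * G b j) Y))"
    for c j and Y :: "('a, 'b) lop"
    unfolding BZ by (simp add: lop.scale_left_diff_distrib[symmetric] mult_ac)
  then have "act (BZ a b) = smul (1/2) ((\<Sum>c\<in>UNIV. \<Sum>j\<in>UNIV. smul (G b c * G a j) (Xop c * nab j)) -
      smul (sgn2 a b) (\<Sum>c\<in>UNIV. \<Sum>j\<in>UNIV. smul (G a c * G b j) (Xop c * nab j)))"
    unfolding act_def by (simp only: lop.scale_sum_right[symmetric] sum_subtractf)
  then show ?thesis by (simp only: *)
qed

text \<open>\<open>BZ a b\<close> represents the functional that reads off an entry of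
  \<open>lower X\<close>. Its two summands pick out the entries (a, b) and (b, a), equal up to sign
  by superskewness; the factor 1/2 averages them.\<close>

lemma trpair_BZ:
  assumes "superskew (lower X)"
  shows "trpair (raise (BZ a b)) X = lower X a b"
proof -
  have HG': "(\<Sum>c\<in>UNIV. (-1) ^ par i * H i c * G a c) = (if i = a then 1 else 0)" for i a
    using sum_G_H[of a i] by (auto simp: sum_distrib_left[symmetric] mult.assoc mult.commute[of "H _ _"])
  have raise_BZ: "raise (BZ a b) $ i $ j = (-1) ^ par b / 2 *
      ((if i = b then 1 else 0) * G a j - sgn2 a b * (if i = a then (-1) ^ par i else 0) * G j b)" for i j
  proof -
    have "raise (BZ a b) $ i $ j = (\<Sum>c\<in>UNIV. (-1) ^ par b / 2 *
        (H i c * G c b * G a j - sgn2 a b * ((-1) ^ par i * ((-1) ^ par i * H i c * G a c)) * G j b))"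
      unfolding raise_def BZ_alt
      by (simp add: algebra_simps minus_one_power_assoc)
    also have "\<dots> = (-1) ^ par b / 2 * ((\<Sum>c\<in>UNIV. H i c * G c b) * G a j -
        sgn2 a b * ((-1) ^ par i * (\<Sum>c\<in>UNIV. (-1) ^ par i * H i c * G a c)) * G j b)"
      unfolding sum_distrib_left[symmetric] sum_subtractf
      by (simp only: sum_distrib_left sum_distrib_right)
    finally show ?thesis by (simp only: HG HG') simp
  qed
  have "trpair (raise (BZ a b)) X = (\<Sum>i\<in>UNIV. (if i = b then 1 else 0) *
        ((-1) ^ par i * (-1) ^ par b / 2 * (\<Sum>j\<in>UNIV. G a j * X $ j $ i))) -
      (\<Sum>i\<in>UNIV. (if i = a then 1 else 0) *
        (sgn2 a b / 2 * (\<Sum>j\<in>UNIV. ((-1) ^ par b * G j b) * X $ j $ i)))"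
    unfolding trpair_def raise_BZ sum_distrib_left sum_subtractf[symmetric]
  proof (intro sum.cong refl)
    fix i j
    show "(-1) ^ par i * ((-1) ^ par b / 2 * ((if i = b then 1 else 0) * G a j -
          sgn2 a b * (if i = a then (-1) ^ par i else 0) * G j b)) * X $ j $ i =
        (if i = b then 1 else 0) * ((-1) ^ par i * (-1) ^ par b / 2 * (G a j * X $ j $ i)) -
        (if i = a then 1 else 0) * (sgn2 a b / 2 * ((-1) ^ par b * G j b * X $ j $ i))"
      by (cases "i = a"; cases "i = b") (simp_all add: algebra_simps minus_one_power_assoc)
  qed
  also have "\<dots> = 1/2 * lower X a b - sgn2 a b / 2 * lower X b a"
    by (simp only: sum_delta_mult G_sgn_swap lower_def) simp
  also have "lower X b a = - sgn2 a b * lower X a b"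
    by (rule superskewD[OF assms])
  finally show ?thesis by simp
qed

text \<open>The product X H. Since X = H \<open>lower X\<close>, both indices are raised, and
  pairing with \<open>LZ\<close> reads off its entries.\<close>

definition msharp :: "('a, 'b) smat \<Rightarrow> 'a + 'b \<Rightarrow> 'a + 'b \<Rightarrow> complex" where
  "msharp X a b = (\<Sum>j\<in>UNIV. X $ a $ j * H j b)"

lemma msharp_skew:
  assumes "superskew (lower X)"
  shows "msharp X a b = - sgn2 a b * ((-1) ^ par a * (-1) ^ par b) * msharp X b a"
proof -
  have M: "msharp X a b = (\<Sum>i\<in>UNIV. \<Sum>j\<in>UNIV. H a i * lower X i j * H j b)" for a b
    unfolding msharp_def raise_nth by (simp add: sum_distrib_right) (rule sum.swap)
  have "H a i * lower X i j * H j b = - sgn2 a b * ((-1) ^ par a * (-1) ^ par b) * (H b j * lower X j i * H i a)" for i j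
  proof -
    have "H a i * lower X i j * H j b = - (sgn2 j i * H a i * H j b) * lower X j i"
      by (subst superskewD[OF assms, of i j]) simp
    also have "sgn2 j i * H a i * H j b = sgn2 a b * H a i * H j b"
    proof (cases "par a = par i \<and> par j = par b")
      case True
      then have "sgn2 j i = sgn2 a b" by (simp add: sgn2_def mult.commute)
      then show ?thesis by (simp only:)
    next
      case False
      then have "H a i = 0 \<or> H j b = 0" using H_par by blast
      then show ?thesis by auto
    qed
    also have "\<dots> = sgn2 a b * ((-1) ^ par a * (-1) ^ par b) * H i a * H b j"
      unfolding H_flip(2)[of a i] H_flip(1)[of j b] by (simp only: mult_ac)
    finally show ?thesis by (simp add: mult_ac)
  qed
  then have "msharp X a b = (\<Sum>i\<in>UNIV. \<Sum>j\<in>UNIV. - sgn2 a b * ((-1) ^ par a * (-1) ^ par b) * (H b j * lower X j i * H i a))"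
    unfolding M by (simp only:)
  also have "\<dots> = - sgn2 a b * ((-1) ^ par a * (-1) ^ par b) * msharp X b a"
    unfolding M sum_distrib_left by (rule sum.swap)
  finally show ?thesis .
qed

lemma trpair_LZ:
  assumes "superskew (lower X)"
  shows "trpair X (raise (LZ a b)) = 2 * (-1) ^ par b * msharp X b a"
proof -
  have *: "(\<Sum>i\<in>UNIV. \<Sum>j\<in>UNIV. (-1) ^ par i * X $ i $ j * (\<Sum>c\<in>UNIV. H j c * ((if c = a then 1 else 0) * (if i = b then 1 else 0)))) =
     (-1) ^ par b * msharp X b a" for a b
  proof -
    have "(\<Sum>c\<in>UNIV. H j c * ((if c = a then 1 else 0) * (if i = b then 1 else 0))) =
        (if i = b then 1 else 0) * H j a" for i j
    proof -
      have "(\<Sum>c\<in>UNIV. H j c * ((if c = a then 1 else 0) * (if i = b then 1 else 0))) =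
          (\<Sum>c\<in>UNIV. (if c = a then 1 else 0) * ((if i = b then 1 else 0) * H j c))"
        by (simp only: mult_ac)
      then show ?thesis by (simp only: sum_delta_mult)
    qed
    then have "(\<Sum>i\<in>UNIV. \<Sum>j\<in>UNIV. (-1) ^ par i * X $ i $ j * (\<Sum>c\<in>UNIV. H j c * ((if c = a then 1 else 0) * (if i = b then 1 else 0)))) =
       (\<Sum>i\<in>UNIV. (if i = b then 1 else 0) * ((-1) ^ par i * msharp X i a))"
      by (simp add: msharp_def sum_distrib_left mult_ac)
    then show ?thesis by (simp only: sum_delta_mult)
  qed
  have "trpair X (raise (LZ a b)) =
    (\<Sum>i\<in>UNIV. \<Sum>j\<in>UNIV. (-1) ^ par i * X $ i $ j * (\<Sum>c\<in>UNIV. H j c * ((if c = a then 1 else 0) * (if i = b then 1 else 0)))) -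
    sgn2 a b * (\<Sum>i\<in>UNIV. \<Sum>j\<in>UNIV. (-1) ^ par i * X $ i $ j * (\<Sum>c\<in>UNIV. H j c * ((if c = b then 1 else 0) * (if i = a then 1 else 0))))"
    unfolding trpair_def raise_def LZ_def
    by (simp only: vec_lambda_beta sum_distrib_left right_diff_distrib sum_subtractf mult_ac)
  also have "\<dots> = (-1) ^ par b * msharp X b a - sgn2 a b * ((-1) ^ par a * msharp X a b)"
    by (simp only: *)
  also have "msharp X a b = - sgn2 a b * ((-1) ^ par a * (-1) ^ par b) * msharp X b a"
    by (rule msharp_skew[OF assms])
  finally show ?thesis by (simp add: minus_one_power_assoc mult_ac)
qed

lemma expand_LZ:
  assumes "superskew (lower X)"
  shows "X = (\<Sum>(a, b)\<in>UNIV. mscale (lower X a b / 2) (raise (LZ a b)))"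
proof -
  have E1: "lower X j c = (\<Sum>(a, b)\<in>UNIV. lower X a b / 2 * LZ a b j c)" for j c
  proof -
    have "(\<Sum>a\<in>UNIV. \<Sum>b\<in>UNIV. lower X a b / 2 * LZ a b j c) =
      (\<Sum>a\<in>UNIV. (if j = a then 1 else 0) * (\<Sum>b\<in>UNIV. (if c = b then 1 else 0) * (lower X a b / 2))) -
      (\<Sum>a\<in>UNIV. (if c = a then 1 else 0) * (\<Sum>b\<in>UNIV. (if j = b then 1 else 0) * (sgn2 a b * lower X a b / 2)))"
      unfolding LZ_def by (simp only: sum_distrib_left right_diff_distrib sum_subtractf mult_ac times_divide_eq_right)
    also have "\<dots> = lower X j c / 2 - sgn2 c j * lower X c j / 2"
      by (simp only: sum_delta_mult)
    also have "lower X j c = - sgn2 c j * lower X c j"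
      by (rule superskewD[OF assms])
    finally have "(\<Sum>a\<in>UNIV. \<Sum>b\<in>UNIV. lower X a b / 2 * LZ a b j c) = - sgn2 c j * lower X c j"
      by simp
    also have "\<dots> = lower X j c"
      by (rule superskewD[OF assms, symmetric])
    finally show ?thesis unfolding sum.cartesian_product UNIV_Times_UNIV by (rule sym)
  qed
  have E2: "lower (\<Sum>(a, b)\<in>UNIV. mscale (lower X a b / 2) (raise (LZ a b))) c j =
      (\<Sum>(a, b)\<in>UNIV. lower X a b / 2 * LZ a b c j)" for c j
    by (simp add: case_prod_unfold lower_sum)
  have "lower X = lower (\<Sum>(a, b)\<in>UNIV. mscale (lower X a b / 2) (raise (LZ a b)))"
    by (intro ext) (rule trans[OF E1 E2[symmetric]])
  from arg_cong[OF this, of raise] show ?thesis by (simp only: raise_lower)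
qed

text \<open>The coefficients are entries of \<open>msharp X\<close> by \<open>trpair_LZ\<close>.
  Multiplying by \<open>G\<close> on both sides returns \<open>lower X\<close>, and the two summands
  of \<open>BZ\<close> contribute equally.\<close>

lemma expand_BZ:
  assumes "superskew (lower X)"
  shows "X = (\<Sum>(a, b)\<in>UNIV. mscale (trpair X (raise (LZ a b)) / 2) (raise (BZ a b)))"
proof -
  have GMG: "(\<Sum>a\<in>UNIV. \<Sum>b\<in>UNIV. G c b * msharp X b a * G a j) = lower X c j" for c j
  proof -
    have "(\<Sum>a\<in>UNIV. msharp X b a * G a j) = X $ b $ j" for b
    proof -
      have "(\<Sum>a\<in>UNIV. msharp X b a * G a j) = (\<Sum>d\<in>UNIV. X $ b $ d * (\<Sum>a\<in>UNIV. H d a * G a j))"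
        by (simp add: msharp_def sum_distrib_left sum_distrib_right mult.assoc) (rule sum.swap)
      also have "\<dots> = (\<Sum>d\<in>UNIV. (if d = j then 1 else 0) * X $ b $ d)"
        by (simp only: HG) (simp only: mult.commute)
      finally show ?thesis by (simp only: sum_delta_mult)
    qed
    then have "(\<Sum>b\<in>UNIV. G c b * (\<Sum>a\<in>UNIV. msharp X b a * G a j)) = lower X c j"
      by (simp add: lower_def)
    then show ?thesis
      by (subst sum.swap) (simp add: sum_distrib_left mult.assoc)
  qed
  have E1: "lower X c j = (\<Sum>(a, b)\<in>UNIV. trpair X (raise (LZ a b)) / 2 * BZ a b c j)" for c j
  proof -
    have "trpair X (raise (LZ a b)) / 2 * BZ a b c j =
       1/2 * (G c b * msharp X b a * G a j) - sgn2 c j / 2 * (G j b * msharp X b a * G a c)" for a b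
      by (simp add: trpair_LZ[OF assms] BZ_def minus_one_power_assoc algebra_simps)
    then have "(\<Sum>a\<in>UNIV. \<Sum>b\<in>UNIV. trpair X (raise (LZ a b)) / 2 * BZ a b c j) =
       1/2 * lower X c j - sgn2 c j / 2 * lower X j c"
      by (simp only: sum_subtractf sum_distrib_left[symmetric] GMG)
    also have "lower X j c = - sgn2 c j * lower X c j"
      by (rule superskewD[OF assms])
    finally show ?thesis unfolding sum.cartesian_product UNIV_Times_UNIV by simp
  qed
  have E2: "lower (\<Sum>(a, b)\<in>UNIV. mscale (trpair X (raise (LZ a b)) / 2) (raise (BZ a b))) c j =
      (\<Sum>(a, b)\<in>UNIV. trpair X (raise (LZ a b)) / 2 * BZ a b c j)" for c j
    by (simp add: case_prod_unfold lower_sum)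
  have "lower X = lower (\<Sum>(a, b)\<in>UNIV. mscale (trpair X (raise (LZ a b)) / 2) (raise (BZ a b)))"
    by (intro ext) (rule trans[OF E1 E2[symmetric]])
  from arg_cong[OF this, of raise] show ?thesis by (simp only: raise_lower)
qed

end

section \<open>The form and its Casimir operator\<close>

definition gram :: "('a::finite, 'b::finite) sform \<Rightarrow> 'a + 'b \<Rightarrow> 'a + 'b \<Rightarrow> complex" where
  "gram \<omega> i j = (-1) ^ par i * \<omega> (axis i 1) (axis j 1)"

definition gram_inv :: "('a::finite, 'b::finite) sform \<Rightarrow> 'a + 'b \<Rightarrow> 'a + 'b \<Rightarrow> complex" where
  "gram_inv \<omega> i j = matrix_inv (\<chi> i j. gram \<omega> i j) $ i $ j"

lemma linear_functional_expand:
  assumes "Vector_Spaces.linear (*s) (*) f"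
  shows "f v = (\<Sum>i\<in>UNIV. v $ i * f (axis i (1::complex)))"
proof -
  have add: "f (x + y) = f x + f y" and scale: "f (c *s x) = c * f x" for x y c
    using assms by (auto simp: Vector_Spaces.linear_iff)
  have zero: "f 0 = 0" using scale[of 0 0] by simp
  have "f (\<Sum>i\<in>I. v $ i *s axis i 1) = (\<Sum>i\<in>I. v $ i * f (axis i 1))" for I
    by (induction I rule: infinite_finite_induct) (simp_all add: add scale zero)
  from this[of UNIV] show ?thesis by (simp add: basis_expansion)
qed

lemma par_cases: "par i \<in> {0, 1}"
  by (cases i) simp_all

lemma hom_vec_axis [simp]: "hom_vec (par i) (axis i 1)"
  by (auto simp: hom_vec_def axis_def)

context
  fixes \<omega> :: "('a::finite, 'b::{finite, linorder}) sform"
  assumes form: "nondeg_even_supersym \<omega>"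
begin

lemma form_expand: "\<omega> v w = (\<Sum>i\<in>UNIV. \<Sum>j\<in>UNIV. v $ i * w $ j * \<omega> (axis i 1) (axis j 1))"
proof -
  have "\<omega> v w = (\<Sum>j\<in>UNIV. w $ j * \<omega> v (axis j 1))"
    using form unfolding nondeg_even_supersym_def by (intro linear_functional_expand) blast
  also have "\<dots> = (\<Sum>j\<in>UNIV. w $ j * (\<Sum>i\<in>UNIV. v $ i * \<omega> (axis i 1) (axis j 1)))"
  proof (intro sum.cong arg_cong2[of _ _ _ _ "(*)"] refl)
    fix j
    have "Vector_Spaces.linear (*s) (*) (\<lambda>v. \<omega> v (axis j 1))"
      using form unfolding nondeg_even_supersym_def by blast
    then show "\<omega> v (axis j 1) = (\<Sum>i\<in>UNIV. v $ i * \<omega> (axis i 1) (axis j 1))"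
      by (rule linear_functional_expand)
  qed
  also have "\<dots> = (\<Sum>i\<in>UNIV. \<Sum>j\<in>UNIV. v $ i * w $ j * \<omega> (axis i 1) (axis j 1))"
    by (simp add: sum_distrib_left mult_ac) (rule sum.swap)
  finally show ?thesis .
qed

lemma form_axis_sym: "\<omega> (axis i 1) (axis j 1) = sgn2 i j * \<omega> (axis j 1) (axis i 1)"
  using form par_cases[of i] par_cases[of j] hom_vec_axis[of i] hom_vec_axis[of j]
  unfolding nondeg_even_supersym_def sgn2_def by blast

lemma form_axis_par: "par i \<noteq> par j \<Longrightarrow> \<omega> (axis i 1) (axis j 1) = 0"
  using form hom_vec_axis[of i] hom_vec_axis[of j] par_cases[of i] par_cases[of j]
  unfolding nondeg_even_supersym_def by (metis insert_iff empty_iff)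

lemma form_eq_gram: "\<omega> (axis i 1) (axis j 1) = (-1) ^ par i * gram \<omega> i j"
  by (simp add: gram_def minus_one_power_assoc)

text \<open>A kernel vector of the transposed Gram matrix, with its odd coordinates negated to undo
  the sign in \<open>gram\<close>, lies in the radical of the form.\<close>

lemma gram_matrix_invertible: "invertible (\<chi> i j. gram \<omega> i j)"
proof -
  let ?G = "\<chi> i j. gram \<omega> i j"
  have "v = 0" if v: "transpose ?G *v v = 0" for v
  proof -
    define v' where "v' = (\<chi> i. (-1) ^ par i * v $ i)"
    have zero: "(\<Sum>i\<in>UNIV. gram \<omega> i j * v $ i) = 0" for j
      using arg_cong[OF v, of "\<lambda>x. x $ j"] by (simp add: transpose_def matrix_vector_mult_def)
    have "\<omega> v' w = 0" for w
    proof -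
      have "\<omega> v' w = (\<Sum>i\<in>UNIV. \<Sum>j\<in>UNIV. w $ j * (gram \<omega> i j * v $ i))"
        by (subst form_expand) (simp add: v'_def gram_def mult_ac)
      also have "\<dots> = (\<Sum>j\<in>UNIV. w $ j * (\<Sum>i\<in>UNIV. gram \<omega> i j * v $ i))"
        by (subst sum.swap) (simp add: sum_distrib_left)
      finally show ?thesis by (simp add: zero)
    qed
    then have "v' = 0" using form unfolding nondeg_even_supersym_def by blast
    then have "v' $ i = 0" for i by simp
    then show "v = 0" by (simp add: vec_eq_iff v'_def)
  qed
  then obtain B where "B ** transpose ?G = mat 1"
    using matrix_left_invertible_ker by blast
  then have "transpose (B ** transpose ?G) = mat 1" by (simp add: transpose_mat)
  then have "?G ** transpose B = mat 1" by (simp only: matrix_transpose_mul transpose_transpose)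
  moreover from this have "transpose B ** ?G = mat 1"
    by (rule matrix_left_right_inverse[THEN iffD1])
  ultimately show ?thesis
    unfolding invertible_def by (intro exI[of _ "transpose B"] conjI)
qed

interpretation supersym_form "gram \<omega>" "gram_inv \<omega>"
proof
  fix i j l
  show par0: "gram \<omega> i j = 0" if "par i \<noteq> par j" for i j
    using that form_axis_par by (simp add: gram_def)
  show "gram \<omega> i j = sgn2 i j * gram \<omega> j i"
  proof (cases "par i = par j")
    case True
    then show ?thesis
      unfolding gram_def by (subst form_axis_sym) simp
  qed (simp add: par0)
  have inv: "(\<chi> i j. gram \<omega> i j) ** matrix_inv (\<chi> i j. gram \<omega> i j) = mat 1"
    "matrix_inv (\<chi> i j. gram \<omega> i j) ** (\<chi> i j. gram \<omega> i j) = mat 1"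
    using someI_ex[OF gram_matrix_invertible[unfolded invertible_def]]
    by (simp_all add: matrix_inv_def)
  show "(\<Sum>j\<in>UNIV. gram \<omega> i j * gram_inv \<omega> j l) = (if i = l then 1 else 0)"
    using arg_cong[OF inv(1), of "\<lambda>A. A $ i $ l"]
    by (simp add: matrix_matrix_mult_def gram_inv_def mat_def)
  show "(\<Sum>j\<in>UNIV. gram_inv \<omega> i j * gram \<omega> j l) = (if i = l then 1 else 0)"
    using arg_cong[OF inv(2), of "\<lambda>A. A $ i $ l"]
    by (simp add: matrix_matrix_mult_def gram_inv_def mat_def)
qed

lemma supersym_form_gram: "supersym_form (gram \<omega>) (gram_inv \<omega>)" ..

lemma form_lower:
  "\<omega> (X *v v) w = (\<Sum>a\<in>UNIV. \<Sum>b\<in>UNIV. v $ a * w $ b * lower X b a)"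
  "\<omega> v (X *v w) = (\<Sum>a\<in>UNIV. \<Sum>b\<in>UNIV. v $ a * w $ b * ((-1) ^ par a * lower X a b))"
proof -
  have *: "\<omega> (axis i 1) (axis b 1) = gram \<omega> b i" for i b
    using G_sgn_swap[of b i] by (cases "par i = par b") (simp_all add: form_eq_gram G_par)
  have "\<omega> (X *v v) w = (\<Sum>i\<in>UNIV. \<Sum>b\<in>UNIV. \<Sum>a\<in>UNIV. v $ a * w $ b * (gram \<omega> b i * X $ i $ a))"
    by (subst form_expand) (simp add: * matrix_vector_mult_def sum_distrib_left sum_distrib_right mult_ac)
  also have "\<dots> = (\<Sum>b\<in>UNIV. \<Sum>a\<in>UNIV. \<Sum>i\<in>UNIV. v $ a * w $ b * (gram \<omega> b i * X $ i $ a))"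
    by (subst sum.swap) (rule sum.cong[OF refl], rule sum.swap)
  also have "\<dots> = (\<Sum>a\<in>UNIV. \<Sum>b\<in>UNIV. v $ a * w $ b * lower X b a)"
    by (subst sum.swap) (simp add: lower_def sum_distrib_left)
  finally show "\<omega> (X *v v) w = (\<Sum>a\<in>UNIV. \<Sum>b\<in>UNIV. v $ a * w $ b * lower X b a)" .
  have "\<omega> v (X *v w) = (\<Sum>a\<in>UNIV. \<Sum>i\<in>UNIV. \<Sum>b\<in>UNIV. v $ a * w $ b * ((-1) ^ par a * (gram \<omega> a i * X $ i $ b)))"
    by (subst form_expand)
      (simp add: form_eq_gram matrix_vector_mult_def sum_distrib_left sum_distrib_right mult_ac)
  also have "\<dots> = (\<Sum>a\<in>UNIV. \<Sum>b\<in>UNIV. \<Sum>i\<in>UNIV. v $ a * w $ b * ((-1) ^ par a * (gram \<omega> a i * X $ i $ b)))"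
    by (rule sum.cong[OF refl], rule sum.swap)
  also have "\<dots> = (\<Sum>a\<in>UNIV. \<Sum>b\<in>UNIV. v $ a * w $ b * ((-1) ^ par a * lower X a b))"
    by (simp add: lower_def sum_distrib_left)
  finally show "\<omega> v (X *v w) = (\<Sum>a\<in>UNIV. \<Sum>b\<in>UNIV. v $ a * w $ b * ((-1) ^ par a * lower X a b))" .
qed

text \<open>A nonzero entry forces s to be |a| + |b| modulo 2, so s |a| + |a| is congruent to |a|
  |b|. The sign in the definition of \<open>osp_hom\<close> thereby becomes a Koszul sign free of
  s.\<close>

lemma hom_mat_lower:
  assumes "hom_mat s X"
  shows "(-1) ^ (s * par a) * ((-1) ^ par a * lower X a b) = sgn2 a b * lower X a b"
proof (cases "lower X a b = 0")
  case False
  then obtain i where i: "gram \<omega> a i * X $ i $ b \<noteq> 0"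
    unfolding lower_def by (meson sum.neutral)
  then have "par a = par i" "(par i + par b) mod 2 = s"
    using assms G_par[of a i] by (auto simp: hom_mat_def)
  then show ?thesis
    by (cases a; cases i; cases b) (auto simp: sgn2_def)
qed simp

lemma osp_hom_iff:
  assumes "s \<in> {0, 1}"
  shows "X \<in> osp_hom \<omega> s \<longleftrightarrow> hom_mat s X \<and> superskew (lower X)"
proof (cases "hom_mat s X")
  case hom: True
  have eq: "\<omega> (X *v v) w + (-1) ^ (s * t) * \<omega> v (X *v w) =
      (\<Sum>a\<in>UNIV. \<Sum>b\<in>UNIV. v $ a * w $ b * (lower X b a + sgn2 a b * lower X a b))"
    if "hom_vec t v" for t v w
    unfolding form_lower sum_distrib_left sum.distrib[symmetric]
  proof (intro sum.cong refl)
    fix a b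
    show "v $ a * w $ b * lower X b a + (-1) ^ (s * t) * (v $ a * w $ b * ((-1) ^ par a * lower X a b)) =
       v $ a * w $ b * (lower X b a + sgn2 a b * lower X a b)"
    proof (cases "v $ a = 0")
      case False
      then have "t = par a" using that by (auto simp: hom_vec_def)
      then show ?thesis
        unfolding hom_mat_lower[OF hom, of a b, symmetric] by (simp add: algebra_simps)
    qed simp
  qed
  show ?thesis
  proof
    assume X: "X \<in> osp_hom \<omega> s"
    have "lower X b a = - sgn2 a b * lower X a b" for a b
    proof -
      have "\<omega> (X *v axis a 1) (axis b 1) + (-1) ^ (s * par a) * \<omega> (axis a 1) (X *v axis b 1) = 0"
        using X par_cases[of a] hom_vec_axis[of a] unfolding osp_hom_def by blast
      then have "(\<Sum>a'\<in>UNIV. \<Sum>b'\<in>UNIV. axis a 1 $ a' * axis b 1 $ b' * (lower X b' a' + sgn2 a' b' * lower X a' b')) = 0"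
        by (simp only: eq[OF hom_vec_axis])
      also have "(\<Sum>a'\<in>UNIV. \<Sum>b'\<in>UNIV. axis a 1 $ a' * axis b 1 $ b' * (lower X b' a' + sgn2 a' b' * lower X a' b')) =
         (\<Sum>a'\<in>UNIV. (if a' = a then 1 else 0) * (\<Sum>b'\<in>UNIV. (if b' = b then 1 else 0) * (lower X b' a' + sgn2 a' b' * lower X a' b')))"
        by (simp only: axis_def vec_lambda_beta sum_distrib_left mult.assoc)
      also have "\<dots> = lower X b a + sgn2 a b * lower X a b"
        by (simp only: sum_delta_mult)
      finally show ?thesis by (simp add: eq_neg_iff_add_eq_0)
    qed
    then show "hom_mat s X \<and> superskew (lower X)"
      using hom by (intro conjI superskewI)
  next
    assume "hom_mat s X \<and> superskew (lower X)"
    then have "lower X b a + sgn2 a b * lower X a b = 0" for a b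
      using superskewD[of "lower X" b a] by simp
    then have "\<omega> (X *v v) w + (-1) ^ (s * t) * \<omega> v (X *v w) = 0" if "hom_vec t v" for t v w
      by (simp only: eq[OF that] mult_zero_right sum.neutral_const)
    then show "X \<in> osp_hom \<omega> s"
      unfolding osp_hom_def using hom by blast
  qed
qed (simp add: osp_hom_def)

lemma superskew_add: "superskew (lower A) \<Longrightarrow> superskew (lower B) \<Longrightarrow> superskew (lower (A + B))"
proof (rule superskewI)
  fix i j assume "superskew (lower A)" "superskew (lower B)"
  from superskewD[OF this(1), of j i] superskewD[OF this(2), of j i]
  show "lower (A + B) j i = - sgn2 i j * lower (A + B) i j"
    by (simp only: lower_add distrib_left)
qed

text \<open>Superskewness relates only the entries (i, j) and (j, i), which have the same total
  parity. Hence the even and odd parts of a superskew matrix are superskew.\<close>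

lemma osp_iff: "X \<in> osp \<omega> \<longleftrightarrow> superskew (lower X)"
proof
  assume "X \<in> osp \<omega>"
  then show "superskew (lower X)"
    by (auto simp: osp_def osp_hom_iff intro!: superskew_add)
next
  assume skew: "superskew (lower X)"
  define part where "part s = ((\<chi> i j. if (par i + par j) mod 2 = s then X $ i $ j else 0) :: ('a, 'b) smat)" for s
  have lower_part: "lower (part s) a b = (if (par a + par b) mod 2 = s then lower X a b else 0)" for s a b
  proof -
    have "gram \<omega> a i * part s $ i $ b = (if (par a + par b) mod 2 = s then gram \<omega> a i * X $ i $ b else 0)" for i
      by (cases "par a = par i") (auto simp: part_def G_par)
    then show ?thesis by (simp add: lower_def)
  qed
  have "part s \<in> osp_hom \<omega> s" if "s \<in> {0, 1}" for s
    unfolding osp_hom_iff[OF that]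
  proof
    show "hom_mat s (part s)" by (auto simp: hom_mat_def part_def)
    show "superskew (lower (part s))"
    proof (rule superskewI)
      fix i j show "lower (part s) j i = - sgn2 i j * lower (part s) i j"
        unfolding lower_part using superskewD[OF skew, of j i] by (auto simp: add.commute)
    qed
  qed
  moreover have "X = part 0 + part 1"
    by (auto simp: vec_eq_iff part_def)
  ultimately show "X \<in> osp \<omega>" unfolding osp_def by blast
qed

lemma expand_BZ_action:
  assumes "F \<in> osp \<omega>"
  shows "glop F = (\<Sum>(a, b)\<in>UNIV. smul (trpair F (raise (LZ a b)) / 2) (act (BZ a b)))"
proof -
  have "glop F = glop (\<Sum>(a, b)\<in>UNIV. mscale (trpair F (raise (LZ a b)) / 2) (raise (BZ a b)))"
    by (rule arg_cong[OF expand_BZ[OF assms[unfolded osp_iff]]])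
  then show ?thesis
    by (simp add: case_prod_unfold glop_sum glop_superskew superskew_BZ)
qed

lemma raise_in_osp: "superskew Z \<Longrightarrow> raise Z \<in> osp \<omega>"
  by (simp add: osp_iff)

text \<open>Expanding each \<open>F i\<close> in the \<open>BZ\<close> moves the coefficients onto
  the \<open>E i\<close>, where duality sums them to \<open>LZ a b\<close>. No trace of the chosen
  bases is left, which makes the description in \<open>casimir\<close> unique.\<close>

lemma dual_bases_casimir:
  assumes osp: "\<And>i. i < (r::nat) \<Longrightarrow> E i \<in> osp \<omega> \<and> F i \<in> osp \<omega>"
    and span: "\<And>X. X \<in> osp \<omega> \<Longrightarrow> \<exists>c. X = (\<chi> a b. \<Sum>i<r. c i * E i $ a $ b)"
    and dual: "\<And>i j. i < r \<Longrightarrow> j < r \<Longrightarrow> supertrace (F i ** E j) / 2 = (if i = j then 1 else 0)"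
  shows "(\<Sum>i<r. glop (E i) * glop (F i)) = casimir_lop"
proof -
  have span': "X = (\<Sum>i<r. mscale (trpair (F i) X / 2) (E i))" if X: "X \<in> osp \<omega>" for X
  proof -
    obtain c where "X = (\<chi> a b. \<Sum>i<r. c i * E i $ a $ b)" using span[OF X] by blast
    then have c: "X = (\<Sum>i<r. mscale (c i) (E i))" by (simp add: vec_eq_iff)
    have "trpair (F j) X / 2 = c j" if "j < r" for j
    proof -
      have "trpair (F j) X / 2 = (\<Sum>i<r. c i * (trpair (F j) (E i) / 2))"
        by (subst c) (simp add: trpair_sum_right sum_divide_distrib)
      also have "\<dots> = (\<Sum>i<r. c i * (if j = i then 1 else 0))"
        using dual that by (intro sum.cong) (auto simp: supertrace_mult)
      also have "\<dots> = (\<Sum>i<r. if j = i then c i else 0)"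
        by (rule sum.cong) auto
      also have "\<dots> = c j" using that by (simp add: sum.delta')
      finally show ?thesis .
    qed
    then have "(\<Sum>i<r. mscale (trpair (F i) X / 2) (E i)) = (\<Sum>i<r. mscale (c i) (E i))"
      by simp
    with c show ?thesis by (rule trans[OF _ sym])
  qed
  have "(\<Sum>i<r. glop (E i) * glop (F i)) =
      (\<Sum>i<r. \<Sum>(a, b)\<in>UNIV. smul (trpair (F i) (raise (LZ a b)) / 2) (glop (E i)) * act (BZ a b))"
    using osp by (intro sum.cong) (auto simp: expand_BZ_action sum_distrib_left case_prod_unfold)
  also have "\<dots> = (\<Sum>(a, b)\<in>UNIV. (\<Sum>i<r. smul (trpair (F i) (raise (LZ a b)) / 2) (glop (E i))) * act (BZ a b))"
    unfolding case_prod_unfold by (subst sum.swap) (simp add: sum_distrib_right)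
  also have "\<dots> = (\<Sum>(a, b)\<in>UNIV. act (LZ a b) * act (BZ a b))"
  proof -
    have "(\<Sum>i<r. smul (trpair (F i) (raise (LZ a b)) / 2) (glop (E i))) = act (LZ a b)" for a b
    proof -
      have "(\<Sum>i<r. smul (trpair (F i) (raise (LZ a b)) / 2) (glop (E i))) = glop (raise (LZ a b))"
        unfolding glop_sum[symmetric]
        by (rule arg_cong[OF span'[OF raise_in_osp[OF superskew_LZ, of a b], symmetric]])
      then show ?thesis by (simp add: glop_superskew superskew_LZ)
    qed
    then show ?thesis by (simp only:)
  qed
  also have "\<dots> = casimir_lop"
    unfolding act_LZ act_BZ casimir_lop_def UNIV_Times_UNIV[symmetric] by (rule sum.cartesian_product[symmetric])
  finally show ?thesis .
qed

text \<open>A basis is selected among the matrices \<open>raise (LZ a b)\<close>; its dual basis is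
  given by an explicit formula.\<close>

lemma dual_bases_exist:
  "\<exists>(r::nat) E F. (\<forall>i<r. E i \<in> osp \<omega> \<and> F i \<in> osp \<omega>) \<and>
     (\<forall>X\<in>osp \<omega>. \<exists>c. X = (\<chi> a b. \<Sum>i<r. c i * E i $ a $ b)) \<and>
     (\<forall>i<r. \<forall>j<r. supertrace (F i ** E j) / 2 = (if i = j then 1 else 0))"
proof -
  define V where "V = range (\<lambda>(a, b). raise (LZ a b))"
  have fin: "finite V" unfolding V_def by simp
  obtain B where B: "B \<subseteq> V" "smat.independent B" "V \<subseteq> smat.span B"
    using smat.maximal_independent_subset[of V] by blast
  have finB: "finite B" using B fin finite_subset by blast
  obtain E where E: "bij_betw E {0..<card B} B"
    using ex_bij_betw_nat_finite[OF finB] by blast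
  \<comment> \<open>\<open>BZ a b\<close> pairs with X to \<open>lower X a b\<close>, and half of
    these numbers expand X in the \<open>LZ\<close>. Under half the supertrace, this combination
    therefore pairs with X to the coordinate of X at \<open>E i\<close>.\<close>
  define F where "F i = (\<Sum>ab\<in>UNIV. mscale (smat.representation B (raise (LZ (fst ab) (snd ab))) (E i))
     (raise (BZ (fst ab) (snd ab))))" for i
  have LZ_span: "raise (LZ a b) \<in> smat.span B" for a b
    using B(3) unfolding V_def by (auto intro: range_eqI[of _ _ "(a, b)"])
  have expand: "X = (\<Sum>ab\<in>UNIV. mscale (lower X (fst ab) (snd ab) / 2) (raise (LZ (fst ab) (snd ab))))"
    if "X \<in> osp \<omega>" for X
    using expand_LZ[of X] that unfolding osp_iff case_prod_unfold by blast
  have osp_span: "X \<in> smat.span B" if "X \<in> osp \<omega>" for X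
    by (subst expand[OF that]) (intro smat.span_sum smat.span_scale LZ_span)
  have E_in: "E i \<in> B" if "i < card B" for i
    using E that by (auto simp: bij_betw_def)
  have B_osp: "X \<in> osp \<omega>" if "X \<in> B" for X
    using B(1) that by (auto simp: V_def raise_in_osp superskew_LZ)
  have F_osp: "F i \<in> osp \<omega>" for i
  proof -
    let ?rep = "\<lambda>ab. smat.representation B (raise (LZ (fst ab) (snd ab))) (E i)"
    have F: "lower (F i) c j = (\<Sum>ab\<in>UNIV. ?rep ab * BZ (fst ab) (snd ab) c j)" for c j
      by (simp add: F_def lower_sum)
    have "superskew (lower (F i))"
    proof (rule superskewI)
      fix c j
      have "lower (F i) j c = (\<Sum>ab\<in>UNIV. - sgn2 c j * (?rep ab * BZ (fst ab) (snd ab) c j))"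
        unfolding F by (rule sum.cong[OF refl], subst superskewD[OF superskew_BZ]) simp
      then show "lower (F i) j c = - sgn2 c j * lower (F i) c j"
        by (simp only: F sum_distrib_left)
    qed
    then show ?thesis by (simp add: osp_iff)
  qed
  have rep_sum: "smat.representation B (E j) (E i) =
      (\<Sum>ab\<in>UNIV. lower (E j) (fst ab) (snd ab) / 2 * smat.representation B (raise (LZ (fst ab) (snd ab))) (E i))"
    if "j < card B" for i j
  proof -
    have "smat.representation B (E j) (E i) = smat.representation B
       (\<Sum>ab\<in>UNIV. mscale (lower (E j) (fst ab) (snd ab) / 2) (raise (LZ (fst ab) (snd ab)))) (E i)"
      using expand[OF B_osp[OF E_in[OF that]]] by (rule arg_cong)
    also have "\<dots> = (\<Sum>ab\<in>UNIV. smat.representation B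
       (mscale (lower (E j) (fst ab) (snd ab) / 2) (raise (LZ (fst ab) (snd ab)))) (E i))"
      by (subst smat.representation_sum[OF B(2)]) (auto intro: smat.span_scale LZ_span)
    finally show ?thesis
      by (simp add: smat.representation_scale[OF B(2) LZ_span])
  qed
  have "\<forall>i<card B. E i \<in> osp \<omega> \<and> F i \<in> osp \<omega>"
    using E_in B_osp F_osp by blast
  moreover have "\<forall>X\<in>osp \<omega>. \<exists>c. X = (\<chi> a b. \<Sum>i<card B. c i * E i $ a $ b)"
  proof
    fix X assume X: "X \<in> osp \<omega>"
    have "X = (\<Sum>b\<in>B. mscale (smat.representation B X b) b)"
      using smat.sum_representation_eq[OF B(2) osp_span[OF X] finB] by simp
    also have "\<dots> = (\<Sum>i<card B. mscale (smat.representation B X (E i)) (E i))"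
      using sum.reindex_bij_betw[OF E, of "\<lambda>b. mscale (smat.representation B X b) b"]
      by (simp add: atLeast0LessThan)
    finally have "X = (\<chi> a b. \<Sum>i<card B. smat.representation B X (E i) * E i $ a $ b)"
      by (simp add: vec_eq_iff)
    then show "\<exists>c. X = (\<chi> a b. \<Sum>i<card B. c i * E i $ a $ b)"
      by (rule exI[of _ "\<lambda>i. smat.representation B X (E i)"])
  qed
  moreover have "\<forall>i<card B. \<forall>j<card B. supertrace (F i ** E j) / 2 = (if i = j then 1 else 0)"
  proof (intro allI impI)
    fix i j assume ij: "i < card B" "j < card B"
    have "supertrace (F i ** E j) / 2 = smat.representation B (E j) (E i)"
      unfolding supertrace_mult F_def trpair_sum_left rep_sum[OF ij(2)]
      using B_osp[OF E_in[OF ij(2)]]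
      by (simp add: osp_iff trpair_BZ sum_divide_distrib mult_ac)
    also have "\<dots> = (if i = j then 1 else 0)"
    proof -
      have "E i = E j \<longleftrightarrow> i = j" using E ij by (auto simp: bij_betw_def inj_on_def)
      then show ?thesis using smat.representation_basis[OF B(2) E_in[OF ij(2)]] by auto
    qed
    finally show "supertrace (F i ** E j) / 2 = (if i = j then 1 else 0)" .
  qed  ultimately show ?thesis by (intro exI conjI)
qed

lemma casimir_eq: "casimir \<omega> = app casimir_lop"
  unfolding casimir_def
proof (rule the_equality)
  obtain r E F where ex: "\<forall>i<(r::nat). E i \<in> osp \<omega> \<and> F i \<in> osp \<omega>"
    "\<forall>X\<in>osp \<omega>. \<exists>c. X = (\<chi> a b. \<Sum>i<r. c i * E i $ a $ b)"
    "\<forall>i<r. \<forall>j<r. supertrace (F i ** E j) / 2 = (if i = j then 1 else 0)"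
    using dual_bases_exist by (elim exE conjE) (rule that)
  have "(\<Sum>i<r. glop (E i) * glop (F i)) = casimir_lop"
  proof (rule dual_bases_casimir)
    show "E i \<in> osp \<omega> \<and> F i \<in> osp \<omega>" if "i < r" for i
      using ex(1) that by (elim allE impE)
    show "\<exists>c. X = (\<chi> a b. \<Sum>i<r. c i * E i $ a $ b)" if "X \<in> osp \<omega>" for X
      using ex(2) that by (rule bspec)
    show "supertrace (F i ** E j) / 2 = (if i = j then 1 else 0)" if "i < r" "j < r" for i j
      using ex(3) that by (elim allE impE)
  qed
  then have "app casimir_lop p = (\<Sum>i<r. gl_action (E i) (gl_action (F i) p))" for p
    by (simp only: gl_action_eq app_lop(6)[symmetric] app_sum_lop[symmetric])
  then have "app casimir_lop = (\<lambda>p. \<Sum>i<r. gl_action (E i) (gl_action (F i) p))"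
    by (rule ext)
  with ex
  show "\<exists>(r::nat) E F. (\<forall>i<r. E i \<in> osp \<omega> \<and> F i \<in> osp \<omega>) \<and>
     (\<forall>X\<in>osp \<omega>. \<exists>c. X = (\<chi> a b. \<Sum>i<r. c i * E i $ a $ b)) \<and>
     (\<forall>i<r. \<forall>j<r. supertrace (F i ** E j) / 2 = (if i = j then 1 else 0)) \<and>
     app casimir_lop = (\<lambda>p. \<Sum>i<r. gl_action (E i) (gl_action (F i) p))"
    by (intro exI conjI)
next
  fix C
  assume "\<exists>(r::nat) E F. (\<forall>i<r. E i \<in> osp \<omega> \<and> F i \<in> osp \<omega>) \<and>
     (\<forall>X\<in>osp \<omega>. \<exists>c. X = (\<chi> a b. \<Sum>i<r. c i * E i $ a $ b)) \<and>
     (\<forall>i<r. \<forall>j<r. supertrace (F i ** E j) / 2 = (if i = j then 1 else 0)) \<and>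
     C = (\<lambda>p. \<Sum>i<r. gl_action (E i) (gl_action (F i) p))"
  then obtain r E F where ex: "\<forall>i<(r::nat). E i \<in> osp \<omega> \<and> F i \<in> osp \<omega>"
    "\<forall>X\<in>osp \<omega>. \<exists>c. X = (\<chi> a b. \<Sum>i<r. c i * E i $ a $ b)"
    "\<forall>i<r. \<forall>j<r. supertrace (F i ** E j) / 2 = (if i = j then 1 else 0)"
    and C: "C = (\<lambda>p. \<Sum>i<r. gl_action (E i) (gl_action (F i) p))"
    by (elim exE conjE) (rule that)
  have "(\<Sum>i<r. glop (E i) * glop (F i)) = casimir_lop"
  proof (rule dual_bases_casimir)
    show "E i \<in> osp \<omega> \<and> F i \<in> osp \<omega>" if "i < r" for i
      using ex(1) that by (elim allE impE)
    show "\<exists>c. X = (\<chi> a b. \<Sum>i<r. c i * E i $ a $ b)" if "X \<in> osp \<omega>" for X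
      using ex(2) that by (rule bspec)
    show "supertrace (F i ** E j) / 2 = (if i = j then 1 else 0)" if "i < r" "j < r" for i j
      using ex(3) that by (elim allE impE)
  qed
  then show "C = app casimir_lop"
    unfolding C by (simp only: gl_action_eq app_lop(6)[symmetric] app_sum_lop[symmetric])
qed

end

section \<open>Polynomials in an operator\<close>

definition peval :: "complex poly \<Rightarrow> ('a, 'b) lop \<Rightarrow> ('a, 'b) lop" where
  "peval p A = fold_coeffs (\<lambda>c B. smul c 1 + A * B) p 0"

lemma peval_0 [simp]: "peval 0 A = 0"
  by (simp add: peval_def)

lemma peval_pCons: "peval (pCons c p) A = smul c 1 + A * peval p A"
  by (cases "c = 0 \<and> p = 0") (auto simp: peval_def)

lemma peval_add: "peval (p + q) A = peval p A + peval q A"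
  by (induction p q rule: poly_induct2)
    (simp_all add: peval_pCons lop.scale_left_distrib algebra_simps)

lemma peval_smult: "peval (smult c p) A = smul c (peval p A)"
  by (induction p) (simp_all add: peval_pCons lop.scale_right_distrib)

lemma peval_mult: "peval (p * q) A = peval p A * peval q A"
  by (induction p) (simp_all add: peval_pCons peval_add peval_smult algebra_simps)

lemma peval_1 [simp]: "peval 1 A = 1"
  by (simp add: one_pCons peval_pCons)

lemma peval_sum: "peval (\<Sum>i\<in>I. f i) A = (\<Sum>i\<in>I. peval (f i) A)"
  by (induction I rule: infinite_finite_induct) (simp_all add: peval_add)

lemma peval_linear: "peval [:- t, 1:] A = A - smul t 1"
  by (simp add: peval_pCons)

lemma peval_commute:
  assumes "B * A = A * B"
  shows "B * peval p A = peval p A * B"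
proof (induction p)
  case (pCons c p)
  have "B * (A * peval p A) = A * (B * peval p A)"
    using assms by (simp add: mult.assoc[symmetric])
  then show ?case using pCons by (simp add: peval_pCons distrib_left distrib_right mult.assoc)
qed simp

lemma peval_eigenvector:
  assumes "app A v = sp_scale t v"
  shows "app (peval p A) v = sp_scale (poly p t) v"
  using assms by (induction p) (simp_all add: peval_pCons app_scale spoly.scale_left_distrib mult.commute)

text \<open>The case of a single linear factor comes from the constant remainder q(t); the induction
  multiplies that identity by the one for n.\<close>

lemma linear_power_bezout:
  fixes q :: "complex poly"
  assumes "poly q t \<noteq> 0"
  obtains a b where "a * [:- t, 1:] ^ n + b * q = 1"
proof -
  have "\<exists>a b. a * [:- t, 1:] ^ n + b * q = 1"
  proof (induction n)
    case 0
    show ?case by (intro exI[of _ 1] exI[of _ 0]) simp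
  next
    case (Suc n)
    then obtain a b where ab: "a * [:- t, 1:] ^ n + b * q = 1" by blast
    have "[:- t, 1:] dvd q - [:poly q t:]"
      by (simp add: poly_eq_0_iff_dvd[symmetric])
    then obtain s where s: "q - [:poly q t:] = [:- t, 1:] * s" by (rule dvdE)
    define c where "c = [:1 / poly q t:]"
    have c: "c * [:poly q t:] = 1" using assms by (simp add: c_def one_pCons)
    define L where "L = [:- t, 1:]"
    define e where "e = [:poly q t:]"
    have q: "q = L * s + e" and c: "c * e = 1"
      using s c by (simp_all only: L_def e_def diff_eq_eq)
    have "(- c * s) * [:- t, 1:] + c * q = 1"
      using c by (simp add: L_def[symmetric] q algebra_simps)
    then have cs: "(- c * s) * L + c * q = 1" by (simp only: L_def)
    have "a * L ^ n + b * q = 1" using ab by (simp only: L_def)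
    then have "(a * L ^ n + b * q) * ((- c * s) * L + c * q) = 1"
      by (simp only: cs mult_1)
    also have "(a * L ^ n + b * q) * ((- c * s) * L + c * q) = (a * (- c * s)) * L ^ Suc n +
        (a * L ^ n * c + b * (- c * s) * L + b * q * c) * q"
      by (simp add: algebra_simps)
    finally have "\<exists>a b. a * L ^ Suc n + b * q = 1" by (intro exI)
    then show ?case unfolding L_def .
  qed
  with that show ?thesis by blast
qed

lemma peval_kernel_coprime:
  assumes "poly q t \<noteq> 0" "app (peval ([:- t, 1:] ^ n) A) v = 0" "app (peval q A) v = 0"
  shows "v = 0"
proof -
  obtain a b where "a * [:- t, 1:] ^ n + b * q = 1"
    using assms(1) by (rule linear_power_bezout)
  from arg_cong[OF this, of "\<lambda>p. app (peval p A) v"] assms(2,3)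
  show ?thesis by (simp add: peval_add peval_mult)
qed

text \<open>A primary decomposition from an annihilating polynomial. Roots may coincide, so all
  indices with the value \<open>t i\<close> are split off together: a Bezout identity writes v as a
  part killed by a power of one linear factor plus a part killed by the other factors.\<close>

lemma zero_on_generalized_eigenspaces:
  assumes "finite I"
    and W: "\<And>p v. v \<in> W \<Longrightarrow> app (peval p A) v \<in> W"
    and zero: "\<And>i n v. i \<in> I \<Longrightarrow> v \<in> W \<Longrightarrow> app (peval ([:- t i, 1:] ^ n) A) v = 0 \<Longrightarrow> app D v = 0"
    and "v \<in> W" "app (peval (\<Prod>i\<in>I. [:- t i, 1:]) A) v = 0"
  shows "app D v = 0"
  using assms(1,3-5)
proof (induction "card I" arbitrary: I v rule: less_induct)
  case (less I v)
  show ?case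
  proof (cases "I = {}")
    case True
    then show ?thesis using less.prems by simp
  next
    case False
    then obtain i where i: "i \<in> I" by blast
    define J where "J = {i' \<in> I. t i' = t i}"
    let ?p = "[:- t i, 1:] ^ card J" and ?q = "\<Prod>i\<in>I - J. [:- t i, 1:]"
    have fin: "finite I" "finite J" "J \<subseteq> I" using less.prems(1) by (auto simp: J_def)
    have "(\<Prod>i\<in>J. [:- t i, 1:]) = (\<Prod>i'\<in>J. [:- t i, 1:])"
      by (rule prod.cong) (auto simp: J_def)
    then have split: "(\<Prod>i\<in>I. [:- t i, 1:]) = ?q * ?p"
      using prod.subset_diff[OF fin(3,1), of "\<lambda>i. [:- t i, 1:]"] by simp
    have "poly ?q (t i) \<noteq> 0"
      using fin by (auto simp: poly_prod J_def)
    then obtain a b where ab: "a * ?p + b * ?q = 1" by (rule linear_power_bezout)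
    define v1 where "v1 = app (peval (b * ?q) A) v"
    define v2 where "v2 = app (peval (a * ?p) A) v"
    have v: "v = v1 + v2"
      using arg_cong[OF ab, of "\<lambda>p. app (peval p A) v"]
      by (simp add: v1_def v2_def peval_add add.commute del: app_lop(6))
    have "app (peval ?p A) v1 = app (peval (b * (?q * ?p)) A) v"
      by (simp add: v1_def app_lop(6)[symmetric] peval_mult[symmetric] mult_ac del: app_lop(6))
    also have "\<dots> = 0" using less.prems(4) by (simp add: split[symmetric] peval_mult[of b])
    finally have 1: "app D v1 = 0"
      using less.prems(2)[OF i] W less.prems(3) unfolding v1_def by blast
    have "app (peval ?q A) v2 = app (peval (a * (?q * ?p)) A) v"
      by (simp add: v2_def app_lop(6)[symmetric] peval_mult[symmetric] mult_ac del: app_lop(6))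
    also have "\<dots> = 0" using less.prems(4) by (simp add: split[symmetric] peval_mult[of a])
    finally have 2: "app (peval ?q A) v2 = 0" .
    have "app D v2 = 0"
    proof (rule less.hyps[of "I - J"])
      have "i \<in> J" using i by (simp add: J_def)
      then show "card (I - J) < card I"
        using fin i by (intro psubset_card_mono) auto
    qed (use fin 2 less.prems(2,3) W in \<open>auto simp: v2_def\<close>)
    with 1 show ?thesis by (simp add: v app_add)
  qed
qed

text \<open>The Newton form, on the nodes u 0, u 1, ..., of the polynomial that is 1 at u 0 and
  vanishes at u 1, ..., u h.\<close>

lemma Newton_interpolation_of_product:
  fixes u :: "nat \<Rightarrow> 'c::field"
  assumes "\<And>i. i \<in> {1..h} \<Longrightarrow> u 0 \<noteq> u i"
  shows "(\<Sum>a\<le>h. smult (1 / (\<Prod>i\<in>{1..a}. u 0 - u i)) (\<Prod>i<a. [:- u i, 1:])) =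
     smult (1 / (\<Prod>i\<in>{1..h}. u 0 - u i)) (\<Prod>i\<in>{1..h}. [:- u i, 1:])"
  using assms
proof (induction h)
  case (Suc h)
  let ?P = "\<Prod>i\<in>{1..h}. [:- u i, 1:]" and ?A = "\<Prod>i\<in>{1..h}. u 0 - u i"
  have nz: "u 0 - u (Suc h) \<noteq> 0" using Suc.prems[of "Suc h"] by simp
  have "(\<Prod>i<Suc h. [:- u i, 1:]) = [:- u 0, 1:] * ?P"
    by (simp add: prod.lessThan_Suc_shift prod.atLeast1_atMost_eq del: prod.lessThan_Suc)
  then have "(\<Sum>a\<le>Suc h. smult (1 / (\<Prod>i\<in>{1..a}. u 0 - u i)) (\<Prod>i<a. [:- u i, 1:])) =
      smult (1 / ?A) ?P + smult (1 / (?A * (u 0 - u (Suc h)))) ([:- u 0, 1:] * ?P)"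
    using Suc by (simp add: mult.commute del: prod.lessThan_Suc)
  also have "smult (1 / ?A) ?P = smult (1 / (?A * (u 0 - u (Suc h)))) ([:u 0 - u (Suc h):] * ?P)"
    using nz by simp
  also have "smult (1 / (?A * (u 0 - u (Suc h)))) ([:u 0 - u (Suc h):] * ?P) +
      smult (1 / (?A * (u 0 - u (Suc h)))) ([:- u 0, 1:] * ?P) =
      smult (1 / (?A * (u 0 - u (Suc h)))) (([:u 0 - u (Suc h):] + [:- u 0, 1:]) * ?P)"
    by (simp only: smult_add_right distrib_right)
  also have "[:u 0 - u (Suc h):] + [:- u 0, 1:] = [:- u (Suc h), 1:]" by simp
  finally show ?case by (simp add: mult.commute)
qed simp

section \<open>Invariant operators on superpolynomials\<close>

text \<open>Iterated on 1, it yields words in the coordinates followed by the same derivatives in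
  reverse order. This order avoids Koszul signs, and the result acts in degree c by the falling
  factorial of c.\<close>

definition sandwich :: "('a::finite, 'b::{finite, linorder}) lop \<Rightarrow> ('a, 'b) lop" where
  "sandwich A = (\<Sum>i\<in>UNIV. Xop i * A * Dop i)"

definition normal_Euler :: "nat \<Rightarrow> ('a::finite, 'b::{finite, linorder}) lop" where
  "normal_Euler b = (sandwich ^^ b) 1"

lemma normal_Euler_pd_lop: "(normal_Euler b :: ('a::finite, 'b::{finite, linorder}) lop) \<in> pd_lop b b"
proof (induction b)
  case (Suc b)
  then have "Xop i * normal_Euler b * Dop i \<in> pd_lop (Suc b) (Suc b)" for i :: "'a + 'b"
    by (intro pd_lop_Dop pd_lop_Xop)
  then show ?case by (auto simp: normal_Euler_def sandwich_def intro!: pd_lop_sum)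
qed (simp add: normal_Euler_def one_in_pd_lop)

lemma app_normal_Euler:
  assumes "app Euler p = sp_scale c p"
  shows "app (normal_Euler b) p = sp_scale (ffact c b) p"
  using assms
proof (induction b arbitrary: c p)
  case (Suc b)
  have "app (normal_Euler b) (app (Dop i) p) = sp_scale (ffact (c - 1) b) (app (Dop i) p)" for i
    by (rule Suc.IH) (rule Euler_power_eigen(2)[OF Suc.prems])
  then have "app (normal_Euler (Suc b)) p = sp_scale (ffact (c - 1) b) (app Euler p)"
    by (simp add: normal_Euler_def sandwich_def Euler_def app_sum_lop app_scale spoly.scale_sum_right)
  also have "\<dots> = sp_scale (ffact c (Suc b)) p"
    using ffact_add[of c 1 b] Suc.prems by (simp add: ffact_Suc mult.commute)
  finally show ?case .
qed (simp add: normal_Euler_def)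

text \<open>On monomials it agrees with the falling factorial as a polynomial in
  \<open>Euler\<close>.\<close>

lemma normal_Euler_commute:
  assumes "B * Euler = Euler * B"
  shows "B * normal_Euler b = normal_Euler b * B"
proof -
  have "normal_Euler b = (peval (ffact [:0, 1:] b) Euler :: ('a, 'b) lop)"
  proof (rule lop_eq_on_monomialsI)
    fix u :: "('a, 'b) smon"
    have "poly (ffact [:0, 1:] b) t = ffact t b" for t :: complex
      by (simp add: ffact_def poly_prod)
    then show "app (normal_Euler b) (Poly_Mapping.single u 1) =
        app (peval (ffact [:0, 1:] b) Euler) (Poly_Mapping.single u 1)"
      by (simp only: app_normal_Euler[OF app_Euler_single] peval_eigenvector[OF app_Euler_single])
  qed
  then show ?thesis using peval_commute[OF assms] by simp
qed

text \<open>
  \<open>tt k e j\<close> is the eigenvalue of \<open>rr * Lap\<close> on the product of \<open>rr ^ j\<close> and a harmonic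
  superpolynomial, in total degree \<open>e\<close>; see \<open>T_rr_power\<close>.
\<close>

definition tt :: "nat \<Rightarrow> complex \<Rightarrow> complex \<Rightarrow> complex" where
  "tt k e y = 4 * y * (e - 1 - of_nat k - y)"

locale capelli = supersym_form G H
  for G H :: "'a::finite + 'b::{finite, linorder} \<Rightarrow> 'a + 'b \<Rightarrow> complex" +
  fixes k :: nat
  assumes sdim_eq: "sdim = - 2 * of_nat k"
begin

definition T :: "('a, 'b) lop" where
  "T = rr * Lap"

lemma Euler_T: "Euler * T = T * Euler"
proof -
  have "Euler * (rr * Lap) = rr * (Euler * Lap) + smul 2 (rr * Lap)"
    by (simp add: mult.assoc[symmetric] Euler_rr distrib_right)
  then show ?thesis by (simp add: T_def Euler_Lap right_diff_distrib mult.assoc)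
qed

lemma eigen_operators:
  assumes "app Euler p = sp_scale e p"
  shows "app Euler (app rr p) = sp_scale (e + 2) (app rr p)"
    and "app Euler (app Lap p) = sp_scale (e - 2) (app Lap p)"
    and "app Euler (app (peval q T) p) = sp_scale e (app (peval q T) p)"
proof -
  show "app Euler (app rr p) = sp_scale (e + 2) (app rr p)"
    using arg_cong[OF Euler_rr, of "\<lambda>A. app A p"] assms by (simp add: app_scale spoly.scale_left_distrib)
  show "app Euler (app Lap p) = sp_scale (e - 2) (app Lap p)"
    using arg_cong[OF Euler_Lap, of "\<lambda>A. app A p"] assms by (simp add: app_scale spoly.scale_left_diff_distrib)
  show "app Euler (app (peval q T) p) = sp_scale e (app (peval q T) p)"
    using arg_cong[OF peval_commute[OF Euler_T, of q], of "\<lambda>A. app A p"] assms by (simp add: app_scale)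
qed

lemma app_casimir_lop:
  assumes "app Euler p = sp_scale e p"
  shows "app casimir_lop p = sp_scale (e * (e - 2 * of_nat k - 2)) p - app T p"
proof -
  have "app casimir_lop p = app Euler (app Euler p) + sp_scale (sdim - 2) (app Euler p) - app T p"
    by (simp add: casimir_lop_eq T_def)
  also have "\<dots> = sp_scale (e * e + (sdim - 2) * e) p - app T p"
    unfolding assms app_scale by (simp add: spoly.scale_left_distrib)
  also have "e * e + (sdim - 2) * e = e * (e - 2 * of_nat k - 2)"
    by (simp add: sdim_eq algebra_simps)
  finally show ?thesis .
qed

text \<open>Each \<open>Lap\<close> lowers the degree by 2 and shifts T by \<open>tt k e 1\<close>
  at the current degree e; the shifts add up because
  \<open>tt k e 1 + tt k (e - 2) b = tt k e (b + 1)\<close>.\<close>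

lemma T_Lap_power:
  assumes "app Euler p = sp_scale e p"
  shows "app (T * Lap ^ b) p = app (Lap ^ b * (T - smul (tt k e (of_nat b)) 1)) p"
  using assms
proof (induction b arbitrary: e p)
  case (Suc b)
  have base: "app T (app Lap p) = app Lap (app (T - smul (tt k e 1) 1) p)"
  proof -
    have "Lap * T = T * Lap + (smul 4 Euler + smul (2 * sdim) 1) * Lap"
      by (simp add: T_def mult.assoc[symmetric] Lap_rr distrib_right add.assoc)
    from arg_cong[OF this, of "\<lambda>A. app A p"] eigen_operators(2)[OF Suc.prems]
    have "app Lap (app T p) = app T (app Lap p) + sp_scale (4 * (e - 2) + 2 * sdim) (app Lap p)"
      by (simp add: spoly.scale_left_distrib)
    moreover have "4 * (e - 2) + 2 * sdim = tt k e 1"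
      by (simp add: tt_def sdim_eq algebra_simps)
    ultimately show ?thesis by (simp add: app_diff app_scale)
  qed
  have tt: "tt k e 1 + tt k (e - 2) (of_nat b) = tt k e (of_nat (Suc b))"
    by (simp add: tt_def algebra_simps)
  have "app (T * Lap ^ Suc b) p = app (T * Lap ^ b) (app Lap p)"
    by (simp add: power_Suc2 del: power_Suc)
  also have "\<dots> = app (Lap ^ b) (app T (app Lap p) - sp_scale (tt k (e - 2) (of_nat b)) (app Lap p))"
    by (subst Suc.IH[OF eigen_operators(2)[OF Suc.prems]]) simp
  also have "\<dots> = app (Lap ^ b) (app Lap (app T p - sp_scale (tt k e 1 + tt k (e - 2) (of_nat b)) p))"
    by (simp add: base app_diff app_add app_scale spoly.scale_left_distrib diff_diff_eq)
  finally show ?case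
    by (simp only: tt power_Suc2 app_lop)
qed (simp add: tt_def)

lemma rr_Lap_power:
  assumes "app Euler p = sp_scale e p"
  shows "app (rr ^ b * Lap ^ b) p = app (peval (\<Prod>i<b. [:- tt k e (of_nat i), 1:]) T) p"
  using assms
proof (induction b arbitrary: p)
  case (Suc b)
  have "rr ^ Suc b * Lap ^ Suc b = rr ^ b * (T * Lap ^ b)"
    by (simp add: power_Suc2 T_def mult.assoc del: power_Suc) (simp add: power_commutes)
  then have "app (rr ^ Suc b * Lap ^ Suc b) p = app (rr ^ b) (app (T * Lap ^ b) p)"
    by simp
  also have "\<dots> = app (rr ^ b * Lap ^ b) (app (peval [:- tt k e (of_nat b), 1:] T) p)"
    by (subst T_Lap_power[OF Suc.prems]) (simp add: peval_linear)
  also have "\<dots> = app (peval (\<Prod>i<b. [:- tt k e (of_nat i), 1:]) T) (app (peval [:- tt k e (of_nat b), 1:] T) p)"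
    by (rule Suc.IH) (rule eigen_operators(3)[OF Suc.prems])
  finally show ?case by (simp add: peval_mult del: mult_pCons_left mult_pCons_right)
qed simp

text \<open>\<open>Lap ^ b\<close> would lower the degree below zero. With
  \<open>rr_Lap_power\<close> this provides an annihilating polynomial of T in degree d.\<close>

lemma T_annihilator:
  assumes "p \<in> hom_spolys d" "d < 2 * b"
  shows "app (Lap ^ b) p = 0" "app (peval (\<Prod>i<b. [:- tt k (of_nat d) (of_nat i), 1:]) T) p = 0"
proof -
  have E: "app Euler (app (Lap ^ n) p) = sp_scale (of_nat d - 2 * of_nat n) (app (Lap ^ n) p)" for n
  proof (induction n)
    case (Suc n)
    from eigen_operators(2)[OF this] show ?case by (simp add: algebra_simps)
  qed (use assms in \<open>simp add: hom_spolys_iff\<close>)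
  show *: "app (Lap ^ b) p = 0"
  proof (rule ccontr)
    assume "app (Lap ^ b) p \<noteq> 0"
    then obtain d' where "(of_nat d - 2 * of_nat b :: complex) = of_nat d'"
      by (rule Euler_eigenvalue_nat[OF E])
    then have "(of_nat d :: complex) = of_nat (d' + 2 * b)" by (simp add: algebra_simps)
    then have "d = d' + 2 * b" by (simp only: of_nat_eq_iff)
    with assms show False by simp
  qed
  then show "app (peval (\<Prod>i<b. [:- tt k (of_nat d) (of_nat i), 1:]) T) p = 0"
    using rr_Lap_power[of p "of_nat d" b] assms by (simp add: hom_spolys_iff)
qed

lemma T_rr_power:
  assumes "app Euler h = sp_scale a h" "app Lap h = 0"
  shows "app T (app (rr ^ j) h) = sp_scale (tt k (a + 2 * of_nat j) (of_nat j)) (app (rr ^ j) h)"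
    and "app Euler (app (rr ^ j) h) = sp_scale (a + 2 * of_nat j) (app (rr ^ j) h)"
proof -
  show E: "app Euler (app (rr ^ j) h) = sp_scale (a + 2 * of_nat j) (app (rr ^ j) h)" for j
  proof (induction j)
    case (Suc j)
    from eigen_operators(1)[OF this] show ?case by (simp add: algebra_simps)
  qed (use assms in simp)
  show "app T (app (rr ^ j) h) = sp_scale (tt k (a + 2 * of_nat j) (of_nat j)) (app (rr ^ j) h)"
  proof (induction j)
    case (Suc j)
    have "T * rr = rr * T + rr * (smul 4 Euler + smul (2 * sdim) 1)"
      by (simp add: T_def mult.assoc Lap_rr distrib_left add.assoc)
    from arg_cong[OF this, of "\<lambda>A. app A (app (rr ^ j) h)"] Suc E[of j]
    have "app T (app (rr ^ Suc j) h) =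
        sp_scale (tt k (a + 2 * of_nat j) (of_nat j) + 4 * (a + 2 * of_nat j) + 2 * sdim) (app (rr ^ Suc j) h)"
      by (simp add: app_scale app_add spoly.scale_left_distrib spoly.scale_right_distrib add.assoc)
    also have "tt k (a + 2 * of_nat j) (of_nat j) + 4 * (a + 2 * of_nat j) + 2 * sdim =
        tt k (a + 2 * of_nat (Suc j)) (of_nat (Suc j))"
      by (simp add: tt_def sdim_eq algebra_simps)
    finally show ?case .
  qed (use assms in \<open>simp add: T_def tt_def\<close>)
qed

end

section \<open>Existence of eigenvectors\<close>

text \<open>The value of the body of a superpolynomial at a point of the even part of \<open>V\<close>.\<close>

definition evaluate :: "('a::finite \<Rightarrow> complex) \<Rightarrow> ('a, 'b::finite) spoly \<Rightarrow> complex" where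
  "evaluate x p = (\<Sum>u\<in>Poly_Mapping.keys p. Poly_Mapping.lookup p u *
     (if snd u = {} then \<Prod>i\<in>UNIV. x i ^ fst u i else 0))"

lemma evaluate_superset:
  assumes "finite U" "Poly_Mapping.keys p \<subseteq> U"
  shows "evaluate x p = (\<Sum>u\<in>U. Poly_Mapping.lookup p u *
     (if snd u = {} then \<Prod>i\<in>UNIV. x i ^ fst u i else 0))"
  unfolding evaluate_def using assms
  by (intro sum.mono_neutral_left) (auto simp: in_keys_iff)

lemma evaluate_add: "evaluate x (p + q) = evaluate x p + evaluate x q"
proof -
  have "Poly_Mapping.keys (p + q) \<subseteq> Poly_Mapping.keys p \<union> Poly_Mapping.keys q"
    by (rule Poly_Mapping.keys_add)
  then show ?thesis
    by (simp add: evaluate_superset[of "Poly_Mapping.keys p \<union> Poly_Mapping.keys q"]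
        lookup_add distrib_right sum.distrib)
qed

lemma evaluate_scale: "evaluate x (sp_scale c p) = c * evaluate x p"
proof -
  have "Poly_Mapping.keys (sp_scale c p) \<subseteq> Poly_Mapping.keys p"
    by (auto simp: in_keys_iff)
  then show ?thesis
    by (simp add: evaluate_superset[of "Poly_Mapping.keys p"] sum_distrib_left mult.assoc)
qed

lemma evaluate_zero [simp]: "evaluate x 0 = 0"
  by (simp add: evaluate_def)

lemma evaluate_sum: "evaluate x (\<Sum>i\<in>I. f i) = (\<Sum>i\<in>I. evaluate x (f i))"
  by (induction I rule: infinite_finite_induct) (simp_all add: evaluate_add)

lemma evaluate_single:
  "evaluate x (Poly_Mapping.single (\<alpha>, S) c) = (if S = {} then c * (\<Prod>i\<in>UNIV. x i ^ \<alpha> i) else 0)"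
  by (cases "c = 0") (simp_all add: evaluate_def)

text \<open>Evaluation sends odd coordinates to 0 and is multiplicative in the even ones, so it can
  detect that a product of even forms is nonzero.\<close>

lemma evaluate_Xop:
  "evaluate x (app (Xop i) p) = (case i of Inl a \<Rightarrow> x a | Inr b \<Rightarrow> 0) * evaluate x p"
proof -
  have *: "evaluate x (app (Xop i) (Poly_Mapping.single u 1)) =
      (case i of Inl a \<Rightarrow> x a | Inr b \<Rightarrow> 0) * evaluate x (Poly_Mapping.single u 1)" for u
  proof (cases i)
    case (Inl a)
    obtain \<alpha> S where u: "u = (\<alpha>, S)" by fastforce
    have "(\<Prod>i\<in>UNIV. x i ^ (\<alpha>(a := \<alpha> a + 1)) i) = x a ^ (\<alpha> a + 1) * (\<Prod>i\<in>UNIV - {a}. x i ^ \<alpha> i)"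
      by (subst prod.remove[of _ a]) auto
    also have "\<dots> = x a * (\<Prod>i\<in>UNIV. x i ^ \<alpha> i)"
      by (subst (2) prod.remove[of _ a]) auto
    finally show ?thesis by (simp add: Inl u app_Xop_single evaluate_single)
  qed (cases u; simp add: app_Xop_single evaluate_single)
  have "evaluate x (app (Xop i) p) = (\<Sum>u\<in>Poly_Mapping.keys p. Poly_Mapping.lookup p u *
      evaluate x (app (Xop i) (Poly_Mapping.single u 1)))"
    using arg_cong[OF spoly_as_sum[of p], of "\<lambda>q. evaluate x (app (Xop i) q)"]
    by (simp only: app_sum app_scale evaluate_sum evaluate_scale)
  also have "\<dots> = (case i of Inl a \<Rightarrow> x a | Inr b \<Rightarrow> 0) * (\<Sum>u\<in>Poly_Mapping.keys p. Poly_Mapping.lookup p u *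
      evaluate x (Poly_Mapping.single u 1))"
    unfolding * sum_distrib_left by (simp only: mult_ac)
  also have "(\<Sum>u\<in>Poly_Mapping.keys p. Poly_Mapping.lookup p u * evaluate x (Poly_Mapping.single u 1)) = evaluate x p"
    using arg_cong[OF spoly_as_sum[of p], of "evaluate x"]
    by (simp only: evaluate_sum evaluate_scale)
  finally show ?thesis .
qed

context supersym_form
begin

definition quad :: "('a \<Rightarrow> complex) \<Rightarrow> ('a \<Rightarrow> complex) \<Rightarrow> complex" where
  "quad x y = (\<Sum>i\<in>UNIV. \<Sum>j\<in>UNIV. G (Inl i) (Inl j) * x i * y j)"

lemma quad_sym: "quad x y = quad y x"
proof -
  have "G (Inl i) (Inl j) = G (Inl j) (Inl i)" for i j
    using G_sym[of "Inl i" "Inl j"] by (simp add: sgn2_def)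
  then have "quad y x = (\<Sum>i\<in>UNIV. \<Sum>j\<in>UNIV. G (Inl j) (Inl i) * x j * y i)"
    unfolding quad_def by (simp add: mult_ac)
  then show ?thesis unfolding quad_def by (subst sum.swap) simp
qed

lemma quad_add: "quad (\<lambda>i. x i + y i) z = quad x z + quad y z"
  by (simp add: quad_def algebra_simps sum.distrib)

lemma quad_scale: "quad (\<lambda>i. c * x i) z = c * quad x z"
  by (simp add: quad_def sum_distrib_left mult_ac)

lemma quad_add_right: "quad z (\<lambda>i. x i + y i) = quad z x + quad z y"
  by (simp add: quad_sym[of z] quad_add)

lemma quad_scale_right: "quad z (\<lambda>i. c * x i) = c * quad z x"
  by (simp add: quad_sym[of z] quad_scale)

lemma sum_Plus: "(\<Sum>i\<in>UNIV. f i) = (\<Sum>a\<in>UNIV. f (Inl a)) + (\<Sum>b\<in>UNIV. f (Inr b))"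
  for f :: "'c::finite + 'd::finite \<Rightarrow> 'e::comm_monoid_add"
  by (simp add: UNIV_Plus_UNIV[symmetric] sum.Plus del: UNIV_Plus_UNIV)

text \<open>As \<open>H\<close> vanishes on mixed parities, its even block inverts the even block of
  \<open>G\<close>.\<close>

lemma quad_nondegenerate:
  assumes "y a \<noteq> 0"
  obtains x where "quad y x \<noteq> 0"
proof -
  have "\<exists>i. (\<Sum>j\<in>UNIV. G (Inl i) (Inl j) * y j) \<noteq> 0"
  proof (rule ccontr)
    assume "\<not> (\<exists>i. (\<Sum>j\<in>UNIV. G (Inl i) (Inl j) * y j) \<noteq> 0)"
    then have zero: "(\<Sum>j\<in>UNIV. G (Inl i) (Inl j) * y j) = 0" for i by blast
    have HG0: "(\<Sum>i\<in>UNIV. H (Inl a) (Inl i) * G (Inl i) (Inl j)) = (if a = j then 1 else 0)" for j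
      using HG[of "Inl a" "Inl j"] by (simp add: sum_Plus H_par)
    have "y a = (\<Sum>j\<in>UNIV. (\<Sum>i\<in>UNIV. H (Inl a) (Inl i) * G (Inl i) (Inl j)) * y j)"
      by (simp add: HG0 if_distrib[of "\<lambda>c. c * _"] cong: if_cong)
    also have "\<dots> = (\<Sum>i\<in>UNIV. H (Inl a) (Inl i) * (\<Sum>j\<in>UNIV. G (Inl i) (Inl j) * y j))"
      by (simp add: sum_distrib_left sum_distrib_right mult.assoc) (rule sum.swap)
    finally show False using assms zero by simp
  qed
  then obtain i where i: "(\<Sum>j\<in>UNIV. G (Inl i) (Inl j) * y j) \<noteq> 0" by blast
  have "quad (\<lambda>i'. if i' = i then 1 else 0) y = (\<Sum>i'\<in>UNIV. if i' = i then \<Sum>j\<in>UNIV. G (Inl i) (Inl j) * y j else 0)"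
    unfolding quad_def by (intro sum.cong refl) auto
  with i have "quad y (\<lambda>i'. if i' = i then 1 else 0) \<noteq> 0"
    by (simp add: quad_sym[of y])
  then show ?thesis by (rule that)
qed

lemma isotropic_vector:
  assumes "CARD('a) \<ge> 2"
  obtains y a where "quad y y = 0" "y a \<noteq> 0"
proof -
  obtain p q :: 'a where pq: "p \<noteq> q"
    using assms by (metis One_nat_def card_le_Suc0_iff_eq finite not_less_eq_eq numeral_2_eq_2 UNIV_I)
  define e :: "'a \<Rightarrow> 'a \<Rightarrow> complex" where "e c = (\<lambda>i. if i = c then 1 else 0)" for c
  show ?thesis
  proof (cases "quad (e p) (e p) = 0")
    case True
    then show ?thesis by (intro that[of "e p" p]) (simp_all add: e_def)
  next
    case False
    define A B C where "A = quad (e p) (e p)" and "B = quad (e p) (e q)" and "C = quad (e q) (e q)"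
    \<comment> \<open>A root of A t^2 + 2 B t + C, which is the value of the form at e_q + t
      e_p.\<close>
    define t where "t = (- B + csqrt (B ^ 2 - A * C)) / A"
    define y where "y = (\<lambda>i. e q i + t * e p i)"
    have "quad y y = C + 2 * t * B + t ^ 2 * A"
      unfolding y_def
      by (simp add: quad_add quad_add_right quad_scale quad_scale_right A_def B_def C_def
          quad_sym[of "e q" "e p"] power2_eq_square algebra_simps)
    also have "\<dots> = ((A * t + B) ^ 2 - (B ^ 2 - A * C)) / A"
      using False by (simp add: A_def[symmetric] field_simps power2_eq_square)
    also have "A * t + B = csqrt (B ^ 2 - A * C)"
      using False by (simp add: t_def A_def[symmetric])
    finally have "quad y y = 0" by simp
    moreover have "y q \<noteq> 0" using pq by (simp add: y_def e_def)
    ultimately show ?thesis by (rule that)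
  qed
qed

lemma evaluate_rr: "evaluate x (app rr p) = quad x x * evaluate x p"
proof -
  have "evaluate x (app (Xop i * xs i) p) =
      (\<Sum>j\<in>UNIV. G i j * ((case i of Inl a \<Rightarrow> x a | Inr b \<Rightarrow> 0) * (case j of Inl a \<Rightarrow> x a | Inr b \<Rightarrow> 0))) * evaluate x p" for i
    by (simp add: evaluate_Xop xs_def app_sum_lop evaluate_sum evaluate_scale sum_distrib_left sum_distrib_right mult_ac)
  then have "evaluate x (app rr p) =
      (\<Sum>i\<in>UNIV. \<Sum>j\<in>UNIV. G i j * ((case i of Inl a \<Rightarrow> x a | Inr b \<Rightarrow> 0) * (case j of Inl a \<Rightarrow> x a | Inr b \<Rightarrow> 0))) * evaluate x p"
    by (simp only: rr_def app_sum_lop evaluate_sum sum_distrib_right)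
  then show ?thesis by (simp add: sum_Plus quad_def mult.assoc)
qed

text \<open>Powers of an isotropic even linear form are harmonic.\<close>

lemma harmonic_exists:
  assumes "CARD('a) \<ge> 2"
  obtains h where "app Euler h = sp_scale (of_nat a) h" "app Lap h = 0"
    "\<And>j. app (rr ^ j) h \<noteq> 0"
proof -
  obtain y b where y: "quad y y = 0" "y b \<noteq> 0"
    using isotropic_vector[OF assms] by blast
  obtain w where w: "quad y w \<noteq> 0"
    using quad_nondegenerate[of y b, OF y(2)] by blast
  \<comment> \<open>At this point both \<open>rr\<close> and the linear form \<open>l\<close> must
    be nonzero. If w is isotropic, w + y serves: its square is 2 \<open>quad y w\<close>, and its
    pairing with y is that of w.\<close>
  obtain x where x: "quad x x \<noteq> 0" "quad y x \<noteq> 0"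
  proof (cases "quad w w = 0")
    case True
    have "quad (\<lambda>i. w i + y i) (\<lambda>i. w i + y i) = 2 * quad y w"
      by (simp add: quad_add quad_add_right quad_sym[of w y] y True)
    moreover have "quad y (\<lambda>i. w i + y i) = quad y w"
      by (simp add: quad_add_right y)
    ultimately show ?thesis using w by (intro that[of "\<lambda>i. w i + y i"]) simp_all
  qed (use w that in blast)
  define l :: "('a, 'b) lop" where "l = (\<Sum>i\<in>UNIV. smul (y i) (xs (Inl i)))"
  define D :: "('a, 'b) lop" where "D = (\<Sum>i\<in>UNIV. smul (y i) (Dop (Inl i)))"
  have Euler_l: "Euler * l = l * Euler + l"
    by (simp add: l_def sum_distrib_left sum_distrib_right Euler_xs lop.scale_right_distrib sum.distrib)
  have Lap_l: "Lap * l = l * Lap + smul 2 D"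
    by (simp add: l_def D_def sum_distrib_left sum_distrib_right Lap_xs lop.scale_right_distrib sum.distrib
        lop.scale_sum_right mult.commute)
  have Dop_xs: "Dop (Inl i) * xs (Inl j) = xs (Inl j) * Dop (Inl i) + smul (G (Inl j) (Inl i)) 1" for i j
  proof -
    have "Dop (Inl i) * xs (Inl j) = (\<Sum>c\<in>UNIV. smul (G (Inl j) c) (Xop c * Dop (Inl i)) +
        (if Inl i = c then smul (G (Inl j) c) 1 else 0))"
      unfolding xs_def sum_distrib_left
      by (rule sum.cong) (auto simp: Dop_Xop sgn2_def lop.scale_right_distrib)
    then show ?thesis by (simp add: sum.distrib xs_def sum_distrib_right)
  qed
  \<comment> \<open>The commutator is the scalar \<open>quad y y\<close>, zero by isotropy. So D
    passes through powers of l and kills them, and by \<open>Lap_l\<close> so does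
    \<open>Lap\<close>.\<close>
  have D_l: "D * l = l * D"
  proof -
    have "D * l = (\<Sum>i\<in>UNIV. \<Sum>j\<in>UNIV. smul (y i * y j) (xs (Inl j) * Dop (Inl i)) +
        smul (G (Inl j) (Inl i) * y j * y i) 1)"
      by (simp add: D_def l_def sum_product Dop_xs lop.scale_right_distrib mult_ac)
    also have "\<dots> = (\<Sum>i\<in>UNIV. \<Sum>j\<in>UNIV. smul (y i * y j) (xs (Inl j) * Dop (Inl i))) + smul (quad y y) 1"
      unfolding quad_def sum.distrib
      by (simp only: lop.scale_sum_left) (subst (4) sum.swap, rule refl)
    also have "(\<Sum>i\<in>UNIV. \<Sum>j\<in>UNIV. smul (y i * y j) (xs (Inl j) * Dop (Inl i))) = l * D"
      by (subst sum.swap) (simp add: D_def l_def sum_product mult_ac)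
    finally show ?thesis by (simp add: y)
  qed
  define one :: "('a, 'b) spoly" where "one = Poly_Mapping.single (\<lambda>_. 0, {}) 1"
  define h where "h = app (l ^ a) one"
  have Dop_one: "app (Dop i) one = 0" for i
    by (cases i) (simp_all add: one_def app_Dop_single)
  have D_h: "app D (app (l ^ n) one) = 0" for n
  proof (induction n)
    case 0
    then show ?case by (simp add: D_def app_sum_lop Dop_one)
  next
    case (Suc n)
    with arg_cong[OF D_l, of "\<lambda>A. app A (app (l ^ n) one)"] show ?case by simp
  qed
  have "app Euler (app (l ^ n) one) = sp_scale (of_nat n) (app (l ^ n) one)" for n
  proof (induction n)
    case 0
    then show ?case by (simp add: Euler_def app_sum_lop Dop_one)
  next
    case (Suc n)
    with arg_cong[OF Euler_l, of "\<lambda>A. app A (app (l ^ n) one)"] show ?case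
      by (simp add: app_scale spoly.scale_left_distrib add.commute)
  qed
  moreover have "app Lap (app (l ^ n) one) = 0" for n
  proof (induction n)
    case 0
    then show ?case by (simp add: Lap_def app_sum_lop Dop_one)
  next
    case (Suc n)
    with arg_cong[OF Lap_l, of "\<lambda>A. app A (app (l ^ n) one)"] D_h[of n] show ?case by simp
  qed
  moreover have "app (rr ^ j) h \<noteq> 0" for j
  proof
    have ev_l: "evaluate x (app l p) = quad y x * evaluate x p" for p
      by (simp add: l_def app_sum_lop evaluate_add evaluate_sum evaluate_scale xs_def evaluate_Xop sum_Plus quad_def
          sum_distrib_left sum_distrib_right mult_ac)
    have "evaluate x (app (l ^ n) one) = quad y x ^ n" for n
      by (induction n) (simp_all add: ev_l, simp add: one_def evaluate_single)
    moreover have "evaluate x (app (rr ^ j) p) = quad x x ^ j * evaluate x p" for p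
      by (induction j) (simp_all add: evaluate_rr)
    moreover assume "app (rr ^ j) h = 0"
    then have "evaluate x (app (rr ^ j) h) = 0" by simp
    ultimately show False using x by (simp add: h_def)
  qed
  ultimately show ?thesis by (intro that[of h]) (simp_all add: h_def)
qed

end

context capelli
begin

lemma T_eigenvector_exists:
  assumes "CARD('a) \<ge> 2" "2 * j \<le> d"
  obtains v where "v \<in> hom_spolys d" "v \<noteq> 0" "app T v = sp_scale (tt k (of_nat d) (of_nat j)) v"
proof -
  obtain h where h: "app Euler h = sp_scale (of_nat (d - 2 * j)) h" "app Lap h = 0"
      "\<And>j. app (rr ^ j) h \<noteq> 0"
    using harmonic_exists[OF assms(1)] by blast
  have "of_nat (d - 2 * j) + 2 * of_nat j = (of_nat d :: complex)"
    using assms(2) by (simp add: of_nat_diff)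
  then show ?thesis
    using T_rr_power[OF h(1,2), of j] h(3)[of j]
    by (intro that[of "app (rr ^ j) h"]) (simp_all add: hom_spolys_iff)
qed

section \<open>Capelli operators\<close>

text \<open>\<open>rr ^ b\<close>, \<open>normal_Euler (d - 2 * b)\<close> and \<open>Lap ^ b\<close> are normally ordered, so this has bidegree \<open>(d, d)\<close>.\<close>

definition capelli_sum :: "nat \<Rightarrow> (nat \<Rightarrow> complex) \<Rightarrow> ('a, 'b) lop" where
  "capelli_sum d c = (\<Sum>b\<le>d div 2. smul (c b / fact (d - 2 * b)) (rr ^ b * normal_Euler (d - 2 * b) * Lap ^ b))"

text \<open>The polynomial in T by which \<open>capelli_sum d c\<close> acts on degree e. The
  falling factorial is the value of the normally ordered Euler power after \<open>Lap ^ b\<close>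
  has lowered the degree to e - 2 b.\<close>

definition capelli_poly :: "nat \<Rightarrow> (nat \<Rightarrow> complex) \<Rightarrow> complex \<Rightarrow> complex poly" where
  "capelli_poly d c e = (\<Sum>b\<le>d div 2. smult (c b / fact (d - 2 * b) * ffact (e - 2 * of_nat b) (d - 2 * b))
     (\<Prod>i<b. [:- tt k e (of_nat i), 1:]))"

lemma capelli_sum_pd_lop: "capelli_sum d c \<in> pd_lop d d"
proof -
  have rr: "rr * A * Lap \<in> pd_lop (Suc (Suc d)) (Suc (Suc e))" if A: "A \<in> pd_lop d e" for A d e
  proof -
    have "xs i * A \<in> pd_lop (Suc d) e" for i
      using A by (auto simp: xs_def sum_distrib_right intro!: pd_lop_sum pd_lop_smul pd_lop_Xop)
    then have "Xop i * (xs i * A) \<in> pd_lop (Suc (Suc d)) e" for i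
      by (rule pd_lop_Xop)
    then have rA: "rr * A \<in> pd_lop (Suc (Suc d)) e"
      by (auto simp: rr_def sum_distrib_right mult.assoc intro!: pd_lop_sum)
    then have "rr * A * nab j \<in> pd_lop (Suc (Suc d)) (Suc e)" for j
      by (auto simp: nab_def sum_distrib_left intro!: pd_lop_sum pd_lop_smul pd_lop_Dop)
    then have "rr * A * nab j * Dop j \<in> pd_lop (Suc (Suc d)) (Suc (Suc e))" for j
      by (rule pd_lop_Dop)
    then show ?thesis
      unfolding Lap_def sum_distrib_left mult.assoc[symmetric] by (intro pd_lop_sum)
  qed
  have "rr ^ b * A * Lap ^ b \<in> pd_lop (n + 2 * b) (n + 2 * b)" if A: "A \<in> pd_lop n n" for A b n
  proof (induction b)
    case (Suc b)
    have "rr ^ Suc b * A * Lap ^ Suc b = rr * (rr ^ b * A * Lap ^ b) * Lap"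
      by (simp add: mult.assoc power_commutes)
    with rr[OF Suc] show ?case by (simp only:) simp
  qed (use A in simp)
  note pow = this[OF normal_Euler_pd_lop]
  have "rr ^ b * normal_Euler (d - 2 * b) * Lap ^ b \<in> pd_lop d d" if "b \<le> d div 2" for b
  proof -
    have "d - 2 * b + 2 * b = d" using that by simp
    with pow[where n = "d - 2 * b" and b = b] show ?thesis by (simp only:)
  qed
  then show ?thesis
    unfolding capelli_sum_def by (intro pd_lop_sum pd_lop_smul) simp
qed

lemma capelli_sum_commute:
  assumes "B * rr = rr * B" "B * Lap = Lap * B" "B * Euler = Euler * B"
  shows "B * capelli_sum d c = capelli_sum d c * B"
proof -
  have pow: "B * A ^ n = A ^ n * B" if "B * A = A * B" for A n
    by (induction n) (simp_all add: mult.assoc[symmetric] that, simp add: mult.assoc)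
  have "B * (rr ^ b * normal_Euler n * Lap ^ b) = rr ^ b * normal_Euler n * Lap ^ b * B" for b n
  proof -
    have "B * (rr ^ b * normal_Euler n * Lap ^ b) = rr ^ b * (B * normal_Euler n) * Lap ^ b"
      by (simp only: mult.assoc[symmetric] pow[OF assms(1)])
    also have "\<dots> = rr ^ b * normal_Euler n * (B * Lap ^ b)"
      by (simp only: normal_Euler_commute[OF assms(3)] mult.assoc)
    finally show ?thesis by (simp only: pow[OF assms(2)] mult.assoc)
  qed
  then show ?thesis by (simp add: capelli_sum_def sum_distrib_left sum_distrib_right)
qed

lemma app_capelli_sum:
  assumes "app Euler p = sp_scale e p"
  shows "app (capelli_sum d c) p = app (peval (capelli_poly d c e) T) p"
proof -
  have E: "app Euler (app (Lap ^ n) p) = sp_scale (e - 2 * of_nat n) (app (Lap ^ n) p)" for n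
  proof (induction n)
    case (Suc n)
    from eigen_operators(2)[OF this] show ?case by (simp add: algebra_simps)
  qed (use assms in simp)
  have "app (rr ^ b * normal_Euler n * Lap ^ b) p =
      sp_scale (ffact (e - 2 * of_nat b) n) (app (peval (\<Prod>i<b. [:- tt k e (of_nat i), 1:]) T) p)" for b n
    using rr_Lap_power[OF assms, of b] app_normal_Euler[OF E[of b], of n] by (simp add: app_scale)
  then show ?thesis
    unfolding capelli_sum_def capelli_poly_def peval_sum peval_smult app_sum_lop app_lop(7)
    by (simp only: spoly.scale_scale)
qed

text \<open>For x = \<mu>_1 - k - 1 and y = \<mu>_2 the degree is x + y + k + 1. In these variables
  the differences of eigenvalues factor as 4 (x - i) (y - i), symmetric in x and y; this explains
  the shift by k + 1.\<close>

lemma poly_capelli_poly: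
  "poly (capelli_poly d c (x + y + of_nat k + 1)) (tt k (x + y + of_nat k + 1) y) =
     (\<Sum>b\<le>d div 2. c b * 4 ^ b * (((x + y + of_nat k + 1 - 2 * of_nat b) gchoose (d - 2 * b)) *
       (ffact x b * ffact y b)))"
proof -
  let ?e = "x + y + of_nat k + 1"
  have "tt k ?e y - tt k ?e (of_nat i) = 4 * ((x - of_nat i) * (y - of_nat i))" for i
    by (simp add: tt_def algebra_simps)
  then have "(\<Prod>i<b. tt k ?e y - tt k ?e (of_nat i)) = 4 ^ b * (ffact x b * ffact y b)" for b
    by (simp only: prod.distrib ffact_def) simp
  then have "poly (\<Prod>i<b. [:- tt k ?e (of_nat i), 1:]) (tt k ?e y) = 4 ^ b * (ffact x b * ffact y b)" for b
    by (simp add: poly_prod)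
  then show ?thesis
    unfolding capelli_poly_def poly_sum poly_smult
    by (intro sum.cong refl) (simp add: ffact_eq_gbinomial[of "?e - _"])
qed

end

section \<open>The nilpotent part of the Jordan decomposition\<close>

text \<open>The choice may return any decomposition, so every admissible S has to act by c. For an
  eigenvector of S, the last nonzero iterate under N is an eigenvector of C with the same
  eigenvalue, which \<open>sq\<close> forces to be c; such eigenvectors span W.\<close>

lemma nilpotent_part_eq:
  assumes C: "Vector_Spaces.linear sp_scale sp_scale C"
    and sub: "spoly.subspace W"
    and stable: "\<And>p. p \<in> W \<Longrightarrow> C p \<in> W"
    and sq: "\<And>p. p \<in> W \<Longrightarrow> ((\<lambda>q. C q - sp_scale c q) ^^ 2) p = 0"
    and p: "p \<in> W"
  shows "nilpotent_part W C p = C p - sp_scale c p"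
proof -
  have C_add: "C (u + v) = C u + C v" and C_scale: "C (sp_scale t u) = sp_scale t (C u)" for u v t
    using C by (auto simp: sp_linear_iff)
  have "jordan_decomposition W C (sp_scale c) (\<lambda>q. C q - sp_scale c q)"
    unfolding jordan_decomposition_def
  proof (intro conjI ballI)
    show "Vector_Spaces.linear sp_scale sp_scale (sp_scale c)"
      by (simp add: sp_linear_iff spoly.scale_right_distrib mult.commute)
    show "Vector_Spaces.linear sp_scale sp_scale (\<lambda>q. C q - sp_scale c q)"
      by (simp add: sp_linear_iff C_add C_scale spoly.scale_right_distrib spoly.scale_right_diff_distrib mult.commute)
    show "W \<subseteq> spoly.span {p \<in> W. \<exists>e. sp_scale c p = sp_scale e p}"
      by (auto intro: spoly.span_base)
    show "\<exists>r. \<forall>p\<in>W. ((\<lambda>q. C q - sp_scale c q) ^^ r) p = 0"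
      using sq by blast
    fix q assume "q \<in> W"
    then show "sp_scale c q \<in> W" "C q - sp_scale c q \<in> W"
      using sub stable by (auto intro: spoly.subspace_scale spoly.subspace_diff)
    show "C q = sp_scale c q + (C q - sp_scale c q)" by simp
    show "sp_scale c (C q - sp_scale c q) = C (sp_scale c q) - sp_scale c (sp_scale c q)"
      by (simp only: C_scale spoly.scale_right_diff_distrib)
  qed
  then have "\<exists>N S. jordan_decomposition W C S N" by blast
  then have "\<exists>S. jordan_decomposition W C S (nilpotent_part W C)"
    unfolding nilpotent_part_def by (rule someI_ex)
  then obtain S where J: "jordan_decomposition W C S (nilpotent_part W C)" by blast
  define N where "N = nilpotent_part W C"
  note J' = J[unfolded jordan_decomposition_def, folded N_def]
  have S_lin: "Vector_Spaces.linear sp_scale sp_scale S" and N_lin: "Vector_Spaces.linear sp_scale sp_scale N"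
    and inW: "\<And>q. q \<in> W \<Longrightarrow> S q \<in> W \<and> N q \<in> W \<and> C q = S q + N q \<and> S (N q) = N (S q)"
    and span: "W \<subseteq> spoly.span {p \<in> W. \<exists>c. S p = sp_scale c p}"
    and nil: "\<exists>r. \<forall>p\<in>W. (N ^^ r) p = 0"
    using J' by blast+
  have S_eig: "S q = sp_scale c q" if q: "q \<in> W" "S q = sp_scale e q" for q e
  proof (cases "q = 0")
    case True
    then show ?thesis using S_lin by (simp add: sp_linear_iff) (metis spoly.scale_zero_left)
  next
    case False
    have pow: "(N ^^ i) q \<in> W \<and> S ((N ^^ i) q) = sp_scale e ((N ^^ i) q)" for i
    proof (induction i)
      case (Suc i)
      then show ?case using inW[of "(N ^^ i) q"] N_lin by (auto simp: sp_linear_iff)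
    qed (use q in simp)
    obtain r where r: "(N ^^ r) q = 0" using nil q by blast
    define i where "i = (LEAST i. (N ^^ i) q = 0)"
    have i0: "(N ^^ i) q = 0" unfolding i_def using r by (rule LeastI)
    then obtain i' where i': "i = Suc i'" using False by (cases i) auto
    define w where "w = (N ^^ i') q"
    have "w \<noteq> 0" unfolding w_def using not_less_Least[of i' "\<lambda>i. (N ^^ i) q = 0"] i' i_def by auto
    moreover have w: "w \<in> W" "S w = sp_scale e w" using pow[of i'] by (auto simp: w_def)
    moreover have "N w = 0" using i0 by (simp add: w_def i')
    ultimately have Cw: "C w = sp_scale e w" using inW[of w] by simp
    then have "((\<lambda>q. C q - sp_scale c q) ^^ 2) w = sp_scale ((e - c) * (e - c)) w"
      by (simp add: numeral_2_eq_2 C_scale spoly.scale_left_diff_distrib[symmetric]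
          del: spoly.scale_cancel_left spoly.scale_cancel_right)
        (simp add: C_scale Cw spoly.scale_left_diff_distrib[symmetric] left_diff_distrib mult.commute)
    with sq[OF w(1)] \<open>w \<noteq> 0\<close> have "e = c" by simp
    then show ?thesis using q by simp
  qed
  have "S q = sp_scale c q" if "q \<in> spoly.span {p \<in> W. \<exists>c. S p = sp_scale c p}" for q
    using that
  proof (rule spoly.span_induct)
    show "spoly.subspace {q. S q = sp_scale c q}"
      using S_lin by (intro spoly.subspaceI)
        (auto simp: sp_linear_iff spoly.scale_right_distrib mult.commute, metis spoly.scale_zero_left)
  qed (use S_eig in blast)
  with span p have "S p = sp_scale c p" by blast
  with inW[OF p] show ?thesis by (simp add: N_def)
qed

lemma pochhammer_of_nat_nz: "pochhammer (of_nat n + 1 :: complex) a \<noteq> 0"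
proof
  assume "pochhammer (of_nat n + 1 :: complex) a = 0"
  then obtain i where "(of_nat n + 1 :: complex) = - of_nat i"
    by (auto simp: pochhammer_eq_0_iff)
  then have "of_nat (n + 1 + i) = (0 :: complex)"
    by (simp only: of_nat_add of_nat_1 eq_neg_iff_add_eq_0)
  then show False by (simp only: of_nat_eq_0_iff)
qed

section \<open>Eigenvalues of T in a fixed degree and the index set\<close>

text \<open>(d - i, i) serves unless it is singular; then its dagger does, since \<open>tt\<close>
  is invariant under replacing i by d - 1 - k - i.\<close>

lemma index_set_representative:
  assumes "2 * i \<le> d"
  obtains \<mu> where "\<mu> \<in> index_set k" "wt \<mu> = d" "tt k (of_nat d) (of_nat (snd \<mu>)) = tt k (of_nat d) (of_nat i)"
proof (cases "k_singular k (d - i, i)")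
  case False
  then have "(d - i, i) \<in> index_set k"
    using assms by (auto simp: index_set_def k_regular_def k_quasiregular_def k_singular_def two_partitions_def)
  then show ?thesis using assms by (intro that[of "(d - i, i)"]) (auto simp: wt_def)
next
  case True
  then have *: "k + 2 \<le> d - i - i" "d - i - i \<le> 2 * k + 2" "i \<le> d - i"
    by (auto simp: k_singular_def two_partitions_def)
  define i' where "i' = d - i - k - 1"
  have i': "d = i + i' + k + 1" using * by (simp add: i'_def)
  have "(i + k + 1, i') \<in> index_set k"
    using * i' by (auto simp: index_set_def k_quasiregular_def two_partitions_def)
  moreover have "tt k (of_nat d) (of_nat i') = tt k (of_nat d) (of_nat i)"
    unfolding i' by (simp add: tt_def algebra_simps)
  ultimately show ?thesis using i' by (intro that[of "(i + k + 1, i')"]) (auto simp: wt_def)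
qed

text \<open>Equal eigenvalues mean equal second parts or second parts with sum d - k - 1. In the
  second case, if they differ, the partition with the smaller second part would be singular.\<close>

lemma index_set_inj:
  assumes "\<mu> \<in> index_set k" "\<nu> \<in> index_set k" "wt \<mu> = d" "wt \<nu> = d"
    and "tt k (of_nat d) (of_nat (snd \<mu>)) = tt k (of_nat d) (of_nat (snd \<nu>))"
  shows "\<mu> = \<nu>"
proof -
  define i i' where "i = snd \<mu>" and "i' = snd \<nu>"
  have part: "snd \<mu> \<le> fst \<mu>" "snd \<nu> \<le> fst \<nu>"
    using assms by (auto simp: index_set_def k_regular_def k_quasiregular_def two_partitions_def)
  have "of_nat i * (of_nat d - 1 - of_nat k - of_nat i) = (of_nat i' * (of_nat d - 1 - of_nat k - of_nat i') :: complex)"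
    using assms(5) by (simp add: tt_def i_def i'_def)
  then have "(of_nat i - of_nat i') * (of_nat d - (of_nat i + of_nat i' + of_nat k + 1)) = (0 :: complex)"
    by (simp add: algebra_simps)
  then have "(of_nat i :: complex) = of_nat i' \<or> (of_nat d :: complex) = of_nat (i + i' + k + 1)"
    by auto
  then have "i = i' \<or> d = i + i' + k + 1"
    by (simp only: of_nat_eq_iff)
  then have "i = i'"
    using assms(1-4) part
    unfolding index_set_def k_regular_def k_quasiregular_def two_partitions_def wt_def i_def i'_def
    by auto
  then show ?thesis using assms(3,4) by (auto simp: i_def i'_def wt_def prod_eq_iff)
qed

section \<open>Generalized eigenspaces of T and the operator in its critical degree\<close>

context capelli
begin

definition gen_space :: "nat \<Rightarrow> complex \<Rightarrow> ('a, 'b) spoly set" where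
  "gen_space d t = {p \<in> hom_spolys d. \<exists>N. app (peval ([:- t, 1:] ^ N) T) p = 0}"

lemma hom_spolys_peval: "p \<in> hom_spolys d \<Longrightarrow> app (peval q T) p \<in> hom_spolys d"
  using eigen_operators(3) by (simp add: hom_spolys_iff)

lemma gen_space_peval: "p \<in> gen_space d t \<Longrightarrow> app (peval q T) p \<in> gen_space d t"
proof -
  assume p: "p \<in> gen_space d t"
  then obtain N where N: "app (peval ([:- t, 1:] ^ N) T) p = 0" by (auto simp: gen_space_def)
  have "peval ([:- t, 1:] ^ N) T * peval q T = peval q T * peval ([:- t, 1:] ^ N) T"
    by (simp only: peval_mult[symmetric] mult.commute)
  from arg_cong[OF this, of "\<lambda>A. app A p"] N
  have "app (peval ([:- t, 1:] ^ N) T) (app (peval q T) p) = 0" by simp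
  with p hom_spolys_peval show ?thesis by (auto simp: gen_space_def)
qed

lemma gen_space_injective:
  assumes "p \<in> gen_space d t" "app (peval q T) p = 0" "poly q t \<noteq> 0"
  shows "p = 0"
proof -
  obtain N where "app (peval ([:- t, 1:] ^ N) T) p = 0" using assms(1) by (auto simp: gen_space_def)
  with assms show ?thesis by (intro peval_kernel_coprime[of q t N T p])
qed

lemma subspace_gen_space: "spoly.subspace (gen_space d t)"
proof (rule spoly.subspaceI)
  show "0 \<in> gen_space d t" by (simp add: gen_space_def hom_spolys_iff)
next
  fix p q assume p: "p \<in> gen_space d t" and q: "q \<in> gen_space d t"
  obtain M where M: "app (peval ([:- t, 1:] ^ M) T) p = 0" using p by (auto simp: gen_space_def)
  obtain N where N: "app (peval ([:- t, 1:] ^ N) T) q = 0" using q by (auto simp: gen_space_def)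
  have "app (peval ([:- t, 1:] ^ (N + M)) T) p = 0" using M by (simp add: power_add peval_mult)
  moreover have "app (peval ([:- t, 1:] ^ (M + N)) T) q = 0" using N by (simp add: power_add peval_mult)
  ultimately have "app (peval ([:- t, 1:] ^ (M + N)) T) (p + q) = 0" by (simp add: app_add add.commute)
  with p q show "p + q \<in> gen_space d t"
    by (auto simp: gen_space_def hom_spolys_iff app_add spoly.scale_right_distrib)
next
  fix c p assume "p \<in> gen_space d t"
  then show "sp_scale c p \<in> gen_space d t"
    by (auto simp: gen_space_def hom_spolys_iff app_scale mult.commute)
qed

text \<open>If e differs from q(t), then q - e is injective on the generalized eigenspace, so e is
  not an eigenvalue; v shows that q(t) is one.\<close>

lemma has_single_eigenvalue_gen_space:
  assumes D: "\<And>p. p \<in> hom_spolys d \<Longrightarrow> D p = app (peval q T) p"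
    and v: "v \<in> hom_spolys d" "v \<noteq> 0" "app T v = sp_scale t v"
  shows "has_single_eigenvalue D (gen_space d t) (poly q t)"
proof -
  have vg: "v \<in> gen_space d t"
    using v by (auto simp: gen_space_def peval_linear intro!: exI[of _ 1])
  have "e = poly q t" if p: "p \<in> gen_space d t" "p \<noteq> 0" "D p = sp_scale e p" for e p
  proof (rule ccontr)
    assume "e \<noteq> poly q t"
    then have "poly (q + [:- e:]) t \<noteq> 0" by simp
    moreover have "app (peval (q + [:- e:]) T) p = 0"
      using p D by (simp add: peval_add peval_pCons gen_space_def)
    ultimately show False using gen_space_injective p by blast
  qed
  moreover have "D v = sp_scale (poly q t) v"
    using D v peval_eigenvector by simp
  ultimately have "{e. \<exists>p\<in>gen_space d t. p \<noteq> 0 \<and> D p = sp_scale e p} = {poly q t}"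
    using vg v(2) by blast
  moreover have "D ` gen_space d t \<subseteq> gen_space d t"
  proof (rule image_subsetI)
    fix p assume p: "p \<in> gen_space d t"
    then have "p \<in> hom_spolys d" by (simp add: gen_space_def)
    with D gen_space_peval[OF p] show "D p \<in> gen_space d t" by simp
  qed
  ultimately show ?thesis unfolding has_single_eigenvalue_def by blast
qed

lemma T_annihilator_atMost:
  assumes "p \<in> hom_spolys d"
  shows "app (peval (\<Prod>i\<in>{..d div 2}. [:- tt k (of_nat d) (of_nat i), 1:]) T) p = 0"
  using T_annihilator(2)[OF assms, of "Suc (d div 2)"] by (simp add: lessThan_Suc_atMost del: prod.lessThan_Suc)

lemma zero_on_hom_spolysI:
  assumes "\<And>i p. 2 * i \<le> d \<Longrightarrow> p \<in> gen_space d (tt k (of_nat d) (of_nat i)) \<Longrightarrow> app D p = 0"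
    and "p \<in> hom_spolys d"
  shows "app D p = 0"
proof (rule zero_on_generalized_eigenspaces[where I = "{..d div 2}" and W = "hom_spolys d" and A = T])
  show "app (peval q T) v \<in> hom_spolys d" if "v \<in> hom_spolys d" for q v
    using that by (rule hom_spolys_peval)
  show "app D v = 0" if "i \<in> {..d div 2}" "v \<in> hom_spolys d"
    "app (peval ([:- tt k (of_nat d) (of_nat i), 1:] ^ n) T) v = 0" for i n v
    using that by (intro assms(1)[of i]) (auto simp: gen_space_def)
qed (use assms(2) T_annihilator_atMost in auto)

text \<open>
  \<open>j\<close> and \<open>s\<close> are the second parts of a singular element and of its image under the involution;
  they index the same eigenvalue of \<open>T\<close> in degree \<open>d\<close>.  The coefficients \<open>ccoeff\<close> are those of
  \<open>knop_sahi_row_expansion\<close>, and they are at the same time Newton interpolation coefficients.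
\<close>

context
  fixes j s d :: nat and K0 :: complex
  assumes js: "j < s" and d_eq: "d = j + s + k + 1" and sd: "2 * s \<le> d"
begin

definition ccoeff :: "nat \<Rightarrow> complex" where
  "ccoeff b = (if b < s then 0 else
     K0 / 4 ^ b * (fact (d - 2 * s) / (fact (b - s) * pochhammer (of_nat (s - j) + 1) (b - s))))"

abbreviation t where "t i \<equiv> tt k (of_nat d) (of_nat i)"

definition rest :: "complex poly" where
  "rest = (\<Prod>i\<in>{..d div 2} - {s, j}. [:- t i, 1:])"

text \<open>The derivative at k of H for (j + k + 1, s). The factor with index j has its zero at k,
  so only the product of the other factors survives; \<open>of_rat_pderiv_H_poly\<close> confirms
  this.\<close>

definition Hder :: complex where
  "Hder = - (fact (d - 2 * s) * fact s * (\<Prod>i\<in>{..<s} - {j}. of_nat j - of_nat i))"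

lemma t_j: "t j = t s"
  unfolding d_eq by (simp add: tt_def algebra_simps)

lemma prod_t_above: "(\<Prod>i\<in>{1..a}. t s - t (s + i)) = 4 ^ a * (fact a * pochhammer (of_nat (s - j) + 1) a)"
proof (induction a)
  case (Suc a)
  have "t s - t (s + Suc a) = 4 * (of_nat (Suc a) * (of_nat (s - j) + 1 + of_nat a))"
    using js unfolding d_eq by (simp add: tt_def of_nat_diff algebra_simps)
  moreover have "(\<Prod>i\<in>{1..Suc a}. t s - t (s + i)) = (\<Prod>i\<in>{1..a}. t s - t (s + i)) * (t s - t (s + Suc a))"
    by (simp add: mult.commute del: of_nat_add of_nat_Suc)
  ultimately have "(\<Prod>i\<in>{1..Suc a}. t s - t (s + i)) = 4 ^ a * (fact a * pochhammer (of_nat (s - j) + 1) a) *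
      (4 * (of_nat (Suc a) * (of_nat (s - j) + 1 + of_nat a)))"
    by (simp only: Suc)
  then show ?case by (simp only: pochhammer_Suc fact_Suc power_Suc mult_ac)
qed simp

lemma index_split: "{..d div 2} - {s, j} = ({..<s} - {j}) \<union> (\<lambda>i. s + i) ` {1..d div 2 - s}"
proof (rule set_eqI)
  fix i
  have le: "s \<le> d div 2" using sd by simp
  have img: "i \<in> (\<lambda>i. s + i) ` {1..d div 2 - s} \<longleftrightarrow> s < i \<and> i \<le> d div 2"
  proof
    assume "s < i \<and> i \<le> d div 2"
    then show "i \<in> (\<lambda>i. s + i) ` {1..d div 2 - s}"
      by (intro image_eqI[where x = "i - s"]) auto
  qed (use le in auto)
  show "i \<in> {..d div 2} - {s, j} \<longleftrightarrow> i \<in> ({..<s} - {j}) \<union> (\<lambda>i. s + i) ` {1..d div 2 - s}"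
    unfolding Un_iff img Diff_iff insert_iff empty_iff atMost_iff lessThan_iff
    using js le by (cases "i < s"; cases "i = s"; cases "i = j") simp_all
qed

lemma prod_rest: "(\<Prod>i\<in>{..d div 2} - {s, j}. f i) =
   (\<Prod>i\<in>{..<s} - {j}. f i) * (\<Prod>i\<in>{1..d div 2 - s}. f (s + i))" for f :: "nat \<Rightarrow> 'c::comm_monoid_mult"
proof -
  have "prod f (({..<s} - {j}) \<union> (\<lambda>i. s + i) ` {1..d div 2 - s}) =
      prod f ({..<s} - {j}) * prod f ((\<lambda>i. s + i) ` {1..d div 2 - s})"
    by (rule prod.union_disjoint) (use js in auto)
  moreover have "prod f ((\<lambda>i. s + i) ` {1..d div 2 - s}) = (\<Prod>i\<in>{1..d div 2 - s}. f (s + i))"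
    by (rule prod.reindex[unfolded o_def]) (simp add: inj_on_def)
  ultimately show ?thesis unfolding index_split by (simp only:)
qed

text \<open>The coefficients start at b = s, so the factors with i < s come out in front, and the
  Newton sum on t s, t (s + 1), ... collapses to the product over the nodes above s. The remaining
  linear factor is the one with i = j, equal to that of s.\<close>

lemma capelli_poly_eq:
  "capelli_poly d ccoeff (of_nat d) =
     smult (K0 / 4 ^ s * fact (d - 2 * s) / (\<Prod>i\<in>{1..d div 2 - s}. t s - t (s + i)))
       ([:- t s, 1:] * rest)"
proof -
  let ?h = "d div 2 - s" and ?L = "\<lambda>i. [:- t i, 1:]"
  have "capelli_poly d ccoeff (of_nat d) = (\<Sum>b\<le>d div 2. smult (ccoeff b) (\<Prod>i<b. ?L i))"
    unfolding capelli_poly_def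
  proof (intro sum.cong refl)
    fix b assume "b \<in> {..d div 2}"
    then have "of_nat d - 2 * of_nat b = (of_nat (d - 2 * b) :: complex)" by (simp add: of_nat_diff)
    \<comment> \<open>In degree d the normally ordered Euler power acts by a factorial, which
      cancels the denominator.\<close>
    moreover have "ffact (of_nat n) n = (fact n :: complex)" for n
      using ffact_eq_pochhammer[of "0 :: complex" n] by (simp add: pochhammer_fact[symmetric])
    ultimately show "smult (ccoeff b / fact (d - 2 * b) * ffact (of_nat d - 2 * of_nat b) (d - 2 * b)) (\<Prod>i<b. ?L i) =
        smult (ccoeff b) (\<Prod>i<b. ?L i)" by simp
  qed
  also have "\<dots> = (\<Sum>b\<in>{s..d div 2}. smult (ccoeff b) (\<Prod>i<b. ?L i))"
    by (rule sum.mono_neutral_right) (auto simp: ccoeff_def)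
  also have "\<dots> = (\<Sum>a\<le>?h. smult (ccoeff (s + a)) (\<Prod>i<s + a. ?L i))"
    using sd by (intro sum.reindex_bij_witness[of _ "\<lambda>a. s + a" "\<lambda>b. b - s"]) auto
  also have "\<dots> = (\<Sum>a\<le>?h. smult (K0 / 4 ^ s * fact (d - 2 * s)) ((\<Prod>i<s. ?L i) *
      smult (1 / (\<Prod>i\<in>{1..a}. t s - t (s + i))) (\<Prod>i<a. ?L (s + i))))"
  proof (intro sum.cong refl)
    fix a
    have "(\<Prod>i<s + a. ?L i) = (\<Prod>i<s. ?L i) * (\<Prod>i<a. ?L (s + i))"
    proof (induction a)
      case (Suc a)
      then show ?case by (simp only: add_Suc_right prod.lessThan_Suc mult.assoc)
    qed simp
    moreover have "ccoeff (s + a) = K0 / 4 ^ s * fact (d - 2 * s) * (1 / (\<Prod>i\<in>{1..a}. t s - t (s + i)))"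
      unfolding prod_t_above by (simp add: ccoeff_def power_add)
    ultimately show "smult (ccoeff (s + a)) (\<Prod>i<s + a. ?L i) =
        smult (K0 / 4 ^ s * fact (d - 2 * s)) ((\<Prod>i<s. ?L i) *
        smult (1 / (\<Prod>i\<in>{1..a}. t s - t (s + i))) (\<Prod>i<a. ?L (s + i)))"
      by (simp only: mult_smult_right smult_smult)
  qed
  also have "\<dots> = smult (K0 / 4 ^ s * fact (d - 2 * s)) ((\<Prod>i<s. ?L i) *
      (\<Sum>a\<le>?h. smult (1 / (\<Prod>i\<in>{1..a}. t s - t (s + i))) (\<Prod>i<a. ?L (s + i))))"
  proof -
    have "smult c (\<Sum>a\<in>A. f a) = (\<Sum>a\<in>A. smult c (f a))" for c and A :: "nat set" and f :: "nat \<Rightarrow> complex poly"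
      by (induction A rule: infinite_finite_induct) (simp_all add: smult_add_right)
    then show ?thesis by (simp only: sum_distrib_left)
  qed
  also have "(\<Sum>a\<le>?h. smult (1 / (\<Prod>i\<in>{1..a}. t s - t (s + i))) (\<Prod>i<a. ?L (s + i))) =
      smult (1 / (\<Prod>i\<in>{1..?h}. t s - t (s + i))) (\<Prod>i\<in>{1..?h}. ?L (s + i))"
  proof -
    have "t s \<noteq> t (s + i)" if "i \<in> {1..?h}" for i
    proof
      assume "t s = t (s + i)"
      then have "(\<Prod>i\<in>{1..i}. t s - t (s + i)) = 0" using that by (intro prod_zero) auto
      then show False unfolding prod_t_above using pochhammer_of_nat_nz by simp
    qed
    then have "(\<lambda>i. t (s + i)) 0 \<noteq> (\<lambda>i. t (s + i)) i" if "i \<in> {1..?h}" for i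
      using that by (simp only: add_0_right not_False_eq_True)
    from Newton_interpolation_of_product[where u = "\<lambda>i. t (s + i)", OF this] show ?thesis
      by (simp only: add_0_right)
  qed
  also have "(\<Prod>i<s. ?L i) = ?L j * (\<Prod>i\<in>{..<s} - {j}. ?L i)"
    using js by (subst prod.remove[of _ j]) auto
  finally show ?thesis
    by (simp only: rest_def prod_rest t_j mult_smult_right smult_smult mult.assoc times_divide_eq_right mult_1_right)
qed

text \<open>Since t s - t i = 4 (s - i) (j - i), the s - 1 factors below s other than j give the
  powers of 4, the s - i multiply to s! / (s - j), and the j - i to the product in
  \<open>Hder\<close>.\<close>

lemma rest_value:
  "poly rest (t s) = 4 ^ s / (4 * of_nat (s - j)) * (fact s * (\<Prod>i\<in>{..<s} - {j}. of_nat j - of_nat i)) *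
     (\<Prod>i\<in>{1..d div 2 - s}. t s - t (s + i))"
proof -
  have "t s - t i = 4 * ((of_nat s - of_nat i) * (of_nat j - of_nat i))" for i
    unfolding d_eq by (simp add: tt_def algebra_simps)
  then have "(\<Prod>i\<in>{..<s} - {j}. t s - t i) =
     4 ^ card ({..<s} - {j}) * ((\<Prod>i\<in>{..<s} - {j}. of_nat s - of_nat i) * (\<Prod>i\<in>{..<s} - {j}. of_nat j - of_nat i))"
    by (simp only: prod.distrib prod_constant)
  also have "card ({..<s} - {j}) = s - 1" using js by simp
  also have "(4::complex) ^ (s - 1) = 4 ^ s / 4" using js by (cases s) auto
  also have "(\<Prod>i\<in>{..<s} - {j}. of_nat s - of_nat i) = (fact s / of_nat (s - j) :: complex)"
  proof -
    have nz: "of_nat (s - j) \<noteq> (0 :: complex)" using js by (simp del: of_nat_diff)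
    have "(fact s :: complex) = (\<Prod>i<s. of_nat s - of_nat i)"
      using ffact_eq_pochhammer[of "0 :: complex" s] by (simp add: ffact_def pochhammer_fact[symmetric])
    also have "\<dots> = (of_nat s - of_nat j) * (\<Prod>i\<in>{..<s} - {j}. of_nat s - of_nat i)"
      using js by (intro prod.remove) auto
    also have "(of_nat s - of_nat j :: complex) = of_nat (s - j)" using js by (simp add: of_nat_diff)
    finally show ?thesis
      by (simp only: nonzero_mult_div_cancel_left[OF nz])
  qed
  finally have below: "(\<Prod>i\<in>{..<s} - {j}. t s - t i) = 4 ^ s / 4 *
     (fact s / of_nat (s - j) * (\<Prod>i\<in>{..<s} - {j}. of_nat j - of_nat i))" .
  have "poly rest (t s) = (\<Prod>i\<in>{..d div 2} - {s, j}. t s - t i)"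
    unfolding rest_def poly_prod by simp
  also have "\<dots> = 4 ^ s / 4 * (fact s / of_nat (s - j) * (\<Prod>i\<in>{..<s} - {j}. of_nat j - of_nat i)) *
      (\<Prod>i\<in>{1..d div 2 - s}. t s - t (s + i))"
    by (simp only: prod_rest below)
  finally show ?thesis
    by (simp only: times_divide_eq_left times_divide_eq_right divide_divide_eq_left mult_ac)
qed

lemma rest_nz: "poly rest (t s) \<noteq> 0"
  unfolding rest_value prod_t_above using js pochhammer_of_nat_nz by (simp del: of_nat_diff)

lemma full_product: "(\<Prod>i\<in>{..d div 2}. [:- t i, 1:]) = [:- t s, 1:] ^ 2 * rest"
proof -
  have "(\<Prod>i\<in>{..d div 2}. [:- t i, 1:]) = [:- t s, 1:] * (\<Prod>i\<in>{..d div 2} - {s}. [:- t i, 1:])"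
    using sd by (intro prod.remove) auto
  also have "(\<Prod>i\<in>{..d div 2} - {s}. [:- t i, 1:]) = [:- t j, 1:] * (\<Prod>i\<in>{..d div 2} - {s} - {j}. [:- t i, 1:])"
    using js sd by (intro prod.remove) auto
  also have "{..d div 2} - {s} - {j} = {..d div 2} - {s, j}" by auto
  finally show ?thesis unfolding t_j rest_def power2_eq_square by (simp only: mult.assoc)
qed

text \<open>t s is exactly a double root of the annihilating polynomial; the cofactor
  \<open>rest\<close> is injective on the generalized eigenspace.\<close>

lemma gen_space_square_zero:
  assumes p: "p \<in> gen_space d (t s)"
  shows "app (peval ([:- t s, 1:] ^ 2) T) p = 0"
proof -
  have "app (peval rest T) (app (peval ([:- t s, 1:] ^ 2) T) p) = 0"
    using T_annihilator_atMost[of p d] p unfolding full_product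
    by (simp only: mult.commute[of _ rest] peval_mult app_lop gen_space_def mem_Collect_eq)
  then show ?thesis
    using gen_space_injective[OF gen_space_peval[OF p]] rest_nz by blast
qed

lemma capelli_sum_other:
  assumes p: "p \<in> gen_space d t'" and "t' \<noteq> t s"
  shows "app (capelli_sum d ccoeff) p = 0"
proof -
  have E: "app Euler p = sp_scale (of_nat d) p" using p by (auto simp: gen_space_def hom_spolys_iff)
  have "app (peval [:- t s, 1:] T) (app (peval ([:- t s, 1:] * rest) T) p) = 0"
    using T_annihilator_atMost[of p d] p unfolding full_product power2_eq_square
    by (simp only: mult.assoc peval_mult app_lop gen_space_def mem_Collect_eq)
  moreover have "poly [:- t s, 1:] t' \<noteq> 0" using assms(2) by simp
  ultimately have "app (peval ([:- t s, 1:] * rest) T) p = 0"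
    using gen_space_injective[OF gen_space_peval[OF p]] by blast
  then show ?thesis
    unfolding app_capelli_sum[OF E] capelli_poly_eq peval_smult by simp
qed

text \<open>\<open>K0\<close> is chosen so that W takes the value -1 at t s. Then L divides W + 1,
  so L W agrees with -L modulo L^2, and L^2 vanishes on this space.\<close>

lemma capelli_sum_nilpotent:
  assumes K0: "K0 = 4 * of_nat (s - j) / Hder"
    and p: "p \<in> gen_space d (t s)"
  shows "app (capelli_sum d ccoeff) p = - (app T p - sp_scale (t s) p)"
proof -
  have E: "app Euler p = sp_scale (of_nat d) p" using p by (auto simp: gen_space_def hom_spolys_iff)
  define W where "W = smult (K0 / 4 ^ s * fact (d - 2 * s) / (\<Prod>i\<in>{1..d div 2 - s}. t s - t (s + i))) rest"
  have nz: "(\<Prod>i\<in>{1..d div 2 - s}. t s - t (s + i)) \<noteq> 0"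
    unfolding prod_t_above using pochhammer_of_nat_nz by simp
  have "poly W (t s) = - 1"
    using nz js by (simp add: W_def rest_value K0 Hder_def field_simps)
  then have "[:- t s, 1:] dvd W + 1"
    by (simp add: poly_eq_0_iff_dvd[symmetric])
  then obtain S where S: "W + 1 = [:- t s, 1:] * S" by (rule dvdE)
  define L where "L = [:- t s, 1:]"
  have "capelli_poly d ccoeff (of_nat d) = L * W"
    unfolding capelli_poly_eq W_def L_def by (simp only: mult_smult_right)
  also have "W = L * S - 1" using S unfolding L_def by (simp only: eq_diff_eq)
  also have "L * (L * S - 1) = S * L ^ 2 + smult (- 1) L"
    by (simp add: power2_eq_square algebra_simps)
  finally have "app (capelli_sum d ccoeff) p = app (peval (S * L ^ 2 + smult (- 1) L) T) p"
    by (simp only: app_capelli_sum[OF E])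
  also have "\<dots> = - app (peval L T) p"
  proof -
    have "app (peval (L ^ 2) T) p = 0" using gen_space_square_zero[OF p] unfolding L_def .
    then show ?thesis by (simp only: peval_add peval_smult peval_mult[of S] app_lop) simp
  qed
  finally show ?thesis unfolding L_def by (simp add: peval_linear)
qed

end

end

section \<open>Comparison with the Knop-Sahi polynomial and with H\<close>

text \<open>The row expansion with z = s - j and r = j + k + 1 - s, for which z + r = k + 1 as in
  the Knop-Sahi coefficients. Pulling out \<open>ffact x s * ffact y s\<close> shifts both variables
  by s.\<close>

lemma poly2_knop_sahi_expansion:
  fixes x y :: complex
  assumes js: "j < s" and s: "s \<le> j + k + 1"
  defines "r \<equiv> j + k + 1 - s"
  shows "poly2 (knop_sahi (of_nat k) (j + k + 1, s)) x y =
    (\<Sum>a\<le>r div 2. fact r / (fact a * pochhammer (of_nat (s - j) + 1) a) *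
      (((x + y + of_nat k + 1 - 2 * of_nat (s + a)) gchoose (r - 2 * a)) * (ffact x (s + a) * ffact y (s + a))))"
proof -
  have K: "of_nat (s - j) + of_nat r = (of_nat k + 1 :: complex)"
  proof -
    have "(s - j) + r = k + 1" using js s by (simp add: r_def)
    then show ?thesis by (metis of_nat_add of_nat_1)
  qed
  let ?c = "ffact x s * ffact y s"
  have "poly2 (knop_sahi (of_nat k) (j + k + 1, s)) x y =
      ?c * (\<Sum>(i, i')\<in>{(i, i'). i + i' \<le> r}.
       fact r * ffact (of_nat (s - j) + of_nat r) (r - i) * ffact (of_nat (s - j) + of_nat r) (r - i') /
         (fact i * fact i' * fact (r - i - i') * ffact (of_nat (s - j) + of_nat r) r) *
         (ffact (x - of_nat s) i * ffact (y - of_nat s) i'))"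
    unfolding poly2_knop_sahi fst_conv snd_conv r_def[symmetric] K sum_distrib_left
    by (rule sum.cong) (auto simp: ffact_add)
  also have "\<dots> = ?c * (\<Sum>a\<le>r div 2. fact r / (fact a * pochhammer (of_nat (s - j) + 1) a) *
        ((x - of_nat s + (y - of_nat s) + (of_nat (s - j) + of_nat r) - 2 * of_nat a) gchoose (r - 2 * a)) *
        (ffact (x - of_nat s) a * ffact (y - of_nat s) a))"
    by (subst knop_sahi_row_expansion) (rule pochhammer_of_nat_nz, rule refl)
  also have "\<dots> = (\<Sum>a\<le>r div 2. fact r / (fact a * pochhammer (of_nat (s - j) + 1) a) *
      (((x + y + of_nat k + 1 - 2 * of_nat (s + a)) gchoose (r - 2 * a)) * (ffact x (s + a) * ffact y (s + a))))"
    unfolding sum_distrib_left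
  proof (rule sum.cong)
    fix a
    have "x - of_nat s + (y - of_nat s) + (of_nat (s - j) + of_nat r) - 2 * of_nat a =
        x + y + of_nat k + 1 - 2 * of_nat (s + a)"
      unfolding K by simp
    then show "?c * (fact r / (fact a * pochhammer (of_nat (s - j) + 1) a) *
        ((x - of_nat s + (y - of_nat s) + (of_nat (s - j) + of_nat r) - 2 * of_nat a) gchoose (r - 2 * a)) *
        (ffact (x - of_nat s) a * ffact (y - of_nat s) a)) =
      fact r / (fact a * pochhammer (of_nat (s - j) + 1) a) *
      (((x + y + of_nat k + 1 - 2 * of_nat (s + a)) gchoose (r - 2 * a)) * (ffact x (s + a) * ffact y (s + a)))"
      unfolding ffact_add[of _ s a] by (simp only: mult_ac)
  qed simp
  finally show ?thesis .
qed

text \<open>In the product rule every summand except the one omitting i = j contains the factor j -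
  j.\<close>

lemma of_rat_pderiv_H_poly:
  assumes "j < s" "s \<le> j + k + 1"
  shows "of_rat (poly (pderiv (H_poly (j + k + 1, s))) (of_nat k)) =
    (- (fact (j + k + 1 - s) * fact s * (\<Prod>i\<in>{..<s} - {j}. of_nat j - of_nat i)) :: complex)"
proof -
  have "(of_nat (j + k + 1) - 1 - of_nat k :: rat) = of_nat j" by simp
  then have "poly (pderiv (H_poly (j + k + 1, s))) (of_nat k) =
     - (fact (j + k + 1 - s) * fact s * (\<Sum>i<s. \<Prod>i'\<in>{..<s} - {i}. of_nat j - of_nat i' :: rat))"
    by (simp only: poly_H_poly fst_conv snd_conv of_nat_fact)
  also have "(\<Sum>i<s. \<Prod>i'\<in>{..<s} - {i}. of_nat j - of_nat i' :: rat) =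
     (\<Prod>i'\<in>{..<s} - {j}. of_nat j - of_nat i') + (\<Sum>i\<in>{..<s} - {j}. \<Prod>i'\<in>{..<s} - {i}. of_nat j - of_nat i')"
    using assms by (intro sum.remove) auto
  also have "(\<Sum>i\<in>{..<s} - {j}. \<Prod>i'\<in>{..<s} - {i}. of_nat j - of_nat i' :: rat) = 0"
    using assms by (intro sum.neutral ballI prod_zero) auto
  finally show ?thesis
    using of_rat_of_nat_eq[of "fact _", where 'a = complex]
    by (simp add: of_rat_minus of_rat_mult of_rat_prod of_rat_diff)
qed

text \<open>In this parametrization the involution exchanges j and s, and the numerator of the
  constant becomes 4 (s - j).\<close>

lemma k_singular_obtains:
  assumes "k_singular k l"
  obtains j s where "l = (s + k + 1, j)" "dagger k l = (j + k + 1, s)" "j < s" "s \<le> j + k + 1"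
    "j + k + 1 - s \<le> k" "(j + k + 1, s) \<in> index_set k"
proof -
  obtain l1 l2 where l: "l = (l1, l2)" by fastforce
  define s where "s = l1 - (k + 1)"
  have *: "l2 \<le> l1" "k + 2 \<le> l1 - l2" "l1 - l2 \<le> 2 * k + 2"
    using assms by (auto simp: k_singular_def two_partitions_def l)
  have "l1 = s + k + 1" using * by (simp add: s_def)
  moreover have "(l2 + k + 1, s) \<in> index_set k"
    using * calculation by (auto simp: index_set_def k_quasiregular_def two_partitions_def)
  ultimately show ?thesis
    using * by (intro that[of s l2]) (auto simp: l dagger_def)
qed

section \<open>The Capelli operator of a given form and its eigenvalue polynomial\<close>

context
  fixes \<omega> :: "('a::finite, 'b::{finite, linorder}) sform" and k m n :: nat
  assumes form: "nondeg_even_supersym \<omega>"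
    and pos: "0 < m" and n: "n = m + k" and dims: "CARD('a) = 2 * m" "CARD('b) = 2 * n"
begin

interpretation cap: capelli "gram \<omega>" "gram_inv \<omega>" k
proof (rule capelli.intro[OF supersym_form_gram[OF form]], unfold_locales)
  interpret supersym_form "gram \<omega>" "gram_inv \<omega>" by (rule supersym_form_gram[OF form])
  show "sdim = - 2 * of_nat k"
    unfolding sdim_def sum_Plus using dims n by simp
qed

text \<open>In degree e, \<open>cas_eig\<close> equals e (e - 2 k - 2) minus the eigenvalue
  \<open>tt\<close> of T. So the Casimir operator and T have the same generalized eigenspaces, and
  their nilpotent parts differ by a sign.\<close>

lemma casimir_shift:
  assumes "q \<in> hom_spolys (wt \<mu>)"
  shows "casimir \<omega> q - sp_scale (cas_eig k \<mu>) q =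
    - (app cap.T q - sp_scale (tt k (of_nat (wt \<mu>)) (of_nat (snd \<mu>))) q)"
proof -
  have "of_nat (wt \<mu>) * (of_nat (wt \<mu>) - 2 * of_nat k - 2) - cas_eig k \<mu> = tt k (of_nat (wt \<mu>)) (of_nat (snd \<mu>))"
    by (simp add: wt_def cas_eig_def tt_def algebra_simps)
  moreover have "casimir \<omega> q - sp_scale (cas_eig k \<mu>) q =
      sp_scale (of_nat (wt \<mu>) * (of_nat (wt \<mu>) - 2 * of_nat k - 2) - cas_eig k \<mu>) q - app cap.T q"
    using assms by (simp add: casimir_eq[OF form] cap.app_casimir_lop hom_spolys_iff spoly.scale_left_diff_distrib)
  ultimately show ?thesis by simp
qed

lemma V_mod_eq: "V_mod \<omega> k \<mu> = cap.gen_space (wt \<mu>) (tt k (of_nat (wt \<mu>)) (of_nat (snd \<mu>)))"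
proof -
  let ?d = "wt \<mu>" and ?t = "tt k (of_nat (wt \<mu>)) (of_nat (snd \<mu>))"
  let ?f = "\<lambda>q. casimir \<omega> q - sp_scale (cas_eig k \<mu>) q"
  have f: "?f q = - app (peval [:- ?t, 1:] cap.T) q" if "q \<in> hom_spolys ?d" for q
    using casimir_shift[OF that] by (simp add: peval_linear)
  have pow: "(?f ^^ N) p = sp_scale ((-1) ^ N) (app (peval ([:- ?t, 1:] ^ N) cap.T) p)"
    if p: "p \<in> hom_spolys ?d" for N p
  proof (induction N)
    case (Suc N)
    let ?q = "app (peval ([:- ?t, 1:] ^ N) cap.T) p"
    have q: "sp_scale ((-1) ^ N) ?q \<in> hom_spolys ?d"
      using cap.hom_spolys_peval[OF p, of "[:- ?t, 1:] ^ N"] by (simp add: hom_spolys_iff app_scale mult.commute)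
    have "(?f ^^ Suc N) p = ?f (sp_scale ((-1) ^ N) ?q)" using Suc by simp
    also have "\<dots> = - app (peval [:- ?t, 1:] cap.T) (sp_scale ((-1) ^ N) ?q)" by (rule f[OF q])
    also have "\<dots> = sp_scale ((-1) ^ Suc N) (app (peval ([:- ?t, 1:] ^ Suc N) cap.T) p)"
      by (simp add: app_scale peval_mult del: mult_pCons_left mult_pCons_right)
    finally show ?case .
  qed simp
  have "(?f ^^ N) p = 0 \<longleftrightarrow> app (peval ([:- ?t, 1:] ^ N) cap.T) p = 0" if "p \<in> hom_spolys ?d" for N p
    unfolding pow[OF that] by simp
  then show ?thesis
    unfolding V_mod_def gen_eigenspace_def cap.gen_space_def by blast
qed

lemma capelli_sum_invariant: "app (cap.capelli_sum d c) \<in> pd_invariants \<omega>"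
proof -
  let ?K = "cap.capelli_sum d c"
  have part: "app ?K \<in> pd_part d d"
    using cap.capelli_sum_pd_lop by (auto simp: pd_part_eq)
  have zero: "(\<lambda>p. 0) \<in> pd_part d' e'" for d' e'
    unfolding pd_part_eq using pd_lop_zero by (metis app_lop(1) image_eqI ext)
  have "app ?K \<in> pd"
  proof -
    define F where "F d' e' = (if d' = d \<and> e' = d then app ?K else (\<lambda>p. 0))" for d' e'
    have "\<forall>d'\<le>d. \<forall>e'\<le>d. F d' e' \<in> pd_part d' e'"
      using part zero by (auto simp: F_def)
    moreover have "app ?K = (\<lambda>p. \<Sum>d'\<le>d. \<Sum>e'\<le>d. F d' e' p)"
    proof (rule ext)
      fix p
      have "(\<Sum>d'\<le>d. \<Sum>e'\<le>d. F d' e' p) = (\<Sum>d'\<le>d. \<Sum>e'\<le>d. if e' = d then if d' = d then app ?K p else 0 else 0)"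
        by (intro sum.cong refl) (auto simp: F_def)
      then show "app ?K p = (\<Sum>d'\<le>d. \<Sum>e'\<le>d. F d' e' p)" by simp
    qed
    ultimately show ?thesis unfolding pd_def by blast
  qed
  moreover have "supercomm s (gl_action X) (app ?K) = (\<lambda>p. 0)" if s: "s \<in> {0, 1}" and X: "X \<in> gosp_hom \<omega> s" for s X
  proof -
    have Pop: "Pop * ?K = ?K * Pop"
      by (rule cap.capelli_sum_commute[OF cap.Pop_rr cap.Pop_Lap Pop_Euler])
    have "glop X * ?K = ?K * glop X"
    proof -
      have osp: "glop A * ?K = ?K * glop A" if "A \<in> osp_hom \<omega> s'" "s' \<in> {0, 1}" for A s'
        using that osp_hom_iff[OF form]
        by (simp add: cap.glop_superskew cap.capelli_sum_commute cap.act_rr cap.act_Lap cap.act_Euler)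
      \<comment> \<open>Needed for the central element, which acts by a multiple of
        \<open>Euler\<close>. It suffices to test monomials, as the operator preserves
        degrees.\<close>
      have E: "Euler * ?K = ?K * Euler"
      proof -
        have "app (Euler * ?K) (Poly_Mapping.single u 1) = app (?K * Euler) (Poly_Mapping.single u 1)" for u
        proof -
          show ?thesis
            using cap.eigen_operators(3)[OF app_Euler_single] cap.app_capelli_sum[OF app_Euler_single]
            by (simp add: app_Euler_single app_scale del: sp_scale_single)
        qed
        then show ?thesis by (rule lop_eq_on_monomialsI)
      qed
      show ?thesis
      proof (cases "s = 0")
        case True
        then obtain A t where A: "X = A + mat (- t)" "A \<in> osp_hom \<omega> 0"
          using X by (auto simp: gosp_hom_def)
        then show ?thesis
          using osp[OF A(2)] E by (simp add: glop_add glop_mat distrib_left distrib_right)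
      next
        case False
        then show ?thesis using X s osp by (auto simp: gosp_hom_def)
      qed
    qed
    then have comm: "app (glop X) (app ?K p) = app ?K (app (glop X) p)" for p
      by (metis app_lop(6))
    have pi: "(parity_aut ^^ s) q = app (Pop ^ s) q" for q :: "('a, 'b) spoly"
      by (simp add: app_power Pop.rep_eq)
    \<comment> \<open>The operator is even, so its supercommutator with X of either parity is the
      ordinary commutator.\<close>
    have "Pop * ?K * Pop = ?K"
      by (subst Pop) (simp add: mult.assoc)
    then have "Pop ^ s * ?K * Pop ^ s = ?K"
      using s by auto
    then have "(parity_aut ^^ s) (app ?K ((parity_aut ^^ s) q)) = app ?K q" for q
      unfolding pi by (metis app_lop(6))
    then show ?thesis
      by (simp add: supercomm_def gl_action_eq comm)
  qed
  ultimately show ?thesis unfolding pd_invariants_def by blast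
qed

lemma capelli_op_eq:
  assumes "j < s" "s \<le> j + k + 1" "(j + k + 1, s) \<in> index_set k" "dagger k l = (j + k + 1, s)"
    and K0: "K0 = 4 * of_nat (s - j) / cap.Hder j s (j + s + k + 1)"
  shows "capelli_op \<omega> k l = app (cap.capelli_sum (j + s + k + 1) (cap.ccoeff j s (j + s + k + 1) K0))"
proof -
  define d where "d = j + s + k + 1"
  let ?\<nu> = "(j + k + 1, s)"
  let ?K = "cap.capelli_sum d (cap.ccoeff j s d K0)" and ?t = "tt k (of_nat d) (of_nat s)"
  define N where "N = nilpotent_part (V_mod \<omega> k ?\<nu>) (casimir \<omega>)"
  have data: "j < s" "d = j + s + k + 1" "2 * s \<le> d" using assms by (auto simp: d_def)
  have wt: "wt ?\<nu> = d" by (simp add: wt_def d_def)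
  have V: "V_mod \<omega> k ?\<nu> = cap.gen_space d ?t" by (simp only: V_mod_eq wt snd_conv)
  have C: "casimir \<omega> p - sp_scale (cas_eig k ?\<nu>) p = - (app cap.T p - sp_scale ?t p)" if "p \<in> hom_spolys d" for p
    using casimir_shift[of p ?\<nu>] that by (simp only: wt snd_conv)
  have hom: "p \<in> hom_spolys d" if "p \<in> cap.gen_space d t" for p t
    using that by (simp add: cap.gen_space_def)
  have C': "casimir \<omega> p - sp_scale (cas_eig k ?\<nu>) p = app (peval [:?t, - 1:] cap.T) p" if "p \<in> hom_spolys d" for p
    using C[OF that] by (simp add: peval_pCons)
  have N: "N p = - (app cap.T p - sp_scale ?t p)" if p: "p \<in> cap.gen_space d ?t" for p
  proof -
    have "N p = casimir \<omega> p - sp_scale (cas_eig k ?\<nu>) p"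
      unfolding N_def V
    proof (rule nilpotent_part_eq)
      show "Vector_Spaces.linear sp_scale sp_scale (casimir \<omega>)"
        unfolding casimir_eq[OF form] by (rule app_linear)
      show "spoly.subspace (cap.gen_space d ?t)" by (rule cap.subspace_gen_space)
      show "casimir \<omega> q \<in> cap.gen_space d ?t" if q: "q \<in> cap.gen_space d ?t" for q
      proof -
        have "casimir \<omega> q = app (peval [:?t, - 1:] cap.T) q + sp_scale (cas_eig k ?\<nu>) q"
          using C'[OF hom[OF q]] by (simp add: algebra_simps)
        then show ?thesis
          using q by (simp only:) (intro spoly.subspace_add[OF cap.subspace_gen_space]
              spoly.subspace_scale[OF cap.subspace_gen_space] cap.gen_space_peval)
      qed
      show "((\<lambda>q. casimir \<omega> q - sp_scale (cas_eig k ?\<nu>) q) ^^ 2) q = 0" if q: "q \<in> cap.gen_space d ?t" for q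
      proof -
        have "((\<lambda>q. casimir \<omega> q - sp_scale (cas_eig k ?\<nu>) q) ^^ 2) q =
            app (peval [:?t, - 1:] cap.T) (app (peval [:?t, - 1:] cap.T) q)"
          using C'[OF hom[OF q]] C'[OF hom[OF cap.gen_space_peval[OF q]]] by (simp add: numeral_2_eq_2)
        also have "\<dots> = app (peval ([:?t, - 1:] * [:?t, - 1:]) cap.T) q"
          by (simp only: peval_mult app_lop)
        also have "[:?t, - 1:] * [:?t, - 1:] = [:- ?t, 1:] ^ 2"
          by (simp add: power2_eq_square)
        also have "app (peval ([:- ?t, 1:] ^ 2) cap.T) q = 0"
          by (rule cap.gen_space_square_zero[OF data q])
        finally show ?thesis .
      qed
    qed (rule p)
    then show ?thesis using C[OF hom[OF p]] by simp
  qed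
  have K_N: "app ?K p = N p" if "p \<in> cap.gen_space d ?t" for p
    using cap.capelli_sum_nilpotent[OF data _ that] K0 N[OF that] by (simp add: d_def)
  have K_0: "app ?K p = 0" if "p \<in> V_mod \<omega> k \<mu>" "\<mu> \<in> index_set k" "wt \<mu> = d" "\<mu> \<noteq> ?\<nu>" for p \<mu>
  proof -
    have "tt k (of_nat d) (of_nat (snd \<mu>)) \<noteq> ?t"
      using index_set_inj[OF that(2) assms(3) that(3) wt] that(4) by auto
    with that show ?thesis
      using cap.capelli_sum_other[OF data] unfolding V_mod_eq by blast
  qed
  have "capelli_op \<omega> k l = op_of_hom \<omega> k ?\<nu> N"
    by (simp add: capelli_op_def assms(4) N_def)
  also have "\<dots> = app ?K"
    unfolding op_of_hom_def wt V
  proof (rule the_equality)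
    show "app ?K \<in> pd_invariants \<omega> \<and> app ?K \<in> pd_part d d \<and>
        (\<forall>p\<in>cap.gen_space d ?t. app ?K p = N p) \<and>
        (\<forall>\<mu>\<in>index_set k. wt \<mu> = d \<and> \<mu> \<noteq> ?\<nu> \<longrightarrow> (\<forall>p\<in>V_mod \<omega> k \<mu>. app ?K p = 0))"
      using capelli_sum_invariant cap.capelli_sum_pd_lop K_N K_0 by (auto simp: pd_part_eq)
  next
    fix D
    assume D: "D \<in> pd_invariants \<omega> \<and> D \<in> pd_part d d \<and>
        (\<forall>p\<in>cap.gen_space d ?t. D p = N p) \<and>
        (\<forall>\<mu>\<in>index_set k. wt \<mu> = d \<and> \<mu> \<noteq> ?\<nu> \<longrightarrow> (\<forall>p\<in>V_mod \<omega> k \<mu>. D p = 0))"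
    then obtain A where A: "D = app A" "A \<in> pd_lop d d" by (auto simp: pd_part_eq)
    \<comment> \<open>Every generalized eigenspace of T in degree d is some V_\<mu>, so both
      operators agree in degree d, and being of order d they agree everywhere.\<close>
    have "app (A - ?K) p = 0" if "p \<in> hom_spolys d" for p
    proof (rule cap.zero_on_hom_spolysI[OF _ that])
      fix i p assume i: "2 * i \<le> d" and p: "p \<in> cap.gen_space d (tt k (of_nat d) (of_nat i))"
      obtain \<mu> where \<mu>: "\<mu> \<in> index_set k" "wt \<mu> = d"
          "tt k (of_nat d) (of_nat (snd \<mu>)) = tt k (of_nat d) (of_nat i)"
        using index_set_representative[OF i] by blast
      have pV: "p \<in> V_mod \<omega> k \<mu>" using p \<mu> by (simp add: V_mod_eq)
      show "app (A - ?K) p = 0"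
      proof (cases "\<mu> = ?\<nu>")
        case True
        then have "p \<in> cap.gen_space d ?t" using pV V by simp
        then show ?thesis using D K_N A(1) by simp
      next
        case False
        then have "D p = 0" using D \<mu> pV by blast
        then show ?thesis using K_0[OF pV \<mu>(1,2) False] A(1) by simp
      qed
    qed
    moreover have "A - ?K \<in> pd_lop d d"
      using A(2) cap.capelli_sum_pd_lop by (rule lop.subspace_diff[OF subspace_pd_lop])
    ultimately have "A - ?K = 0" by (intro pd_lop_eq_0I)
    then show "D = app ?K" using A(1) by simp
  qed
  finally show ?thesis by (simp add: d_def)
qed

lemma capelli_eigenvalue:
  assumes "j < s" "s \<le> j + k + 1"
  shows "poly (cap.capelli_poly (j + s + k + 1) (cap.ccoeff j s (j + s + k + 1) K0) (x + y + of_nat k + 1))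
      (tt k (x + y + of_nat k + 1) y) = K0 * poly2 (knop_sahi (of_nat k) (j + k + 1, s)) x y"
proof -
  define d where "d = j + s + k + 1"
  define r where "r = j + k + 1 - s"
  have data: "j < s" "d = j + s + k + 1" "2 * s \<le> d" and dr: "d - 2 * s = r" "d div 2 = s + r div 2"
    using assms by (auto simp: d_def r_def)
  let ?g = "\<lambda>b. ((x + y + of_nat k + 1 - 2 * of_nat b) gchoose (d - 2 * b)) * (ffact x b * ffact y b)"
  have "poly (cap.capelli_poly d (cap.ccoeff j s d K0) (x + y + of_nat k + 1)) (tt k (x + y + of_nat k + 1) y) =
      (\<Sum>b\<le>d div 2. cap.ccoeff j s d K0 b * 4 ^ b * ?g b)"
    by (rule cap.poly_capelli_poly)
  also have "\<dots> = (\<Sum>b\<in>{s..d div 2}. cap.ccoeff j s d K0 b * 4 ^ b * ?g b)"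
    by (rule sum.mono_neutral_right) (auto simp: cap.ccoeff_def[OF data])
  also have "\<dots> = (\<Sum>a\<le>r div 2. cap.ccoeff j s d K0 (s + a) * 4 ^ (s + a) * ?g (s + a))"
    by (rule sum.reindex_bij_witness[of _ "\<lambda>a. s + a" "\<lambda>b. b - s"]) (auto simp: dr)
  also have "\<dots> = (\<Sum>a\<le>r div 2. K0 * (fact r / (fact a * pochhammer (of_nat (s - j) + 1) a) *
      (((x + y + of_nat k + 1 - 2 * of_nat (s + a)) gchoose (r - 2 * a)) * (ffact x (s + a) * ffact y (s + a)))))"
  proof (rule sum.cong)
    fix a
    have "cap.ccoeff j s d K0 (s + a) * 4 ^ (s + a) = K0 * (fact r / (fact a * pochhammer (of_nat (s - j) + 1) a))"
      by (simp add: cap.ccoeff_def[OF data] dr)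
    moreover have "d - 2 * (s + a) = r - 2 * a" using dr by simp
    ultimately show "cap.ccoeff j s d K0 (s + a) * 4 ^ (s + a) * ?g (s + a) =
        K0 * (fact r / (fact a * pochhammer (of_nat (s - j) + 1) a) *
      (((x + y + of_nat k + 1 - 2 * of_nat (s + a)) gchoose (r - 2 * a)) * (ffact x (s + a) * ffact y (s + a))))"
      by (simp only: mult.assoc)
  qed simp
  also have "\<dots> = K0 * poly2 (knop_sahi (of_nat k) (j + k + 1, s)) x y"
    unfolding poly2_knop_sahi_expansion[OF assms] r_def[symmetric] sum_distrib_left[symmetric] ..
  finally show ?thesis by (simp only: d_def)
qed

text \<open>As 2 \<mu>_2 \<le> |\<mu>| and the even dimension is at least 2, an eigenvector of T
  exists in V_\<mu>, so the set of eigenvalues is not empty.\<close>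

lemma capelli_op_has_single_eigenvalue:
  assumes "j < s" "s \<le> j + k + 1" "\<mu> \<in> index_set k"
  shows "has_single_eigenvalue (app (cap.capelli_sum (j + s + k + 1) (cap.ccoeff j s (j + s + k + 1) K0)))
     (V_mod \<omega> k \<mu>)
     (K0 * poly2 (knop_sahi (of_nat k) (j + k + 1, s)) (of_nat (fst \<mu>) - of_nat k - 1) (of_nat (snd \<mu>)))"
proof -
  let ?x = "of_nat (fst \<mu>) - of_nat k - 1 :: complex" and ?y = "of_nat (snd \<mu>) :: complex"
  have e: "of_nat (wt \<mu>) = ?x + ?y + of_nat k + 1" by (simp add: wt_def)
  have "2 * snd \<mu> \<le> wt \<mu>"
    using assms(3) by (auto simp: index_set_def k_regular_def k_quasiregular_def two_partitions_def wt_def)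
  moreover have "2 \<le> CARD('a)" using dims pos by simp
  ultimately obtain v where v: "v \<in> hom_spolys (wt \<mu>)" "v \<noteq> 0" "app cap.T v = sp_scale (tt k (of_nat (wt \<mu>)) ?y) v"
    using cap.T_eigenvector_exists by blast
  show ?thesis
    unfolding V_mod_eq capelli_eigenvalue[OF assms(1,2), symmetric] e[symmetric]
    by (rule cap.has_single_eigenvalue_gen_space[OF _ v])
      (rule cap.app_capelli_sum, simp add: hom_spolys_iff)
qed

lemma eigenvalue_poly_capelli_op:
  assumes "k_singular k l"
  shows "eigenvalue_poly \<omega> k (capelli_op \<omega> k l) =
    smult [: 4 * (of_nat (fst l) - of_nat (snd l) - of_nat k - 1) /
             of_rat (poly (pderiv (H_poly (dagger k l))) (of_nat k)) :]
      (knop_sahi_at k (dagger k l))"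
proof -
  obtain j s where l: "l = (s + k + 1, j)" and dag: "dagger k l = (j + k + 1, s)"
    and js: "j < s" "s \<le> j + k + 1" "j + k + 1 - s \<le> k" and ind: "(j + k + 1, s) \<in> index_set k"
    using k_singular_obtains[OF assms] by blast
  let ?K0 = "4 * (of_nat (fst l) - of_nat (snd l) - of_nat k - 1) /
             of_rat (poly (pderiv (H_poly (dagger k l))) (of_nat k)) :: complex"
  let ?f = "smult [:?K0:] (knop_sahi_at k (dagger k l))"
  have K0: "?K0 = 4 * of_nat (s - j) / cap.Hder j s (j + s + k + 1)"
  proof -
    have "j + s + k + 1 - 2 * s = j + k + 1 - s" "2 * s \<le> j + s + k + 1" using js by auto
    then have "of_rat (poly (pderiv (H_poly (dagger k l))) (of_nat k)) = cap.Hder j s (j + s + k + 1)"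
      unfolding dag of_rat_pderiv_H_poly[OF js(1,2)] cap.Hder_def[OF js(1) refl \<open>2 * s \<le> j + s + k + 1\<close>] by simp
    moreover have "(of_nat (fst l) - of_nat (snd l) - of_nat k - 1 :: complex) = of_nat (s - j)"
      using js by (simp add: l of_nat_diff)
    ultimately show ?thesis by (simp only:)
  qed
  have ks: "knop_sahi_at k (dagger k l) = knop_sahi (of_nat k) (j + k + 1, s)"
    unfolding dag by (rule knop_sahi_at_eq) (use js in simp)
  have eig: "has_single_eigenvalue (capelli_op \<omega> k l) (V_mod \<omega> k \<mu>)
      (poly2 ?f (of_nat (fst \<mu>) - of_nat k - 1) (of_nat (snd \<mu>)))" if "\<mu> \<in> index_set k" for \<mu>
    using capelli_op_has_single_eigenvalue[OF js(1,2) that, of ?K0]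
    unfolding capelli_op_eq[OF js(1,2) ind dag K0] ks by simp
  show ?thesis
    unfolding eigenvalue_poly_def
  proof (rule the_equality)
    show "symmetric2 ?f \<and> (\<forall>\<mu>\<in>index_set k. has_single_eigenvalue (capelli_op \<omega> k l) (V_mod \<omega> k \<mu>)
        (poly2 ?f (of_nat (fst \<mu>) - of_nat k - 1) (of_nat (snd \<mu>))))"
      using eig symmetric2_smult[OF symmetric2_knop_sahi] unfolding ks by blast
  next
    fix g
    assume g: "symmetric2 g \<and> (\<forall>\<mu>\<in>index_set k. has_single_eigenvalue (capelli_op \<omega> k l) (V_mod \<omega> k \<mu>)
        (poly2 g (of_nat (fst \<mu>) - of_nat k - 1) (of_nat (snd \<mu>))))"
    have "g - ?f = 0"
    \<comment> \<open>All (a, b) with a - b \<ge> 2 k + 3 are regular, and there both candidates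
      take the single eigenvalue. The argument shifts the first variable by -k - 1.\<close>
    proof (rule poly2_eq_0I)
      fix a b :: nat assume ab: "b + (2 * k + 3) \<le> a"
      then have mem: "(a, b) \<in> index_set k"
        by (auto simp: index_set_def k_regular_def two_partitions_def)
      have "poly2 g (of_nat a - of_nat k - 1) (of_nat b) = poly2 ?f (of_nat a - of_nat k - 1) (of_nat b)"
        using eig[OF mem] bspec[OF conjunct2[OF g] mem] by (simp add: has_single_eigenvalue_def del: poly2_smult)
      then show "poly2 (g - ?f) (of_nat a + (- of_nat k - 1)) (of_nat b) = 0"
        by (simp add: algebra_simps del: poly2_smult)
    qed
    then show "g = ?f" by simp
  qed
qed

end

theorem theoremB:
  fixes \<omega> :: "complex ^ ('a::finite + 'b::{finite, linorder}) \<Rightarrow> complex ^ ('a + 'b) \<Rightarrow> complex"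
    and m n k :: nat
    and l :: "nat \<times> nat"
  assumes "0 < m" and "0 < n" and "n = m + k"
    and "CARD('a) = 2 * m" and "CARD('b) = 2 * n"
    and "nondeg_even_supersym \<omega>"
    and "k_singular k l"
  shows "eigenvalue_poly \<omega> k (capelli_op \<omega> k l) =
    smult [: 4 * (of_nat (fst l) - of_nat (snd l) - of_nat k - 1) /
             of_rat (poly (pderiv (H_poly (dagger k l))) (of_nat k)) :]
      (knop_sahi_at k (dagger k l))"
  using eigenvalue_poly_capelli_op[OF assms(6,1,3,4,5,7)] .

end
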